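(* Let $G$ be a group and let $Y$ be a non-trivial locally finite $G$-tree with finitely generated stabilizers. If $f\colon X\to Y$ is any surjective simplicial map of $G$-trees (i.e. a surjective $G$-equivariant simplicial map, where $X$ is a $G$-tree), with $X$ cocompact, then $X$ and $Y$ are in the same deformation space.
   Context: Graphs and trees: every edge $e$ is oriented, with initial vertex $\partial_0(e)$ and terminal vertex $\partial_1(e)$; $\overline{e}$ denotes the same geometric edge with the opposite orientation. Trees are nonempty. A $G$-tree is a simplicial tree together with a $G$-action by simplicial automorphisms, with no inversions. For a vertex or edge $x$, $G_x$ denotes its stabilizer. A $G$-tree is trivial if it has a global fixed point, and non-trivial otherwise. It is locally finite if every vertex has finite valence, and cocompact if the quotient graph by $G$ is finite. "With finitely generated stabilizers" means that all vertex and edge stabilizers are finitely generated. A simplicial map takes vertices to vertices and takes each edge either to an edge or to a vertex (edges may be collapsed). A subgroup $H\subset G$ is elliptic for a $G$-tree if it fixes a vertex of that tree. Elementary collapse: if $e$ is an edge of a $G$-tree $X$ whose endpoints lie in distinct $G$-orbits and such that $G_{\partial_0(e)}=G_e$, then collapsing each edge in the orbit of $e$ to a vertex gives a new $G$-tree; this is an elementary collapse move, and the reverse move is an elementary expansion. Two $G$-trees are in the same deformation space if they are related by a finite sequence of elementary collapse and expansion moves. For cocompact $G$-trees this holds if and only if the two trees have the same elliptic subgroups of $G$. *)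

theory Defs
  imports "Graph_Theory.Graph_Theory" "HOL-Algebra.Group_Action" "HOL-Algebra.Generated_Groups"
begin

section \<open>Trees\<close>

text \<open>
  Graphs are in the sense of Serre: the set of arcs consists of all oriented edges, the tail and
  the head of an arc are its initial and its terminal vertex, and a fixed-point-free involution
  \<open>rv\<close> reverses orientation (\<^const>\<open>bidirected_digraph\<close>).

  A circuit is a closed walk without repeated vertices which does not use both orientations of one
  geometric edge. (The library's \<^const>\<open>forest\<close> is unsuitable here, as \<^const>\<open>pre_digraph.cycle\<close>
  counts the backtracking walk consisting of \<open>e\<close> and \<open>rv e\<close> as a cycle.) Connectedness includes
  nonemptiness.
\<close>

definition circuit :: "('v, 'e) pre_digraph \<Rightarrow> ('e \<Rightarrow> 'e) \<Rightarrow> 'e list \<Rightarrow> bool" where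
  "circuit T rv p \<longleftrightarrow> pre_digraph.cycle T p \<and> (\<forall>e \<in> set p. rv e \<notin> set p)"

definition simplicial_tree :: "('v, 'e) pre_digraph \<Rightarrow> ('e \<Rightarrow> 'e) \<Rightarrow> bool" where
  "simplicial_tree T rv \<longleftrightarrow>
     bidirected_digraph T rv \<and> Digraph_Component.connected T \<and> (\<nexists>p. circuit T rv p)"


section \<open>G-trees\<close>

record ('g, 'v, 'e) G_graph =
  gr :: "('v, 'e) pre_digraph"
  erev :: "'e \<Rightarrow> 'e"
  vact :: "'g \<Rightarrow> 'v \<Rightarrow> 'v"
  eact :: "'g \<Rightarrow> 'e \<Rightarrow> 'e"

abbreviation gverts :: "('g, 'v, 'e) G_graph \<Rightarrow> 'v set" where "gverts X \<equiv> verts (gr X)"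
abbreviation gedges :: "('g, 'v, 'e) G_graph \<Rightarrow> 'e set" where "gedges X \<equiv> arcs (gr X)"
abbreviation bd0 :: "('g, 'v, 'e) G_graph \<Rightarrow> 'e \<Rightarrow> 'v" where "bd0 X \<equiv> tail (gr X)"
abbreviation bd1 :: "('g, 'v, 'e) G_graph \<Rightarrow> 'e \<Rightarrow> 'v" where "bd1 X \<equiv> head (gr X)"

definition G_tree :: "('g, 'm) monoid_scheme \<Rightarrow> ('g, 'v, 'e) G_graph \<Rightarrow> bool" where
  "G_tree G X \<longleftrightarrow>
     simplicial_tree (gr X) (erev X) \<and>
     group_action G (gverts X) (vact X) \<and>
     group_action G (gedges X) (eact X) \<and>
     (\<forall>g \<in> carrier G. \<forall>e \<in> gedges X.
        bd0 X (eact X g e) = vact X g (bd0 X e) \<and>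
        bd1 X (eact X g e) = vact X g (bd1 X e) \<and>
        eact X g (erev X e) = erev X (eact X g e) \<and>
        eact X g e \<noteq> erev X e)"

text \<open>
  As there are no inversions, a point of the geometric realization in the interior of an edge can
  only be fixed by the group if both ends of that edge are fixed, so it suffices to look for fixed
  vertices.
\<close>

definition trivial_G_tree :: "('g, 'm) monoid_scheme \<Rightarrow> ('g, 'v, 'e) G_graph \<Rightarrow> bool" where
  "trivial_G_tree G X \<longleftrightarrow> (\<exists>v \<in> gverts X. \<forall>g \<in> carrier G. vact X g v = v)"

definition locally_finite :: "('g, 'v, 'e) G_graph \<Rightarrow> bool" where
  "locally_finite X \<longleftrightarrow> (\<forall>v \<in> gverts X. finite (out_arcs (gr X) v))"

definition cocompact :: "('g, 'm) monoid_scheme \<Rightarrow> ('g, 'v, 'e) G_graph \<Rightarrow> bool" where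
  "cocompact G X \<longleftrightarrow> finite (orbits G (gverts X) (vact X)) \<and> finite (orbits G (gedges X) (eact X))"

definition finitely_generated :: "('g, 'm) monoid_scheme \<Rightarrow> 'g set \<Rightarrow> bool" where
  "finitely_generated G H \<longleftrightarrow> (\<exists>S. finite S \<and> S \<subseteq> carrier G \<and> H = generate G S)"

definition fg_stabilizers :: "('g, 'm) monoid_scheme \<Rightarrow> ('g, 'v, 'e) G_graph \<Rightarrow> bool" where
  "fg_stabilizers G X \<longleftrightarrow>
     (\<forall>v \<in> gverts X. finitely_generated G (stabilizer G (vact X) v)) \<and>
     (\<forall>e \<in> gedges X. finitely_generated G (stabilizer G (eact X) e))"


section \<open>Maps\<close>

text \<open>
  A simplicial map consists of a map \<open>fv\<close> on vertices and a map \<open>fe\<close> on oriented edges; \<open>fe e\<close> is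
  \<open>Inl w\<close> if \<open>e\<close> is collapsed to the vertex \<open>w\<close>, and \<open>Inr e'\<close> if \<open>e\<close> is mapped to the edge \<open>e'\<close>.
\<close>

definition simplicial_map ::
  "('g, 'v, 'e) G_graph \<Rightarrow> ('g, 'w, 'f) G_graph \<Rightarrow> ('v \<Rightarrow> 'w) \<Rightarrow> ('e \<Rightarrow> 'w + 'f) \<Rightarrow> bool" where
  "simplicial_map X Y fv fe \<longleftrightarrow>
     (\<forall>v \<in> gverts X. fv v \<in> gverts Y) \<and>
     (\<forall>e \<in> gedges X. case fe e of
          Inl w \<Rightarrow> fv (bd0 X e) = w \<and> fv (bd1 X e) = w \<and> fe (erev X e) = Inl w
        | Inr e' \<Rightarrow> e' \<in> gedges Y \<and> fv (bd0 X e) = bd0 Y e' \<and> fv (bd1 X e) = bd1 Y e' \<and>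
                    fe (erev X e) = Inr (erev Y e'))"

definition equivariant_map :: "('g, 'm) monoid_scheme \<Rightarrow>
  ('g, 'v, 'e) G_graph \<Rightarrow> ('g, 'w, 'f) G_graph \<Rightarrow> ('v \<Rightarrow> 'w) \<Rightarrow> ('e \<Rightarrow> 'w + 'f) \<Rightarrow> bool" where
  "equivariant_map G X Y fv fe \<longleftrightarrow>
     (\<forall>g \<in> carrier G.
        (\<forall>v \<in> gverts X. fv (vact X g v) = vact Y g (fv v)) \<and>
        (\<forall>e \<in> gedges X. fe (eact X g e) = map_sum (vact Y g) (eact Y g) (fe e)))"

definition surjective_map ::
  "('g, 'v, 'e) G_graph \<Rightarrow> ('g, 'w, 'f) G_graph \<Rightarrow> ('v \<Rightarrow> 'w) \<Rightarrow> ('e \<Rightarrow> 'w + 'f) \<Rightarrow> bool" where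
  "surjective_map X Y fv fe \<longleftrightarrow> gverts Y \<subseteq> fv ` gverts X \<and> Inr ` gedges Y \<subseteq> fe ` gedges X"

definition isomorphic_G_graphs :: "('g, 'm) monoid_scheme \<Rightarrow>
  ('g, 'v, 'e) G_graph \<Rightarrow> ('g, 'w, 'f) G_graph \<Rightarrow> bool" where
  "isomorphic_G_graphs G X Y \<longleftrightarrow>
     (\<exists>fv fe. bij_betw fv (gverts X) (gverts Y) \<and> bij_betw fe (gedges X) (gedges Y) \<and>
        (\<forall>e \<in> gedges X. fv (bd0 X e) = bd0 Y (fe e) \<and> fv (bd1 X e) = bd1 Y (fe e) \<and>
                   fe (erev X e) = erev Y (fe e)) \<and>
        (\<forall>g \<in> carrier G. (\<forall>v \<in> gverts X. fv (vact X g v) = vact Y g (fv v)) \<and>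
                          (\<forall>e \<in> gedges X. fe (eact X g e) = eact Y g (fe e))))"


section \<open>Elementary moves and deformation spaces\<close>

definition collapsed_edges ::
  "('g, 'm) monoid_scheme \<Rightarrow> ('g, 'v, 'e) G_graph \<Rightarrow> 'e \<Rightarrow> 'e set" where
  "collapsed_edges G X e = orbit G (eact X) e \<union> orbit G (eact X) (erev X e)"

text \<open>The vertices of the quotient are the components of the union of the collapsed edges.\<close>

definition collapse_class ::
  "('g, 'm) monoid_scheme \<Rightarrow> ('g, 'v, 'e) G_graph \<Rightarrow> 'e \<Rightarrow> 'v \<Rightarrow> 'v set" where
  "collapse_class G X e v = {w. (v, w) \<in> ((\<lambda>a. (bd0 X a, bd1 X a)) ` collapsed_edges G X e)\<^sup>*}"

text \<open>
  The reversal is the identity off the arcs, and the actions are extensional, as required by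
  \<^const>\<open>bidirected_digraph\<close> and \<^const>\<open>group_action\<close>.
\<close>

definition collapse ::
  "('g, 'm) monoid_scheme \<Rightarrow> ('g, 'v, 'e) G_graph \<Rightarrow> 'e \<Rightarrow> ('g, 'v set, 'e) G_graph" where
  "collapse G X e =
     (let V' = collapse_class G X e ` gverts X; E' = gedges X - collapsed_edges G X e in
      \<lparr> gr = \<lparr> verts = V', arcs = E',
               tail = (\<lambda>a. collapse_class G X e (bd0 X a)),
               head = (\<lambda>a. collapse_class G X e (bd1 X a)) \<rparr>,
        erev = (\<lambda>a. if a \<in> E' then erev X a else a),
        vact = (\<lambda>g. \<lambda>S \<in> V'. vact X g ` S),
        eact = (\<lambda>g. \<lambda>a \<in> E'. eact X g a) \<rparr>)"

definition elementary_collapse :: "('g, 'm) monoid_scheme \<Rightarrow>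
  ('g, 'v, 'e) G_graph \<Rightarrow> ('g, 'w, 'f) G_graph \<Rightarrow> bool" where
  "elementary_collapse G X X' \<longleftrightarrow>
     G_tree G X \<and> G_tree G X' \<and>
     (\<exists>e \<in> gedges X. orbit G (vact X) (bd0 X e) \<noteq> orbit G (vact X) (bd1 X e) \<and>
                stabilizer G (vact X) (bd0 X e) = stabilizer G (eact X) e \<and>
                isomorphic_G_graphs G (collapse G X e) X')"

definition elementary_move :: "('g, 'm) monoid_scheme \<Rightarrow>
  ('g, 'v, 'e) G_graph \<Rightarrow> ('g, 'v, 'e) G_graph \<Rightarrow> bool" where
  "elementary_move G X X' \<longleftrightarrow> elementary_collapse G X X' \<or> elementary_collapse G X' X"

text \<open>
  The trees in a sequence of moves starting at \<open>X\<close> need a common type, into which \<open>X\<close> and \<open>Y\<close> are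
  moved by isomorphisms. The type used here is large enough for every such sequence: a
  collapse passes to a quotient of the vertices and a subset of the edges, and an expansion adds one
  orbit of vertices and two orbits of oriented edges, and an orbit has at most as many
  elements as the group.
\<close>

definition same_deformation_space :: "('g, 'm) monoid_scheme \<Rightarrow>
  ('g, 'v, 'e) G_graph \<Rightarrow> ('g, 'w, 'f) G_graph \<Rightarrow> bool" where
  "same_deformation_space G X Y \<longleftrightarrow>
     G_tree G X \<and> G_tree G Y \<and>
     (\<exists>Z Z' :: ('g, 'v + 'g \<times> nat, 'e + 'g \<times> nat) G_graph.
        G_tree G Z \<and> G_tree G Z' \<and>
        isomorphic_G_graphs G X Z \<and> (elementary_move G)\<^sup>*\<^sup>* Z Z' \<and> isomorphic_G_graphs G Z' Y)"

end

theory Submission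
  imports Defs
begin

text \<open>
  Three facts carry the proof.

  First, every vertex stabilizer \<open>H = G_y\<close> of \<open>Y\<close> is elliptic in \<open>X\<close> (lemma \<open>elliptic\<close>). As
  \<open>H\<close> is finitely generated, \<open>X\<close> has an \<open>H\<close>-invariant subtree \<open>T\<close> that is the union of the
  translates of a finite set, so the image of \<open>T\<close> lies within some distance \<open>r\<close> of \<open>y\<close>. If \<open>T\<close>
  meets all its translates \<open>g T\<close>, then every \<open>g y\<close> is within distance \<open>2 r\<close> of \<open>y\<close>. Then \<open>G y\<close>
  is finite, because \<open>Y\<close> is locally finite, and \<open>G\<close> fixes a vertex of \<open>Y\<close>, contrary to
  non-triviality. Otherwise \<open>T\<close> and some \<open>g T\<close> are disjoint, and the stabilizer of both \<open>y\<close>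
  and \<open>g y\<close> fixes the point of \<open>T\<close> closest to \<open>g T\<close>. That stabilizer has finite index in \<open>H\<close>,
  again by local finiteness, so \<open>H\<close> has a finite orbit in \<open>X\<close> and therefore a fixed vertex.
  Choosing fixed vertices equivariantly gives an equivariant map \<open>s\<close> from the vertices of \<open>Y\<close>
  to those of \<open>X\<close>.

  Secondly, with \<open>s\<close> at hand two kinds of operations on \<open>X\<close> are elementary moves compatible
  with the map \<open>f\<close> to \<open>Y\<close>. If \<open>f\<close> sends both ends of an edge to \<open>y\<close>, the stabilizers of both
  ends fix \<open>s y\<close>. Seen from one end, \<open>s y\<close> lies in the direction of the edge, so the
  stabilizer of that end fixes the edge. Its ends lie in different orbits, because an element
  carrying one end to the other would fix \<open>s y\<close> and so preserve distances from it. Hence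
  collapsing it is an elementary collapse (\<open>collapse_exists\<close>). For a vertex \<open>x\<close> of \<open>X\<close> and a
  neighbour \<open>y\<close> of \<open>f x\<close>, one can add a new vertex over \<open>y\<close>, joined to \<open>x\<close> by an edge whose
  stabilizer is the whole stabilizer of \<open>(x, y)\<close>, and move to the new vertex all edges at \<open>x\<close>
  whose other end lies over \<open>y\<close>. This is an elementary expansion, here called a pull. The
  moved edges are now collapsed by \<open>f\<close>, and a pull followed by their collapse is a fold of
  \<open>X\<close>.

  Thirdly, finitely many pulls and collapses turn \<open>X\<close> into \<open>Y\<close> (\<open>deforms_to_target\<close>). Pulling
  at \<open>s y\<close> in the direction of \<open>y\<close> brings \<open>f (s y)\<close> closer to \<open>y\<close>, so \<open>s\<close> may be assumed to be
  a section of \<open>f\<close>. Each edge of \<open>Y\<close> then gives a path in \<open>X\<close> between the images of its ends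
  under \<open>s\<close>. As long as such a path has more than one edge, its image backtracks, and pulling
  there shortens it. Once all these paths are edges, \<open>s\<close> embeds \<open>Y\<close> in \<open>X\<close>, and pulling at an
  edge that leaves the embedded copy reduces the number of orbits of edges that \<open>f\<close> does not
  collapse. The process ends with an isomorphism \<open>f\<close>. Cocompactness makes the measures finite.
  Since paths are measured by the number of their edges that \<open>f\<close> does not collapse, pulls and
  collapses never increase the length.

  Throughout, a tree is handled as a symmetric relation on its vertices; edges of a tree are
  determined by their ends, so nothing is lost.
\<close>

section \<open>Trees as symmetric relations\<close>

text \<open>
  Acyclicity is expressed by saying that every edge is a bridge. This form passes most easily
  to quotients and expansions; unique directions and distances are derived from it below.
\<close>

locale rel_tree =
  fixes V :: "'a set" and E :: "('a \<times> 'a) set"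
  assumes edge_verts: "(a, b) \<in> E \<Longrightarrow> a \<in> V \<and> b \<in> V"
    and edge_sym: "(a, b) \<in> E \<Longrightarrow> (b, a) \<in> E"
    and edge_irrefl: "(a, a) \<notin> E"
    and nonempty: "V \<noteq> {}"
    and connected: "a \<in> V \<Longrightarrow> b \<in> V \<Longrightarrow> (a, b) \<in> E\<^sup>*"
    and bridge: "(a, b) \<in> E \<Longrightarrow> (a, b) \<notin> (E - {(a, b), (b, a)})\<^sup>*"

definition avoid :: "('a \<times> 'a) set \<Rightarrow> 'a \<Rightarrow> ('a \<times> 'a) set" where
  "avoid E v = {(a, b) \<in> E. a \<noteq> v \<and> b \<noteq> v}"

definition tdist :: "('a \<times> 'a) set \<Rightarrow> 'a \<Rightarrow> 'a \<Rightarrow> nat" where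
  "tdist E a b = (LEAST n. (a, b) \<in> E ^^ n)"

lemma rtrancl_sym_set: "(\<And>a b. (a, b) \<in> R \<Longrightarrow> (b, a) \<in> R) \<Longrightarrow> (x, y) \<in> R\<^sup>* \<Longrightarrow> (y, x) \<in> R\<^sup>*"
  by (meson symI sym_rtrancl symD)

lemma rtrancl_closed:
  "(x, y) \<in> R\<^sup>* \<Longrightarrow> x \<in> S \<Longrightarrow> (\<And>a b. a \<in> S \<Longrightarrow> (a, b) \<in> R \<Longrightarrow> b \<in> S) \<Longrightarrow> y \<in> S"
  by (induction rule: rtrancl_induct) auto

lemma rtrancl_map:
  "(x, y) \<in> R\<^sup>* \<Longrightarrow> (\<And>a b. (a, b) \<in> R \<Longrightarrow> (h a, h b) \<in> Q\<^sup>*) \<Longrightarrow> (h x, h y) \<in> Q\<^sup>*"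
  by (induction rule: rtrancl_induct) (auto intro: rtrancl_trans)

lemma avoid_start: "(x, y) \<in> (avoid E v)\<^sup>* \<Longrightarrow> x \<noteq> v \<Longrightarrow> y \<noteq> v"
  by (induction rule: rtrancl_induct) (auto simp: avoid_def)

lemma avoid_sub: "(x, y) \<in> (avoid E v)\<^sup>* \<Longrightarrow> (x, y) \<in> E\<^sup>*"
  by (rule rtrancl_mono[THEN subsetD]) (auto simp: avoid_def)

context rel_tree
begin

lemma edge_neq: "(a, b) \<in> E \<Longrightarrow> a \<noteq> b"
  using edge_irrefl by auto

lemma avoid_sym: "(x, y) \<in> (avoid E v)\<^sup>* \<Longrightarrow> (y, x) \<in> (avoid E v)\<^sup>*"
  by (rule rtrancl_sym_set) (auto simp: avoid_def edge_sym)

text \<open>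
  A connection between two neighbours of \<open>v\<close> that misses \<open>v\<close> would bypass the edge from \<open>v\<close> to
  one of them. So distinct neighbours of \<open>v\<close> lie in distinct branches at \<open>v\<close>.
\<close>

lemma branch_unique:
  assumes "(v, a) \<in> E" "(v, b) \<in> E" "(a, b) \<in> (avoid E v)\<^sup>*"
  shows "a = b"
proof (rule ccontr)
  assume ne: "a \<noteq> b"
  let ?R = "E - {(v, a), (a, v)}"
  have "(b, a) \<in> (avoid E v)\<^sup>*"
    using assms(3) by (rule avoid_sym)
  then have "(b, a) \<in> ?R\<^sup>*"
    by (rule rtrancl_mono[THEN subsetD, rotated]) (auto simp: avoid_def)
  moreover have "(v, b) \<in> ?R"
    using assms ne edge_neq by auto
  ultimately have "(v, a) \<in> ?R\<^sup>*" by (rule converse_rtrancl_into_rtrancl[rotated])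
  then show False using bridge assms(1) by blast
qed

lemma tdist_le: "(a, b) \<in> E ^^ n \<Longrightarrow> tdist E a b \<le> n"
  unfolding tdist_def by (rule Least_le)

lemma tdist_walk: "a \<in> V \<Longrightarrow> b \<in> V \<Longrightarrow> (a, b) \<in> E ^^ tdist E a b"
  unfolding tdist_def using connected[of a b] by (metis LeastI rtrancl_imp_relpow)

lemma tdist_self [simp]: "tdist E a a = 0"
  using tdist_le[of a a 0] by simp

lemma tdist_eq_0: "a \<in> V \<Longrightarrow> b \<in> V \<Longrightarrow> tdist E a b = 0 \<longleftrightarrow> a = b"
  using tdist_walk[of a b] by auto

lemma relpow_sym: "(a, b) \<in> E ^^ n \<Longrightarrow> (b, a) \<in> E ^^ n"
  by (induction n arbitrary: b) (auto intro: relpow_Suc_I2 dest: edge_sym simp del: relpow.simps(2) elim!: relpow_Suc_E)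

lemma tdist_sym: "a \<in> V \<Longrightarrow> b \<in> V \<Longrightarrow> tdist E a b = tdist E b a"
  by (meson antisym relpow_sym tdist_le tdist_walk)

lemma tdist_triangle:
  assumes "a \<in> V" "b \<in> V" "c \<in> V"
  shows "tdist E a c \<le> tdist E a b + tdist E b c"
  using tdist_walk[OF assms(1,2)] tdist_walk[OF assms(2,3)] tdist_le
  by (metis relcompI relpow_add)

lemma tdist_edge: "(a, b) \<in> E \<Longrightarrow> tdist E a b = 1"
  using tdist_le[of a b 1] tdist_eq_0[of a b] edge_verts[of a b] edge_neq[of a b] by force

lemma tdist_edge_le: "(a, b) \<in> E \<Longrightarrow> z \<in> V \<Longrightarrow> tdist E a z \<le> Suc (tdist E b z)"
  using tdist_triangle[of a b z] tdist_edge[of a b] edge_verts[of a b] by auto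

text \<open>
  A vertex \<open>v\<close> on a geodesic from \<open>a\<close> to \<open>z\<close>, other than \<open>a\<close>, is closer to \<open>z\<close> than \<open>a\<close> is.
\<close>

lemma short_walk_avoids:
  assumes "(a, z) \<in> E ^^ n" "n = tdist E a z" "z \<in> V" "v \<in> V" "a \<in> V"
    "tdist E v z \<ge> n" "a \<noteq> v"
  shows "(a, z) \<in> (avoid E v)\<^sup>*"
  using assms
proof (induction n arbitrary: a)
  case 0
  then show ?case by auto
next
  case (Suc n)
  from Suc.prems(1) obtain b where b: "(a, b) \<in> E" "(b, z) \<in> E ^^ n"
    by (meson relpow_Suc_D2)
  have bn: "tdist E b z \<le> n" using b tdist_le by blast
  moreover have "tdist E a z \<le> Suc (tdist E b z)" using b Suc.prems tdist_edge_le by blast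
  ultimately have d: "n = tdist E b z" using Suc.prems by linarith
  moreover have bv: "b \<noteq> v" using d Suc.prems by auto
  ultimately have "(b, z) \<in> (avoid E v)\<^sup>*"
    using Suc b edge_verts by auto
  moreover have "(a, b) \<in> avoid E v" using b bv Suc.prems by (auto simp: avoid_def)
  ultimately show ?case by (rule converse_rtrancl_into_rtrancl[rotated])
qed

lemma closer_avoids:
  assumes "a \<in> V" "z \<in> V" "v \<in> V" "tdist E a z \<le> tdist E v z" "a \<noteq> v"
  shows "(a, z) \<in> (avoid E v)\<^sup>*"
  using short_walk_avoids[OF tdist_walk[OF assms(1,2)] refl] assms by auto

lemma closer_nbr_exists:
  assumes "v \<in> V" "z \<in> V" "v \<noteq> z"
  shows "\<exists>a. (v, a) \<in> E \<and> tdist E v z = Suc (tdist E a z)"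
proof -
  obtain n where n: "tdist E v z = Suc n" using tdist_eq_0 assms by (meson not0_implies_Suc)
  then have "(v, z) \<in> E ^^ Suc n" using tdist_walk assms by metis
  then obtain a where a: "(v, a) \<in> E" "(a, z) \<in> E ^^ n" by (meson relpow_Suc_D2)
  then have "tdist E a z \<le> n" using tdist_le by blast
  moreover have "tdist E v z \<le> Suc (tdist E a z)" using a assms tdist_edge_le by blast
  ultimately show ?thesis using a n by force
qed

text \<open>
  The direction from \<open>v\<close> to \<open>z\<close>: the neighbour of \<open>v\<close> in the branch at \<open>v\<close> that contains \<open>z\<close>.
  By \<open>branch_unique\<close> it does not depend on the choice, so an automorphism that fixes \<open>v\<close> and
  \<open>z\<close> fixes this neighbour as well.
\<close>

definition toward :: "'a \<Rightarrow> 'a \<Rightarrow> 'a" where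
  "toward v z = (SOME a. (v, a) \<in> E \<and> (a, z) \<in> (avoid E v)\<^sup>*)"

lemma closer_nbr_avoids:
  assumes "(v, a) \<in> E" "tdist E v z = Suc (tdist E a z)" "z \<in> V"
  shows "(a, z) \<in> (avoid E v)\<^sup>*"
  using closer_avoids[of a z v] assms edge_verts[of v a] edge_neq[of v a] by auto

lemma toward:
  assumes "v \<in> V" "z \<in> V" "v \<noteq> z"
  shows toward_edge: "(v, toward v z) \<in> E"
    and toward_avoids: "(toward v z, z) \<in> (avoid E v)\<^sup>*"
  using closer_nbr_exists[OF assms] closer_nbr_avoids[OF _ _ assms(2)]
  unfolding toward_def by (metis (mono_tags, lifting) someI_ex)+

lemma toward_eq:
  assumes "(v, a) \<in> E" "(a, z) \<in> (avoid E v)\<^sup>*"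
  shows "toward v z = a"
proof -
  have "z \<noteq> v" using avoid_start[OF assms(2)] edge_neq[OF assms(1)] by auto
  moreover have "v \<in> V" using assms edge_verts by auto
  moreover have "z \<in> V" using avoid_sub[OF assms(2)] edge_verts[OF assms(1)]
    by (induction rule: rtrancl_induct) (auto dest: edge_verts)
  ultimately have "(v, toward v z) \<in> E" "(toward v z, z) \<in> (avoid E v)\<^sup>*"
    using toward by auto
  with assms show ?thesis
    using branch_unique avoid_sym by (meson rtrancl_trans)
qed

lemma toward_dist:
  assumes "v \<in> V" "z \<in> V" "v \<noteq> z"
  shows "tdist E v z = Suc (tdist E (toward v z) z)"
  using closer_nbr_exists[OF assms] closer_nbr_avoids[OF _ _ assms(2)] toward_eq by metis

text \<open>
  If \<open>v\<close> and \<open>w\<close> were equally far from \<open>z\<close>, a geodesic from \<open>w\<close> to \<open>z\<close> would miss \<open>v\<close>, so \<open>w\<close>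
  would be the direction from \<open>v\<close> to \<open>z\<close>, and moving in that direction reduces the distance.
\<close>

lemma adjacent_dist_neq:
  assumes "(v, w) \<in> E" "z \<in> V"
  shows "tdist E v z \<noteq> tdist E w z"
proof
  assume eq: "tdist E v z = tdist E w z"
  have vw: "v \<in> V" "w \<in> V" "v \<noteq> w" using assms edge_verts edge_neq by auto
  have "(w, z) \<in> (avoid E v)\<^sup>*" using closer_avoids[of w z v] vw eq assms by auto
  then have tw: "toward v z = w" using assms toward_eq by blast
  show False
  proof (cases "v = z")
    case True
    then show ?thesis using eq vw tdist_eq_0 by (metis tdist_self)
  next
    case False
    then show ?thesis using toward_dist[of v z] tw eq vw assms by auto
  qed
qed

lemma away_dist:
  assumes "(v, w) \<in> E" "z \<in> V" "z = v \<or> toward v z \<noteq> w"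
  shows "tdist E w z = Suc (tdist E v z)"
proof -
  have vw: "v \<in> V" "w \<in> V" using assms edge_verts by auto
  have "tdist E w z \<le> Suc (tdist E v z)" "tdist E v z \<le> Suc (tdist E w z)"
    using tdist_edge_le assms edge_sym by blast+
  moreover have "tdist E v z \<noteq> tdist E w z" using adjacent_dist_neq assms by blast
  moreover have "tdist E v z \<noteq> Suc (tdist E w z)"
  proof
    assume "tdist E v z = Suc (tdist E w z)"
    then have "toward v z = w" "v \<noteq> z"
      using assms closer_nbr_avoids toward_eq by auto
    then show False using assms by auto
  qed
  ultimately show ?thesis by linarith
qed

text \<open>
  One end of an edge is closer to \<open>z\<close>, and then the direction to \<open>z\<close> at the other end is along
  this edge. This alternative decides which end stabilizer is contained in the other.
\<close>

lemma toward_either: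
  assumes "(v, w) \<in> E" "z \<in> V"
  obtains "toward v z = w" "v \<noteq> z" | "toward w z = v" "w \<noteq> z"
proof -
  have vw: "v \<in> V" "w \<in> V" using assms edge_verts by auto
  show thesis
  proof (cases "z = v \<or> toward v z \<noteq> w")
    case True
    then have d: "tdist E w z = Suc (tdist E v z)" using away_dist assms by blast
    then have "toward w z = v" "w \<noteq> z"
      using closer_nbr_avoids toward_eq assms edge_sym by (blast, auto)
    then show ?thesis using that by blast
  next
    case False
    then show ?thesis using that by blast
  qed
qed

text \<open>
  Each vertex has only one neighbour closer to the starting point, namely the one the walk
  came from; a walk that does not turn back therefore moves away at each step.
\<close>

lemma nonbacktracking_dist:
  assumes "\<And>i. i < n \<Longrightarrow> (p i, p (Suc i)) \<in> E" "\<And>i. Suc i < n \<Longrightarrow> p i \<noteq> p (Suc (Suc i))"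
    and "p 0 \<in> V"
  shows "tdist E (p n) (p 0) = n"
proof -
  have "i < n \<Longrightarrow> tdist E (p i) (p 0) = i \<and> tdist E (p (Suc i)) (p 0) = Suc i" for i
  proof (induction i)
    case 0
    then show ?case using assms(1)[of 0] tdist_edge edge_sym by auto
  next
    case (Suc i)
    have IH: "tdist E (p i) (p 0) = i" "tdist E (p (Suc i)) (p 0) = Suc i"
      using Suc by auto
    have e: "(p (Suc i), p i) \<in> E" "(p (Suc i), p (Suc (Suc i))) \<in> E"
      using assms(1)[of i] assms(1)[of "Suc i"] Suc.prems edge_sym by auto
    have "toward (p (Suc i)) (p 0) = p i"
      using closer_nbr_avoids[OF e(1)] IH assms(3) toward_eq e(1) by auto
    then have "toward (p (Suc i)) (p 0) \<noteq> p (Suc (Suc i))"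
      using assms(2) Suc.prems by auto
    then show ?case using away_dist[OF e(2)] assms(3) IH by auto
  qed
  then show ?thesis by (cases n) auto
qed

text \<open>
  Every walk between vertices in different branches at \<open>v\<close> passes through \<open>v\<close>.
\<close>

lemma through_vertex:
  assumes "x \<in> V" "w \<in> V" "v \<in> V" "x \<noteq> v" "w \<noteq> v" "toward v x \<noteq> toward v w"
  shows "tdist E x v + tdist E v w \<le> tdist E x w"
proof -
  have key: "(a, b) \<in> (avoid E v)\<^sup>* \<or> (\<exists>k\<le>n. (a, v) \<in> E ^^ k \<and> (v, b) \<in> E ^^ (n - k))"
    if "(a, b) \<in> E ^^ n" for n a b
    using that
  proof (induction n arbitrary: b)
    case 0
    then show ?case by auto
  next
    case (Suc n)
    from Suc.prems obtain c where c: "(a, c) \<in> E ^^ n" "(c, b) \<in> E" by auto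
    consider "(a, c) \<in> (avoid E v)\<^sup>*" | k where "k \<le> n" "(a, v) \<in> E ^^ k" "(v, c) \<in> E ^^ (n - k)"
      using Suc.IH[OF c(1)] by blast
    then show ?case
    proof cases
      case 1
      show ?thesis
      proof (cases "b = v")
        case True
        then show ?thesis using Suc.prems by (intro disjI2 exI[of _ "Suc n"]) auto
      next
        case False
        show ?thesis
        proof (cases "c = v")
          case True
          then show ?thesis using c by (intro disjI2 exI[of _ n]) auto
        next
          case False
          then have "(c, b) \<in> avoid E v" using \<open>b \<noteq> v\<close> c by (auto simp: avoid_def)
          then show ?thesis using 1 by (meson rtrancl.rtrancl_into_rtrancl)
        qed
      qed
    next
      case 2
      then have "(v, b) \<in> E ^^ Suc (n - k)" using c by auto
      then have "(v, b) \<in> E ^^ (Suc n - k)" using 2 by (simp add: Suc_diff_le)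
      then show ?thesis using 2 by (intro disjI2 exI[of _ k]) auto
    qed
  qed
  have "(x, w) \<notin> (avoid E v)\<^sup>*"
  proof
    assume "(x, w) \<in> (avoid E v)\<^sup>*"
    moreover have "(toward v x, x) \<in> (avoid E v)\<^sup>*"
      using toward_avoids[of v x] assms by auto
    ultimately have "(toward v x, w) \<in> (avoid E v)\<^sup>*"
      by (rule rtrancl_trans[rotated])
    then have "toward v w = toward v x" using toward_eq toward_edge[of v x] assms by auto
    then show False using assms by auto
  qed
  then obtain k where k: "k \<le> tdist E x w" "(x, v) \<in> E ^^ k" "(v, w) \<in> E ^^ (tdist E x w - k)"
    using key[OF tdist_walk[OF assms(1,2)]] by blast
  then have "tdist E x v \<le> k" "tdist E v w \<le> tdist E x w - k" using tdist_le by auto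
  then show ?thesis using k by linarith
qed

end

section \<open>Group actions on trees and elliptic subgroups\<close>

locale set_action = group G
  for G :: "('g, 'm) monoid_scheme" (structure) +
  fixes V :: "'a set" and act :: "'g \<Rightarrow> 'a \<Rightarrow> 'a"
  assumes act_closed: "g \<in> carrier G \<Longrightarrow> v \<in> V \<Longrightarrow> act g v \<in> V"
    and act_one: "v \<in> V \<Longrightarrow> act \<one> v = v"
    and act_mult: "g \<in> carrier G \<Longrightarrow> h \<in> carrier G \<Longrightarrow> v \<in> V \<Longrightarrow> act (g \<otimes> h) v = act g (act h v)"
begin

lemma act_inv [simp]: "g \<in> carrier G \<Longrightarrow> v \<in> V \<Longrightarrow> act (inv g) (act g v) = v"
  using act_mult[of "inv g" g v] act_one by auto

lemma act_inv2 [simp]: "g \<in> carrier G \<Longrightarrow> v \<in> V \<Longrightarrow> act g (act (inv g) v) = v"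
  using act_mult[of g "inv g" v] act_one by auto

lemma act_inj: "g \<in> carrier G \<Longrightarrow> a \<in> V \<Longrightarrow> b \<in> V \<Longrightarrow> act g a = act g b \<longleftrightarrow> a = b"
  by (metis act_inv)

lemma inv_fixes: "g \<in> carrier G \<Longrightarrow> v \<in> V \<Longrightarrow> act g v = v \<Longrightarrow> act (inv g) v = v"
  by (metis act_inv)

lemma orbit_self: "v \<in> V \<Longrightarrow> v \<in> orbit G act v"
  using act_one one_closed by (force simp: orbit_def)

lemma orbit_sub: "v \<in> V \<Longrightarrow> orbit G act v \<subseteq> V"
  using act_closed by (auto simp: orbit_def)

lemma orbit_act: "g \<in> carrier G \<Longrightarrow> v \<in> V \<Longrightarrow> orbit G act (act g v) = orbit G act v"
proof -
  have sub: "orbit G act (act g v) \<subseteq> orbit G act v" if "g \<in> carrier G" "v \<in> V" for g v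
    using that act_mult[symmetric] by (auto simp: orbit_def)
  assume g: "g \<in> carrier G" "v \<in> V"
  then have "orbit G act (act (inv g) (act g v)) \<subseteq> orbit G act (act g v)"
    using sub[of "inv g" "act g v"] act_closed by blast
  then have "orbit G act v \<subseteq> orbit G act (act g v)" using g by simp
  then show ?thesis using sub[OF g] by auto
qed

lemma orbit_eq_iff: "v \<in> V \<Longrightarrow> w \<in> V \<Longrightarrow> orbit G act v = orbit G act w \<longleftrightarrow> w \<in> orbit G act v"
proof
  assume "w \<in> orbit G act v" "v \<in> V" then show "orbit G act v = orbit G act w"
    using orbit_act by (auto simp: orbit_def[of _ _ v])
qed (use orbit_self in auto)

end

locale G_rel_tree = set_action G V act + rel_tree V E
  for G :: "('g, 'm) monoid_scheme" (structure) and V :: "'a set" and E and act +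
  assumes act_edge: "g \<in> carrier G \<Longrightarrow> (a, b) \<in> E \<Longrightarrow> (act g a, act g b) \<in> E"
    and no_inversion: "g \<in> carrier G \<Longrightarrow> (a, b) \<in> E \<Longrightarrow> act g a = b \<Longrightarrow> act g b \<noteq> a"
begin

lemma act_relpow: "g \<in> carrier G \<Longrightarrow> (a, b) \<in> E ^^ n \<Longrightarrow> (act g a, act g b) \<in> E ^^ n"
  by (induction n arbitrary: b) (auto intro: act_edge)

lemma tdist_act:
  assumes "g \<in> carrier G" "a \<in> V" "b \<in> V"
  shows "tdist E (act g a) (act g b) = tdist E a b"
proof (rule antisym)
  show "tdist E (act g a) (act g b) \<le> tdist E a b"
    using assms act_relpow tdist_walk tdist_le by blast
  have "(act (inv g) (act g a), act (inv g) (act g b)) \<in> E ^^ tdist E (act g a) (act g b)"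
    using assms act_relpow tdist_walk act_closed inv_closed by blast
  then show "tdist E a b \<le> tdist E (act g a) (act g b)"
    using assms tdist_le by simp
qed

lemma avoid_act:
  assumes "g \<in> carrier G" "v \<in> V" "(a, b) \<in> (avoid E v)\<^sup>*"
  shows "(act g a, act g b) \<in> (avoid E (act g v))\<^sup>*"
  using assms(3)
proof (rule rtrancl_map)
  fix x y assume "(x, y) \<in> avoid E v"
  then have "(act g x, act g y) \<in> avoid E (act g v)"
    using assms edge_verts act_inj unfolding avoid_def by (auto simp: act_edge)
  then show "(act g x, act g y) \<in> (avoid E (act g v))\<^sup>*" by auto
qed

lemma toward_act:
  assumes "g \<in> carrier G" "v \<in> V" "z \<in> V" "v \<noteq> z"
  shows "toward (act g v) (act g z) = act g (toward v z)"
  using toward_eq[OF act_edge[OF assms(1) toward_edge] avoid_act[OF assms(1) _ toward_avoids]] assms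
  by auto

lemma toward_fixed:
  assumes "g \<in> carrier G" "v \<in> V" "z \<in> V" "v \<noteq> z" "act g v = v" "act g z = z"
  shows "act g (toward v z) = toward v z"
  using toward_act[OF assms(1-4)] assms by auto

text \<open>
  The vertices whose largest distance to \<open>F\<close> is minimal form an invariant set. Two of them at
  distance at least two are impossible: the neighbour of one in the direction of the other
  would have smaller largest distance to \<open>F\<close>. So distinct ones are adjacent. If \<open>h\<close> moved such
  a vertex \<open>v\<close>, then \<open>v\<close>, \<open>h v\<close> and \<open>h (h v)\<close> would form a triangle or \<open>h\<close> would invert an
  edge.
\<close>

lemma finite_invariant_fixes:
  assumes F: "finite F" "F \<noteq> {}" "F \<subseteq> V" and H: "H \<subseteq> carrier G" "\<And>h. h \<in> H \<Longrightarrow> act h ` F \<subseteq> F"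
  shows "\<exists>v\<in>V. \<forall>h\<in>H. act h v = v"
proof -
  define ecc where "ecc v = Max (tdist E v ` F)" for v
  have ecc_ge: "tdist E v x \<le> ecc v" if "x \<in> F" for v x
    using that F unfolding ecc_def by auto
  have ecc_less: "ecc v < r" if "\<And>x. x \<in> F \<Longrightarrow> tdist E v x < r" for v r
    using that F unfolding ecc_def by auto
  obtain v where v: "v \<in> V" "\<And>w. w \<in> V \<Longrightarrow> ecc v \<le> ecc w"
    using nonempty ex_has_least_nat[of "\<lambda>v. v \<in> V" _ ecc] by blast
  have min_adj: "(v, w) \<in> E" if w: "w \<in> V" "ecc w = ecc v" "w \<noteq> v" for w
  proof (rule ccontr)
    assume nE: "(v, w) \<notin> E"
    let ?m = "toward v w"
    have m: "(v, ?m) \<in> E" using toward_edge v w by auto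
    have d: "tdist E v w \<ge> 2"
    proof -
      have "?m \<noteq> w" using nE m by auto
      then have "tdist E ?m w \<noteq> 0" using m edge_verts w tdist_eq_0 by metis
      then show ?thesis using toward_dist[of v w] v w by auto
    qed
    have "tdist E ?m x < ecc v" if x: "x \<in> F" for x
    proof (cases "x \<noteq> v \<and> toward v x = ?m")
      case True
      then have "tdist E v x = Suc (tdist E ?m x)"
        using toward_dist[of v x] v x F by auto
      then show ?thesis using ecc_ge[OF x, of v] by auto
    next
      case False
      then have "tdist E ?m x = Suc (tdist E v x)"
        using away_dist[OF m, of x] x F by auto
      moreover have "tdist E x v + tdist E v w \<le> tdist E x w"
        using through_vertex[of x w v] False v w x F by (cases "x = v") auto
      moreover have "tdist E x w = tdist E w x" "tdist E x v = tdist E v x"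
        using tdist_sym x F v w by blast+
      moreover have "tdist E w x \<le> ecc v" using ecc_ge[OF x, of w] w by auto
      ultimately show ?thesis using d by linarith
    qed
    then have "ecc ?m < ecc v" by (rule ecc_less)
    moreover have "?m \<in> V" using m edge_verts by blast
    ultimately show False using v(2) by force
  qed
  have ecc_act: "ecc (act h w) = ecc w" if "h \<in> H" "w \<in> V" for h w
  proof -
    have hc: "h \<in> carrier G" using H that by auto
    have "inj_on (act h) F" using act_inj[OF hc] F by (auto simp: inj_on_def subset_iff)
    then have "act h ` F = F" using F H that by (simp add: endo_inj_surj)
    then have "tdist E (act h w) ` F = (\<lambda>x. tdist E (act h w) (act h x)) ` F"
      by (metis image_image)
    also have "\<dots> = tdist E w ` F"
      using tdist_act[OF hc that(2)] F by (auto simp: subset_iff)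
    finally show ?thesis unfolding ecc_def by simp
  qed
  have "act h v = v" if h: "h \<in> H" for h
  proof (rule ccontr)
    assume ne: "act h v \<noteq> v"
    have hc: "h \<in> carrier G" using H h by auto
    let ?w = "act h v" and ?u = "act h (act h v)"
    have V: "?w \<in> V" "?u \<in> V" using hc v act_closed by auto
    have e1: "(v, ?w) \<in> E" using min_adj[of ?w] V ne ecc_act[OF h] v by auto
    have "?u \<noteq> v" using no_inversion[OF hc e1] by auto
    then have e2: "(v, ?u) \<in> E" using min_adj[of ?u] V ecc_act[OF h] v by auto
    have e3: "(?w, ?u) \<in> E" using act_edge[OF hc e1] .
    then have "(?w, ?u) \<in> avoid E v" using ne \<open>?u \<noteq> v\<close> by (auto simp: avoid_def)
    then show False using branch_unique[OF e1 e2] e3 edge_neq by blast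
  qed
  then show ?thesis using v by auto
qed

text \<open>
  Follow the walk from its last visit to \<open>a\<close>.
\<close>

lemma leave_vertex:
  assumes "(a, z) \<in> (E \<inter> A \<times> A)\<^sup>*"
  shows "z = a \<or> (\<exists>b\<in>A. (a, b) \<in> E \<and> (b, z) \<in> (avoid E a)\<^sup>*)"
  using assms
proof (induction rule: rtrancl_induct)
  case (step c d)
  show ?case
  proof (cases "d = a")
    case False
    show ?thesis
    proof (cases "c = a")
      case True
      then show ?thesis using step by auto
    next
      case False
      then have "(c, d) \<in> avoid E a" using \<open>d \<noteq> a\<close> step by (auto simp: avoid_def)
      then show ?thesis using step False by (meson rtrancl.rtrancl_into_rtrancl)
    qed
  qed auto
qed auto

text \<open>
  The bridge between disjoint subtrees \<open>A\<close> and \<open>B\<close> starts at a unique vertex of \<open>A\<close>: if two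
  vertices of \<open>A\<close> both realized the distance to \<open>B\<close>, then from the first the direction to the
  second through \<open>B\<close> would leave \<open>A\<close>, whereas the direction through \<open>A\<close> does not.
\<close>

lemma disjoint_subtrees_fix:
  assumes A: "A \<subseteq> V" "A \<noteq> {}" "\<And>a a'. a \<in> A \<Longrightarrow> a' \<in> A \<Longrightarrow> (a, a') \<in> (E \<inter> A \<times> A)\<^sup>*"
    and B: "B \<subseteq> V" "B \<noteq> {}" "\<And>b b'. b \<in> B \<Longrightarrow> b' \<in> B \<Longrightarrow> (b, b') \<in> (E \<inter> B \<times> B)\<^sup>*"
    and disj: "A \<inter> B = {}"
    and K: "K \<subseteq> carrier G" "\<And>k. k \<in> K \<Longrightarrow> act k ` A \<subseteq> A" "\<And>k. k \<in> K \<Longrightarrow> act k ` B \<subseteq> B"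
  shows "\<exists>a\<in>A. \<forall>k\<in>K. act k a = a"
proof -
  obtain a0 b0 where "a0 \<in> A" "b0 \<in> B" using A B by auto
  then obtain p where p: "p \<in> A \<times> B"
    "\<And>q. q \<in> A \<times> B \<Longrightarrow> tdist E (fst p) (snd p) \<le> tdist E (fst q) (snd q)"
    using ex_has_least_nat[of "\<lambda>p. p \<in> A \<times> B" "(a0, b0)" "\<lambda>p. tdist E (fst p) (snd p)"] by blast
  obtain a b where ab: "p = (a, b)" by force
  have a: "a \<in> A" and b: "b \<in> B" using p ab by auto
  have min: "tdist E a b \<le> tdist E a' b'" if "a' \<in> A" "b' \<in> B" for a' b'
    using p(2)[of "(a', b')"] ab that by auto
  have uniq: "a2 = a" if a2: "a2 \<in> A" and b2: "b2 \<in> B" and eq: "tdist E a2 b2 = tdist E a b" for a2 b2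
  proof (rule ccontr)
    assume ne: "a2 \<noteq> a"
    let ?n = "toward a b"
    have V: "a \<in> V" "b \<in> V" "a2 \<in> V" "b2 \<in> V" "a \<noteq> b" using a b a2 b2 A B disj by auto
    have "?n \<notin> A" using min[of ?n b] toward_dist[of a b] V b by auto
    have "(b, b2) \<in> (avoid E a)\<^sup>*"
      using B(3)[OF b b2] by (rule rtrancl_mono[THEN subsetD, rotated]) (use a disj in \<open>auto simp: avoid_def\<close>)
    moreover have "(a2, b2) \<in> (avoid E a)\<^sup>*"
      using closer_avoids[of a2 b2 a] V ne eq min[OF a b2] by auto
    ultimately have "(?n, a2) \<in> (avoid E a)\<^sup>*"
      using toward_avoids[of a b] V by (meson avoid_sym rtrancl_trans)
    then have "toward a a2 = ?n" using toward_eq toward_edge[of a b] V by blast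
    moreover obtain a' where "a' \<in> A" "(a, a') \<in> E" "(a', a2) \<in> (avoid E a)\<^sup>*"
      using leave_vertex[OF A(3)[OF a a2]] ne by blast
    ultimately show False using toward_eq \<open>?n \<notin> A\<close> by metis
  qed
  have "act k a = a" if "k \<in> K" for k
  proof (rule uniq)
    show "act k a \<in> A" "act k b \<in> B" using K(2)[OF that] K(3)[OF that] a b by auto
    show "tdist E (act k a) (act k b) = tdist E a b"
      using tdist_act subsetD[OF K(1) that] subsetD[OF A(1) a] subsetD[OF B(1) b] by blast
  qed
  then show ?thesis using a by auto
qed

lemma finite_ball:
  assumes "\<And>v. v \<in> V \<Longrightarrow> finite (E `` {v})" "y \<in> V"
  shows "finite {z \<in> V. tdist E z y \<le> n}"
proof (induction n)
  case 0
  have "{z \<in> V. tdist E z y \<le> 0} \<subseteq> {y}" using tdist_eq_0 assms by auto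
  then show ?case by (rule finite_subset) auto
next
  case (Suc n)
  let ?B = "{z \<in> V. tdist E z y \<le> n}"
  have "{z \<in> V. tdist E z y \<le> Suc n} \<subseteq> insert y (\<Union>v\<in>?B. E `` {v})"
  proof
    fix z assume z: "z \<in> {z \<in> V. tdist E z y \<le> Suc n}"
    show "z \<in> insert y (\<Union>v\<in>?B. E `` {v})"
    proof (cases "z = y")
      case False
      then have "(z, toward z y) \<in> E" "tdist E z y = Suc (tdist E (toward z y) y)"
        using toward_edge toward_dist z assms by auto
      then have "(toward z y, z) \<in> E" "toward z y \<in> ?B" using edge_sym edge_verts z by auto
      then show ?thesis by blast
    qed auto
  qed
  then show ?case using Suc assms by (auto intro: finite_subset)
qed

end

text \<open>
  The condition on all points of \<open>P\<close>, and not just on \<open>y\<close>, is what makes a union of translates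
  of such sets connected.
\<close>

lemma finite_path:
  assumes "(x, y) \<in> R\<^sup>*"
  shows "\<exists>P. finite P \<and> x \<in> P \<and> y \<in> P \<and> P \<subseteq> R\<^sup>* `` {x} \<and> (\<forall>p\<in>P. (x, p) \<in> (R \<inter> P \<times> P)\<^sup>*)"
  using assms
proof (induction rule: rtrancl_induct)
  case base
  then show ?case by (intro exI[of _ "{x}"]) auto
next
  case (step y z)
  then obtain P where P: "finite P" "x \<in> P" "y \<in> P" "P \<subseteq> R\<^sup>* `` {x}" "\<And>p. p \<in> P \<Longrightarrow> (x, p) \<in> (R \<inter> P \<times> P)\<^sup>*"
    by blast
  let ?P = "insert z P"
  have mono: "(R \<inter> P \<times> P)\<^sup>* \<subseteq> (R \<inter> ?P \<times> ?P)\<^sup>*" by (rule rtrancl_mono) auto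
  have "(x, y) \<in> (R \<inter> ?P \<times> ?P)\<^sup>*" using P mono by auto
  moreover have "(y, z) \<in> R \<inter> ?P \<times> ?P" using P step by auto
  ultimately have "(x, z) \<in> (R \<inter> ?P \<times> ?P)\<^sup>*" by (rule rtrancl.rtrancl_into_rtrancl)
  moreover have "(x, z) \<in> R\<^sup>*" using step by auto
  ultimately show ?case using P mono by (intro exI[of _ ?P]) auto
qed

text \<open>
  As an edge is determined by its ends, a simplicial map is determined by its effect on
  vertices.
\<close>

locale G_tree_map = X: G_rel_tree G V E act + Y: G_rel_tree G W D bct
  for G :: "('g, 'm) monoid_scheme" (structure) and V :: "'a set" and E act
    and W :: "'b set" and D bct +
  fixes f :: "'a \<Rightarrow> 'b"
  assumes f_closed: "v \<in> V \<Longrightarrow> f v \<in> W"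
    and f_act: "g \<in> carrier G \<Longrightarrow> v \<in> V \<Longrightarrow> f (act g v) = bct g (f v)"
    and f_edge: "(a, b) \<in> E \<Longrightarrow> f a = f b \<or> (f a, f b) \<in> D"
begin

text \<open>
  A vertex stabilizer \<open>H\<close> of the target fixes a vertex of the source. Below, \<open>T\<close> is the
  \<open>H\<close>-orbit of finitely many paths joining a base vertex to its translates under the
  generators, so it is a subtree whose image is bounded. The case distinction is whether \<open>T\<close>
  meets all of its translates.
\<close>

lemma elliptic:
  assumes lf: "\<And>y. y \<in> W \<Longrightarrow> finite (D `` {y})"
    and nontrivial: "\<not> (\<exists>y\<in>W. \<forall>g\<in>carrier G. bct g y = y)"
    and y: "y \<in> W"
    and S: "finite S" "S \<subseteq> carrier G" "{g \<in> carrier G. bct g y = y} = generate G S"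
  shows "\<exists>x\<in>V. \<forall>g\<in>carrier G. bct g y = y \<longrightarrow> act g x = x"
proof -
  define H where "H = {g \<in> carrier G. bct g y = y}"
  have Hgen: "H = generate G S" using S H_def by simp
  have Hc: "H \<subseteq> carrier G" by (auto simp: H_def)
  have Hm: "g \<otimes> h \<in> H" if "g \<in> H" "h \<in> H" for g h
    using that y Y.act_mult by (auto simp: H_def)
  have Hi: "inv h \<in> H" if "h \<in> H" for h
    using that y Y.inv_fixes by (auto simp: H_def)
  have H1: "\<one> \<in> H" using y Y.act_one by (auto simp: H_def)
  obtain x0 where x0: "x0 \<in> V" using X.nonempty by auto
  have "\<exists>P. \<forall>s\<in>S. finite (P s) \<and> x0 \<in> P s \<and> act s x0 \<in> P s \<and> P s \<subseteq> E\<^sup>* `` {x0} \<and>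
      (\<forall>p\<in>P s. (x0, p) \<in> (E \<inter> P s \<times> P s)\<^sup>*)"
    by (intro bchoice ballI finite_path X.connected x0 X.act_closed) (use S in auto)
  then obtain P where P0: "\<forall>s\<in>S. finite (P s) \<and> x0 \<in> P s \<and> act s x0 \<in> P s \<and> P s \<subseteq> E\<^sup>* `` {x0} \<and>
      (\<forall>p\<in>P s. (x0, p) \<in> (E \<inter> P s \<times> P s)\<^sup>*)" by (rule exE)
  note P = bspec[OF P0]
  define F where "F = insert x0 (\<Union>s\<in>S. P s)"
  have Ffin: "finite F" using P S by (auto simp: F_def)
  have reachV: "p \<in> V" if "(x0, p) \<in> E\<^sup>*" for p
    using that x0 by (induction rule: rtrancl_induct) (auto dest: X.edge_verts)
  have FV: "F \<subseteq> V" using P x0 reachV by (fastforce simp: F_def)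
  define T where "T = (\<lambda>(h, p). act h p) ` (H \<times> F)"
  have TI: "act h p \<in> T" if "h \<in> H" "p \<in> F" for h p using that by (auto simp: T_def)
  have TV: "T \<subseteq> V" using Hc FV X.act_closed by (auto simp: T_def)
  have x0T: "x0 \<in> T" using TI[OF H1, of x0] X.act_one x0 by (auto simp: F_def)
  have Tact: "act h t \<in> T" if "h \<in> H" "t \<in> T" for h t
  proof -
    from that obtain k p where kp: "t = act k p" "k \<in> H" "p \<in> F" by (auto simp: T_def)
    then have "act h t = act (h \<otimes> k) p" using X.act_mult that Hc FV by (metis subsetD)
    then show ?thesis using TI Hm kp that by auto
  qed
  let ?R = "E \<inter> T \<times> T"
  have Rsym: "(b, a) \<in> ?R\<^sup>*" if "(a, b) \<in> ?R\<^sup>*" for a b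
    using that by (rule rtrancl_sym_set[rotated]) (auto dest: X.edge_sym)
  have Ract: "(act h a, act h b) \<in> ?R\<^sup>*" if "h \<in> H" "(a, b) \<in> ?R\<^sup>*" for a b h
    using that(2)
  proof (rule rtrancl_map)
    fix a b assume "(a, b) \<in> ?R"
    then have "(act h a, act h b) \<in> ?R" using Tact[OF that(1)] X.act_edge[OF subsetD[OF Hc that(1)]] by blast
    then show "(act h a, act h b) \<in> ?R\<^sup>*" by auto
  qed
  have Fconn: "(x0, p) \<in> ?R\<^sup>*" if "p \<in> F" for p
  proof (cases "p = x0")
    case False
    then obtain s where s: "s \<in> S" "p \<in> P s" using \<open>p \<in> F\<close> by (auto simp: F_def)
    have "P s \<subseteq> T"
    proof
      fix p assume "p \<in> P s"
      then have "p \<in> F" using s by (auto simp: F_def)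
      then show "p \<in> T" using TI[OF H1] X.act_one FV by (metis subsetD)
    qed
    then have "E \<inter> P s \<times> P s \<subseteq> ?R" by auto
    then show ?thesis using P[OF s(1)] s rtrancl_mono by blast
  qed auto
  have Hconn: "(x0, act h x0) \<in> ?R\<^sup>*" if "h \<in> generate G S" for h
    using that
  proof (induction rule: generate.induct)
    case one
    then show ?case using X.act_one x0 by auto
  next
    case (incl h)
    then show ?case using Fconn P by (auto simp: F_def)
  next
    case (inv h)
    then have h: "h \<in> H" "h \<in> carrier G" using Hgen S generate.incl by auto
    have "(x0, act h x0) \<in> ?R\<^sup>*" using Fconn P inv by (auto simp: F_def)
    then have "(act (inv h) x0, act (inv h) (act h x0)) \<in> ?R\<^sup>*" using Ract Hi h by blast
    then show ?case using h x0 Rsym by simp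
  next
    case (eng h1 h2)
    then have h: "h1 \<in> H" "h1 \<in> carrier G" "h2 \<in> carrier G" using Hgen Hc by auto
    have "(act h1 x0, act h1 (act h2 x0)) \<in> ?R\<^sup>*" using Ract h eng by blast
    then show ?case using eng h X.act_mult x0 by (metis rtrancl_trans)
  qed
  have T0: "(x0, t) \<in> ?R\<^sup>*" if "t \<in> T" for t
  proof -
    from that obtain h p where hp: "t = act h p" "h \<in> H" "p \<in> F" by (auto simp: T_def)
    then have "(act h x0, t) \<in> ?R\<^sup>*" using Fconn Ract by auto
    moreover have "(x0, act h x0) \<in> ?R\<^sup>*" using Hconn hp Hgen by auto
    ultimately show ?thesis by (rule rtrancl_trans[rotated])
  qed
  have Tconn: "(t, t') \<in> ?R\<^sup>*" if "t \<in> T" "t' \<in> T" for t t'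
    using T0 Rsym that by (meson rtrancl_trans)
  \<comment> \<open>If all translates of T meet T, the orbit of y is bounded, hence finite. Otherwise K below has finite index in H and fixes a vertex of T.\<close>
  show ?thesis
  proof (cases "\<forall>g\<in>carrier G. T \<inter> act g ` T \<noteq> {}")
    case True
    define r where "r = Max ((\<lambda>p. tdist D (f p) y) ` F)"
    have r: "tdist D (f t) y \<le> r" if "t \<in> T" for t
    proof -
      from that obtain h p where hp: "t = act h p" "h \<in> H" "p \<in> F" by (auto simp: T_def)
      then have "tdist D (f t) y = tdist D (bct h (f p)) (bct h y)"
        using f_act Hc FV by (auto simp: H_def)
      also have "\<dots> = tdist D (f p) y" using Y.tdist_act[of h "f p" y] hp Hc FV y f_closed by blast
      also have "\<dots> \<le> r" using hp Ffin by (auto simp: r_def)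
      finally show ?thesis .
    qed
    let ?O = "(\<lambda>g. bct g y) ` carrier G"
    have "?O \<subseteq> {z \<in> W. tdist D z y \<le> r + r}"
    proof
      fix z assume "z \<in> ?O"
      then obtain g where g: "g \<in> carrier G" "z = bct g y" by auto
      then obtain t t' where t: "t \<in> T" "t' \<in> T" "t = act g t'" using True by blast
      have "tdist D z (f t) = tdist D (bct g y) (bct g (f t'))" using g t f_act TV by auto
      also have "\<dots> = tdist D (f t') y"
        using g t TV Y.tdist_act[OF g(1) y] f_closed Y.tdist_sym[OF y] by auto
      finally have "tdist D z (f t) \<le> r" using r t by simp
      moreover have "z \<in> W" using g y Y.act_closed by auto
      moreover have "tdist D z y \<le> tdist D z (f t) + tdist D (f t) y"
        using Y.tdist_triangle \<open>z \<in> W\<close> y f_closed t TV by blast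
      ultimately show "z \<in> {z \<in> W. tdist D z y \<le> r + r}" using r[OF t(1)] by auto
    qed
    then have "finite ?O" using Y.finite_ball[OF lf y] finite_subset by blast
    moreover have "?O \<noteq> {}" using X.one_closed by blast
    moreover have "?O \<subseteq> W" using y Y.act_closed by auto
    moreover have "bct h ` ?O \<subseteq> ?O" if "h \<in> carrier G" for h
      using that y Y.act_mult[symmetric] X.m_closed by auto
    ultimately show ?thesis using Y.finite_invariant_fixes[of ?O "carrier G"] nontrivial by blast
  next
    case False
    then obtain g where g: "g \<in> carrier G" "T \<inter> act g ` T = {}" by blast
    define K where "K = {k \<in> H. bct k (bct g y) = bct g y}"
    have Kconj: "inv g \<otimes> (k \<otimes> g) \<in> H" if "k \<in> K" for k
      using that g y Y.act_mult Y.act_closed by (auto simp: K_def H_def)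
    have "\<exists>a\<in>T. \<forall>k\<in>K. act k a = a"
    proof (rule X.disjoint_subtrees_fix)
      show "act g ` T \<subseteq> V" using X.act_closed TV g by auto
      show "K \<subseteq> carrier G" using Hc by (auto simp: K_def)
      show "act k ` T \<subseteq> T" if "k \<in> K" for k using Tact that by (auto simp: K_def)
      show "act k ` (act g ` T) \<subseteq> act g ` T" if k: "k \<in> K" for k
      proof clarify
        fix t assume t: "t \<in> T"
        have kc: "k \<in> carrier G" using k Hc by (auto simp: K_def)
        have "act g (act (inv g \<otimes> (k \<otimes> g)) t) = act k (act g t)"
          using X.act_mult X.act_closed TV g kc t by (auto simp: subset_iff)
        then show "act k (act g t) \<in> act g ` T" using Tact[OF Kconj[OF k] t] by (metis imageI)
      qed
      show "(b, b') \<in> (E \<inter> act g ` T \<times> act g ` T)\<^sup>*" if "b \<in> act g ` T" "b' \<in> act g ` T" for b b'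
      proof -
        from that obtain t t' where t: "t \<in> T" "t' \<in> T" "b = act g t" "b' = act g t'" by auto
        show ?thesis unfolding t(3,4) using Tconn[OF t(1,2)]
        proof (rule rtrancl_map)
          fix a b assume "(a, b) \<in> ?R"
          then have "(act g a, act g b) \<in> E \<inter> act g ` T \<times> act g ` T"
            using X.act_edge g by auto
          then show "(act g a, act g b) \<in> (E \<inter> act g ` T \<times> act g ` T)\<^sup>*" by auto
        qed
      qed
    qed (use TV x0T Tconn g in auto)
    then obtain a where a: "a \<in> T" "\<And>k. k \<in> K \<Longrightarrow> act k a = a" by blast
    have aV: "a \<in> V" using a TV by auto
    let ?gy = "bct g y"
    have gy: "?gy \<in> W" using Y.act_closed g y by auto
    have fin: "finite ((\<lambda>h. bct h ?gy) ` H)"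
    proof (rule finite_subset)
      show "(\<lambda>h. bct h ?gy) ` H \<subseteq> {z \<in> W. tdist D z y \<le> tdist D ?gy y}"
      proof clarify
        fix h assume "h \<in> H"
        then have h: "h \<in> carrier G" "bct h y = y" by (auto simp: H_def)
        then have "tdist D (bct h ?gy) y = tdist D ?gy y" using Y.tdist_act[OF h(1) gy y] by simp
        then show "bct h ?gy \<in> W \<and> tdist D (bct h ?gy) y \<le> tdist D ?gy y"
          using Y.act_closed h gy by auto
      qed
      show "finite {z \<in> W. tdist D z y \<le> tdist D ?gy y}" using Y.finite_ball[OF lf y] .
    qed
    \<comment> \<open>Elements of H that agree on g y differ by an element of K, and hence agree on a.\<close>
    have "finite ((\<lambda>h. act h a) ` H)"
    proof -
      define sel where "sel z = (SOME h. h \<in> H \<and> bct h ?gy = z)" for z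
      have "(\<lambda>h. act h a) ` H \<subseteq> (\<lambda>z. act (sel z) a) ` ((\<lambda>h. bct h ?gy) ` H)"
      proof clarify
        fix h assume h: "h \<in> H"
        let ?k = "sel (bct h ?gy)"
        have k: "?k \<in> H" "bct ?k ?gy = bct h ?gy"
          using someI[of "\<lambda>k. k \<in> H \<and> bct k ?gy = bct h ?gy" h] h unfolding sel_def by auto
        have c: "?k \<in> carrier G" "h \<in> carrier G" using k h Hc by auto
        then have "bct (inv ?k \<otimes> h) ?gy = bct (inv ?k) (bct h ?gy)" using Y.act_mult gy by auto
        also have "\<dots> = ?gy" using Y.act_inv[OF c(1) gy] k(2) by simp
        finally have "bct (inv ?k \<otimes> h) ?gy = ?gy" .
        then have "inv ?k \<otimes> h \<in> K" using Hm[OF Hi[OF k(1)] h] by (auto simp: K_def)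
        then have "act (inv ?k \<otimes> h) a = a" using a by auto
        then have "act (inv ?k) (act h a) = a" using c X.act_mult aV by auto
        then have "act h a = act ?k a" using c X.act_inv2 X.act_closed aV by metis
        then show "act h a \<in> (\<lambda>z. act (sel z) a) ` ((\<lambda>h. bct h ?gy) ` H)" using h by auto
      qed
      then show ?thesis using fin finite_subset by blast
    qed
    moreover have "act k ` ((\<lambda>h. act h a) ` H) \<subseteq> (\<lambda>h. act h a) ` H" if "k \<in> H" for k
      using that Hm X.act_mult[symmetric, OF _ _ aV] Hc by (auto simp: subset_iff)
    moreover have "(\<lambda>h. act h a) ` H \<subseteq> V" using Hc aV X.act_closed by auto
    ultimately have "\<exists>x\<in>V. \<forall>h\<in>H. act h x = x"
      using X.finite_invariant_fixes[of "(\<lambda>h. act h a) ` H" H] H1 Hc by blast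
    then show ?thesis by (auto simp: H_def)
  qed
qed

end

section \<open>Collapsing an orbit of edges\<close>

abbreviation pact :: "('g \<Rightarrow> 'a \<Rightarrow> 'a) \<Rightarrow> 'g \<Rightarrow> 'a \<times> 'a \<Rightarrow> 'a \<times> 'a" where
  "pact act g \<equiv> map_prod (act g) (act g)"

definition collapsed_pairs ::
  "('g, 'm) monoid_scheme \<Rightarrow> ('g \<Rightarrow> 'a \<Rightarrow> 'a) \<Rightarrow> 'a \<Rightarrow> 'a \<Rightarrow> ('a \<times> 'a) set" where
  "collapsed_pairs G act v w = orbit G (pact act) (v, w) \<union> orbit G (pact act) (w, v)"

text \<open>
  The map \<open>q\<close> collapses the orbit of the edge from \<open>v\<close> to \<open>w\<close>, and the condition on
  stabilizers makes this an elementary collapse. The target is described by \<open>q\<close> only up to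
  isomorphism, so that elementary collapses can be composed with isomorphisms and read as
  expansions.
\<close>

definition tree_collapse where
  "tree_collapse G V E act V' E' act' v w q \<longleftrightarrow>
     (v, w) \<in> E \<and> orbit G act v \<noteq> orbit G act w \<and> stabilizer G act v \<subseteq> stabilizer G act w \<and>
     q ` V = V' \<and> (\<forall>g\<in>carrier G. \<forall>a\<in>V. q (act g a) = act' g (q a)) \<and>
     (\<forall>a\<in>V. \<forall>b\<in>V. q a = q b \<longleftrightarrow> (a, b) \<in> (collapsed_pairs G act v w)\<^sup>*) \<and>
     E' = map_prod q q ` (E - collapsed_pairs G act v w)"

lemma tree_collapseD:
  assumes "tree_collapse G V E act V' E' act' v w q"
  shows "(v, w) \<in> E" "orbit G act v \<noteq> orbit G act w" "stabilizer G act v \<subseteq> stabilizer G act w"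
    "q ` V = V'" "\<And>g a. g \<in> carrier G \<Longrightarrow> a \<in> V \<Longrightarrow> q (act g a) = act' g (q a)"
    "\<And>a b. a \<in> V \<Longrightarrow> b \<in> V \<Longrightarrow> q a = q b \<longleftrightarrow> (a, b) \<in> (collapsed_pairs G act v w)\<^sup>*"
    "E' = map_prod q q ` (E - collapsed_pairs G act v w)"
  using assms unfolding tree_collapse_def by blast+

lemma orbit_image:
  assumes "\<And>g. g \<in> carrier G \<Longrightarrow> h (act g a) = act' g (h a)"
  shows "orbit G act' (h a) = h ` orbit G act a"
  using assms by (force simp: orbit_def)

lemma orbits_image:
  assumes "\<And>g a. g \<in> carrier G \<Longrightarrow> a \<in> A \<Longrightarrow> h (act g a) = act' g (h a)"
  shows "orbits G (h ` A) act' = (`) h ` orbits G A act"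
proof -
  have "orbit G act' (h a) = h ` orbit G act a" if "a \<in> A" for a
    using assms that by (intro orbit_image)
  then show ?thesis by (force simp: orbits_def)
qed

context G_rel_tree
begin

lemma pairs_action: "set_action G E (pact act)"
  by unfold_locales (auto simp: act_one act_mult act_edge dest: edge_verts)

context
  fixes v w
  assumes vw: "(v, w) \<in> E"
begin

lemma pairs_sub: "collapsed_pairs G act v w \<subseteq> E"
  using vw act_edge edge_sym by (auto simp: collapsed_pairs_def orbit_def)

lemma pairs_sym: "(a, b) \<in> collapsed_pairs G act v w \<Longrightarrow> (b, a) \<in> collapsed_pairs G act v w"
  by (auto simp: collapsed_pairs_def orbit_def)

lemma pairs_act:
  "g \<in> carrier G \<Longrightarrow> (a, b) \<in> collapsed_pairs G act v w \<Longrightarrow> (act g a, act g b) \<in> collapsed_pairs G act v w"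
  using edge_verts[OF vw] act_mult[symmetric] by (auto simp: collapsed_pairs_def orbit_def)

end

end

text \<open>
  Collapsing any invariant set \<open>F\<close> of edges. It is used for the orbit of one edge and, to
  transport a tree along a bijection, for the empty set.
\<close>

locale tree_quotient = G_rel_tree G V E act
  for G :: "('g, 'm) monoid_scheme" (structure) and V :: "'a set" and E and act +
  fixes F and q :: "'a \<Rightarrow> 'b" and V' E' act'
  assumes F_sub: "F \<subseteq> E"
    and F_sym: "(a, b) \<in> F \<Longrightarrow> (b, a) \<in> F"
    and F_act: "g \<in> carrier G \<Longrightarrow> (a, b) \<in> F \<Longrightarrow> (act g a, act g b) \<in> F"
    and qV: "q ` V = V'"
    and q_act: "g \<in> carrier G \<Longrightarrow> a \<in> V \<Longrightarrow> q (act g a) = act' g (q a)"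
    and q_eq: "a \<in> V \<Longrightarrow> b \<in> V \<Longrightarrow> q a = q b \<longleftrightarrow> (a, b) \<in> F\<^sup>*"
    and qE: "E' = map_prod q q ` (E - F)"
begin

lemma F_act_iff:
  assumes "g \<in> carrier G" "a \<in> V" "b \<in> V"
  shows "(act g a, act g b) \<in> F \<longleftrightarrow> (a, b) \<in> F"
  using F_act[of g a b] F_act[of "inv g" "act g a" "act g b"] assms by auto

lemma F_avoids: "(a, b) \<in> E - F \<Longrightarrow> F \<subseteq> E - {(a, b), (b, a)}"
  using F_sub F_sym by auto

lemma q_edge_neq: "(a, b) \<in> E - F \<Longrightarrow> q a \<noteq> q b"
  using q_eq F_avoids bridge edge_verts rtrancl_mono by (metis DiffD1 subsetD)

text \<open>
  If two edges had the same image, their ends would be connected by collapsed edges, and one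
  of them would not be a bridge.
\<close>

lemma q_edge_inj:
  assumes "(a, b) \<in> E - F" "(c, d) \<in> E" "q a = q c" "q b = q d"
  shows "c = a \<and> d = b"
proof (rule ccontr)
  assume ne: "\<not> (c = a \<and> d = b)"
  let ?R = "E - {(a, b), (b, a)}"
  have V: "a \<in> V" "b \<in> V" "c \<in> V" "d \<in> V" using assms edge_verts by auto
  have "(a, c) \<in> F\<^sup>*" "(d, b) \<in> F\<^sup>*" using q_eq[of a c] q_eq[of d b] V assms by auto
  then have R: "(a, c) \<in> ?R\<^sup>*" "(d, b) \<in> ?R\<^sup>*" using rtrancl_mono F_avoids[OF assms(1)] by blast+
  have "(c, d) \<noteq> (b, a)" using q_edge_neq[OF assms(1)] assms by auto
  then have "(c, d) \<in> ?R" using ne assms by auto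
  then have "(a, b) \<in> ?R\<^sup>*" using R by (meson converse_rtrancl_into_rtrancl rtrancl_trans)
  then show False using bridge assms by blast
qed

text \<open>
  A walk in the quotient that avoids an edge lifts to a walk that avoids the corresponding
  edge, after inserting collapsed edges; so bridges stay bridges. An inversion of an edge in
  the quotient lifts to an inversion because edges of the quotient have unique lifts.
\<close>

lemma quotient_tree: "G_rel_tree G V' E' act'"
proof
  show "act' g x \<in> V'" if "g \<in> carrier G" "x \<in> V'" for g x
  proof -
    obtain a where "x = q a" "a \<in> V" using \<open>x \<in> V'\<close> qV by auto
    then show ?thesis using q_act[symmetric] that act_closed qV by auto
  qed
  show "act' \<one> x = x" if x: "x \<in> V'" for x
  proof -
    obtain a where "x = q a" "a \<in> V" using x qV by auto
    then show ?thesis using q_act[symmetric] act_one by auto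
  qed
  show "act' (g \<otimes> h) x = act' g (act' h x)" if "g \<in> carrier G" "h \<in> carrier G" "x \<in> V'" for g h x
  proof -
    obtain a where "x = q a" "a \<in> V" using \<open>x \<in> V'\<close> qV by auto
    then show ?thesis using q_act[symmetric] act_mult act_closed that by auto
  qed
  fix x y
  show "x \<in> V' \<and> y \<in> V'" if "(x, y) \<in> E'"
    using that qE qV edge_verts by blast
  show "(y, x) \<in> E'" if "(x, y) \<in> E'"
    using that qE edge_sym F_sym by force
  show "(x, x) \<notin> E'" using q_edge_neq qE by auto
  show "V' \<noteq> {}" using nonempty qV by auto
  show "(x, y) \<in> E'\<^sup>*" if xy: "x \<in> V'" "y \<in> V'"
  proof -
    obtain a b where ab: "x = q a" "y = q b" "a \<in> V" "b \<in> V" using xy qV by auto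
    show ?thesis unfolding ab(1,2) using connected[OF ab(3,4)]
    proof (rule rtrancl_map)
      fix c d assume cd: "(c, d) \<in> E"
      show "(q c, q d) \<in> E'\<^sup>*"
      proof (cases "(c, d) \<in> F")
        case True
        then have "q c = q d" using q_eq cd edge_verts by blast
        then show ?thesis by simp
      next
        case False
        then have "(q c, q d) \<in> E'" using cd qE by (auto intro!: rev_image_eqI)
        then show ?thesis by auto
      qed
    qed
  qed
  show "(x, y) \<notin> (E' - {(x, y), (y, x)})\<^sup>*" if xy: "(x, y) \<in> E'"
  proof
    assume walk: "(x, y) \<in> (E' - {(x, y), (y, x)})\<^sup>*"
    obtain a b where ab: "(a, b) \<in> E - F" "x = q a" "y = q b" using xy qE by auto
    let ?R = "E - {(a, b), (b, a)}"
    have FR: "F\<^sup>* \<subseteq> ?R\<^sup>*" using F_avoids[OF ab(1)] by (rule rtrancl_mono)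
    have aV: "a \<in> V" "b \<in> V" using ab edge_verts by auto
    have lift: "\<forall>d\<in>V. q d = z \<longrightarrow> (a, d) \<in> ?R\<^sup>*" if "(x, z) \<in> (E' - {(x, y), (y, x)})\<^sup>*" for z
      using that
    proof (induction rule: rtrancl_induct)
      case base
      show ?case
      proof (intro ballI impI)
        fix d assume "d \<in> V" "q d = x"
        then have "(a, d) \<in> F\<^sup>*" using q_eq[of a d] aV ab by auto
        then show "(a, d) \<in> ?R\<^sup>*" using FR by auto
      qed
    next
      case (step y' z')
      obtain c e where ce: "(c, e) \<in> E - F" "y' = q c" "z' = q e" using step qE by auto
      then have "(c, e) \<in> ?R" using step ab by auto
      moreover have "(a, c) \<in> ?R\<^sup>*" using step ce edge_verts by blast
      ultimately have ae: "(a, e) \<in> ?R\<^sup>*" by (rule rtrancl.rtrancl_into_rtrancl[rotated])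
      show ?case
      proof (intro ballI impI)
        fix d assume d: "d \<in> V" "q d = z'"
        then have "(e, d) \<in> F\<^sup>*" using q_eq ce edge_verts by (metis DiffD1)
        then show "(a, d) \<in> ?R\<^sup>*" using ae FR by (meson rtrancl_trans subsetD)
      qed
    qed
    then have "(a, b) \<in> ?R\<^sup>*" using lift[OF walk] ab(3) aV by auto
    then show False using bridge ab by blast
  qed
  show "(act' g x, act' g y) \<in> E'" if g: "g \<in> carrier G" and xy: "(x, y) \<in> E'" for g
  proof -
    obtain a b where ab: "(a, b) \<in> E - F" "x = q a" "y = q b" using xy qE by auto
    have V: "a \<in> V" "b \<in> V" using ab edge_verts by auto
    have "(act g a, act g b) \<in> E - F" using ab act_edge[OF g] F_act_iff[OF g V] by auto
    then have "map_prod q q (act g a, act g b) \<in> E'" unfolding qE by (rule imageI)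
    then show ?thesis using ab V q_act[OF g] by simp
  qed
  show "act' g y \<noteq> x" if g: "g \<in> carrier G" and xy: "(x, y) \<in> E'" "act' g x = y" for g
  proof
    assume inv: "act' g y = x"
    obtain a b where ab: "(a, b) \<in> E - F" "x = q a" "y = q b" using xy qE by auto
    have V: "a \<in> V" "b \<in> V" using ab edge_verts by auto
    have "(b, a) \<in> E - F" using ab edge_sym F_sym by blast
    moreover have "(act g a, act g b) \<in> E" using ab act_edge[OF g] by blast
    moreover have "q b = q (act g a)" using q_act[OF g V(1)] xy(2) ab by metis
    moreover have "q a = q (act g b)" using q_act[OF g V(2)] inv ab by metis
    ultimately have "act g a = b \<and> act g b = a" by (rule q_edge_inj)
    then show False using no_inversion[OF g] ab by auto
  qed
qed

end

context G_rel_tree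
begin

text \<open>
  Representatives of the classes serve as the vertices of the quotient, so that its vertices
  keep their type and a map that is constant on the classes can be kept as it is.
\<close>

lemma quotient_exists:
  assumes "(v, w) \<in> E"
  shows "\<exists>q act'. tree_quotient G V E act (collapsed_pairs G act v w) q (q ` V)
      (map_prod q q ` (E - collapsed_pairs G act v w)) act' \<and>
      (\<forall>a\<in>V. q a \<in> V \<and> (a, q a) \<in> (collapsed_pairs G act v w)\<^sup>*)"
proof -
  let ?F = "collapsed_pairs G act v w"
  define q where "q a = (SOME b. (a, b) \<in> ?F\<^sup>*)" for a
  have q: "(a, q a) \<in> ?F\<^sup>*" for a unfolding q_def by (rule someI[of _ a]) auto
  have Fsym: "(b, a) \<in> ?F\<^sup>*" if "(a, b) \<in> ?F\<^sup>*" for a b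
    using pairs_sym[OF assms] that by (rule rtrancl_sym_set)
  have q_eq: "q a = q b \<longleftrightarrow> (a, b) \<in> ?F\<^sup>*" for a b
  proof
    assume "(a, b) \<in> ?F\<^sup>*"
    then have "(a, c) \<in> ?F\<^sup>* \<longleftrightarrow> (b, c) \<in> ?F\<^sup>*" for c using Fsym by (meson rtrancl_trans)
    then show "q a = q b" unfolding q_def by simp
  next
    assume "q a = q b"
    then show "(a, b) \<in> ?F\<^sup>*" using q[of a] q[of b] Fsym by (metis rtrancl_trans)
  qed
  have qV: "q a \<in> V" if "a \<in> V" for a
    using q[of a] that pairs_sub[OF assms] edge_verts by (rule_tac rtrancl_closed) auto
  have "tree_quotient G V E act ?F q (q ` V) (map_prod q q ` (E - ?F)) (\<lambda>g x. q (act g x))"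
  proof (unfold_locales)
    show "q (act g a) = q (act g (q a))" if "g \<in> carrier G" "a \<in> V" for g a
    proof -
      have "(act g a, act g (q a)) \<in> ?F\<^sup>*"
        using q[of a] by (rule rtrancl_map) (use pairs_act[OF assms that(1)] in blast)
      then show ?thesis using q_eq by auto
    qed
  qed (use pairs_sub[OF assms] pairs_sym[OF assms] pairs_act[OF assms] q_eq in auto)
  then show ?thesis using qV q by blast
qed

end

text \<open>
  The map \<open>s\<close> carries the information that the stabilizers of \<open>W\<close> are elliptic in the tree
  \<open>V\<close>: the stabilizer of \<open>y\<close> fixes \<open>s y\<close>. In particular the stabilizer of \<open>v\<close> fixes \<open>s (f v)\<close>.
\<close>

locale G_tree_map_and_back = G_tree_map G V E act W D bct f
  for G :: "('g, 'm) monoid_scheme" (structure) and V :: "'a set" and E act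
    and W :: "'b set" and D bct and f +
  fixes s :: "'b \<Rightarrow> 'a"
  assumes s_closed: "y \<in> W \<Longrightarrow> s y \<in> V"
    and s_act: "g \<in> carrier G \<Longrightarrow> y \<in> W \<Longrightarrow> s (bct g y) = act g (s y)"
    and fin_V: "finite (orbits G V act)"
    and fin_E: "finite (orbits G E (pact act))"
begin

lemma stab_fixes: "g \<in> carrier G \<Longrightarrow> v \<in> V \<Longrightarrow> act g v = v \<Longrightarrow> act g (s (f v)) = s (f v)"
  using f_act f_closed s_act by metis

lemma stab_edge:
  assumes "(v, w) \<in> E" "v \<noteq> s (f v)" "X.toward v (s (f v)) = w" "g \<in> carrier G" "act g v = v"
  shows "act g w = w"
  using X.toward_fixed[of g v "s (f v)"] assms stab_fixes X.edge_verts s_closed f_closed by metis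

text \<open>
  An element \<open>g\<close> that sends \<open>v\<close> to \<open>w\<close> would fix \<open>s (f v)\<close>, and hence \<open>v\<close> and \<open>w\<close> would have
  the same distance from it.
\<close>

lemma collapsed_edge_orbits:
  assumes "(v, w) \<in> E" "f v = f w"
  shows "orbit G act v \<noteq> orbit G act w"
proof
  assume "orbit G act v = orbit G act w"
  then have "w \<in> orbit G act v" using X.orbit_self[of w] assms X.edge_verts by auto
  then obtain g where g: "g \<in> carrier G" "w = act g v" by (auto simp: orbit_def)
  have V: "v \<in> V" "w \<in> V" using assms X.edge_verts by auto
  have "bct g (f v) = f v" using f_act g V assms by auto
  then have "act g (s (f v)) = s (f v)" using s_act[OF g(1) f_closed[OF V(1)]] by auto
  then have "tdist E w (s (f v)) = tdist E v (s (f v))"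
    using X.tdist_act[OF g(1) V(1) s_closed[OF f_closed[OF V(1)]]] g by auto
  then show False using X.adjacent_dist_neq[OF assms(1)] s_closed f_closed V by metis
qed

text \<open>
  Let \<open>v\<close> be the end from which the edge points to \<open>z = s (f v)\<close>. The stabilizer of \<open>v\<close> fixes
  \<open>z\<close> and hence the edge, so that its collapse is elementary.
\<close>

lemma collapse_exists:
  assumes "(a, b) \<in> E" "f a = f b"
  shows "\<exists>v w q V' E' act'. tree_collapse G V E act V' E' act' v w q \<and>
     G_tree_map_and_back G V' E' act' W D bct f (q \<circ> s) \<and> (\<forall>x\<in>V. f (q x) = f x)"
proof -
  have ab: "a \<in> V" "b \<in> V" using assms X.edge_verts by auto
  obtain v w where vw: "(v, w) \<in> E" "f v = f w" "v \<noteq> s (f v)" "X.toward v (s (f v)) = w"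
    using X.toward_either[OF assms(1), of "s (f a)"] s_closed f_closed ab assms X.edge_sym by metis
  have V: "v \<in> V" "w \<in> V" using vw X.edge_verts by auto
  let ?F = "collapsed_pairs G act v w"
  obtain q act' where q: "tree_quotient G V E act ?F q (q ` V) (map_prod q q ` (E - ?F)) act'"
    "\<And>a. a \<in> V \<Longrightarrow> q a \<in> V \<and> (a, q a) \<in> ?F\<^sup>*"
    using X.quotient_exists[OF vw(1)] by blast
  let ?V = "q ` V" and ?E = "map_prod q q ` (E - ?F)"
  interpret Q: tree_quotient G V E act ?F q ?V ?E act' by (rule q)
  interpret Q': G_rel_tree G ?V ?E act' by (rule Q.quotient_tree)
  have fF: "f x = f y" if "(x, y) \<in> ?F\<^sup>*" for x y
    using that
  proof (induction rule: rtrancl_induct)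
    case (step y z)
    have "f y = f z" using step(2) f_act V vw(2) by (auto simp: collapsed_pairs_def orbit_def)
    then show ?case using step by auto
  qed auto
  have fq: "f (q x) = f x" if "x \<in> V" for x using q(2)[OF that] fF by auto
  have "tree_collapse G V E act ?V ?E act' v w q"
    unfolding tree_collapse_def
    using vw(1) collapsed_edge_orbits[OF vw(1,2)] stab_edge[OF vw(1,3,4)] Q.q_act Q.q_eq
    by (auto simp: stabilizer_def)
  moreover have "G_tree_map_and_back G ?V ?E act' W D bct f (q \<circ> s)"
  proof (unfold_locales)
    show "f x \<in> W" if "x \<in> ?V" for x using that fq f_closed by auto
    show "f (act' g x) = bct g (f x)" if "g \<in> carrier G" "x \<in> ?V" for g x
    proof -
      obtain a where a: "x = q a" "a \<in> V" using \<open>x \<in> ?V\<close> by auto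
      then show ?thesis using Q.q_act[symmetric] that fq f_act X.act_closed by auto
    qed
    show "f x = f y \<or> (f x, f y) \<in> D" if xy: "(x, y) \<in> ?E" for x y
    proof -
      obtain a b where a: "x = q a" "y = q b" "(a, b) \<in> E" using xy by auto
      then show ?thesis using fq f_edge X.edge_verts by metis
    qed
    show "(q \<circ> s) y \<in> ?V" if "y \<in> W" for y using that s_closed by auto
    show "(q \<circ> s) (bct g y) = act' g ((q \<circ> s) y)" if "g \<in> carrier G" "y \<in> W" for g y
      using that s_act s_closed Q.q_act by auto
    show "finite (orbits G ?V act')"
      using fin_V orbits_image[of G V q act act'] Q.q_act by auto
    have "orbits G (E - ?F) (pact act) \<subseteq> orbits G E (pact act)" by (auto simp: orbits_def)
    moreover have "orbits G ?E (pact act') = (`) (map_prod q q) ` orbits G (E - ?F) (pact act)"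
      using Q.q_act X.edge_verts by (intro orbits_image) force
    ultimately show "finite (orbits G ?E (pact act'))" using finite_subset[OF _ fin_E] by auto
  qed
  ultimately show ?thesis using fq by blast
qed

end

section \<open>Pulling: the expansions that perform folds\<close>

lemma orbits_Un: "orbits G (A \<union> B) act = orbits G A act \<union> orbits G B act"
  by (auto simp: orbits_def)

context set_action
begin

lemma orbits_orbit: "v \<in> V \<Longrightarrow> orbits G (orbit G act v) act = {orbit G act v}"
  using orbit_eq_iff[of v] orbit_sub[of v] orbit_self[of v] unfolding orbits_def by blast

text \<open>
  The representative of an orbit depends on the orbit only, and \<open>elt v\<close> is an element that
  carries it to \<open>v\<close>.
\<close>

lemma orbit_representatives:
  "\<exists>rep elt. \<forall>v\<in>V. rep (orbit G act v) \<in> V \<and> elt v \<in> carrier G \<and> act (elt v) (rep (orbit G act v)) = v"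
proof -
  define rep where "rep B = (SOME v. v \<in> B)" for B :: "'a set"
  define elt where "elt v = (SOME g. g \<in> carrier G \<and> act g (rep (orbit G act v)) = v)" for v
  have "rep (orbit G act v) \<in> V \<and> elt v \<in> carrier G \<and> act (elt v) (rep (orbit G act v)) = v" if v: "v \<in> V" for v
  proof -
    have r: "rep (orbit G act v) \<in> orbit G act v"
      unfolding rep_def using orbit_self[OF v] by (rule someI)
    then have rV: "rep (orbit G act v) \<in> V" using orbit_sub[OF v] by auto
    then have "v \<in> orbit G act (rep (orbit G act v))"
      using r orbit_eq_iff v orbit_self by metis
    then have "\<exists>g. g \<in> carrier G \<and> act g (rep (orbit G act v)) = v" by (auto simp: orbit_def)
    then have "elt v \<in> carrier G \<and> act (elt v) (rep (orbit G act v)) = v"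
      unfolding elt_def by (rule someI_ex)
    then show ?thesis using rV by blast
  qed
  then show ?thesis by (intro exI[of _ rep] exI[of _ elt] ballI)
qed

text \<open>
  Each vertex is a translate of one of finitely many representatives. All trees in the proof
  can therefore be moved to the same type.
\<close>

lemma embedding_exists:
  assumes "finite (orbits G V act)"
  shows "\<exists>\<iota> :: 'a \<Rightarrow> 'g \<times> nat. inj_on \<iota> V"
proof -
  obtain num :: "'a set \<Rightarrow> nat" where num: "inj_on num (orbits G V act)"
    using finite_imp_inj_to_nat_seg[OF assms] by blast
  obtain rep elt where "\<forall>v\<in>V. rep (orbit G act v) \<in> V \<and> elt v \<in> carrier G \<and> act (elt v) (rep (orbit G act v)) = v"
    using orbit_representatives by (elim exE)
  note r = bspec[OF this]
  have "inj_on (\<lambda>v. (elt v, num (orbit G act v))) V"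
  proof (rule inj_onI)
    fix v w assume V: "v \<in> V" "w \<in> V" and eq: "(elt v, num (orbit G act v)) = (elt w, num (orbit G act w))"
    then have "orbit G act v = orbit G act w" using num by (auto simp: inj_on_def orbits_def)
    then have "act (elt v) (rep (orbit G act v)) = act (elt w) (rep (orbit G act w))" using eq by simp
    then show "v = w" using r[OF V(1)] r[OF V(2)] by metis
  qed
  then show ?thesis by blast
qed

lemma finite_orbit_representatives:
  assumes "finite (orbits G V act)"
  obtains R where "finite R" "R \<subseteq> V" "\<And>v. v \<in> V \<Longrightarrow> \<exists>r\<in>R. v \<in> orbit G act r"
proof -
  obtain rep elt where "\<forall>v\<in>V. rep (orbit G act v) \<in> V \<and> elt v \<in> carrier G \<and> act (elt v) (rep (orbit G act v)) = v"
    using orbit_representatives by (elim exE)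
  note r = bspec[OF this]
  show thesis
  proof (rule that[of "rep ` orbits G V act"])
    show "finite (rep ` orbits G V act)" using assms by simp
    show "rep ` orbits G V act \<subseteq> V" using r unfolding orbits_def by blast
    show "\<exists>x\<in>rep ` orbits G V act. v \<in> orbit G act x" if v: "v \<in> V" for v
    proof
      show "rep (orbit G act v) \<in> rep ` orbits G V act" using v unfolding orbits_def by blast
      show "v \<in> orbit G act (rep (orbit G act v))" using r[OF v]
        unfolding orbit_def[of G act "rep (orbit G act v)"] mem_Collect_eq by metis
    qed
  qed
qed

end

text \<open>
  Walks in which only the edges not collapsed by \<open>f\<close> (the prefix \<open>nc\<close>) are counted. Ordinary
  length would grow temporarily under a pull, until the collapses that complete the fold.
\<close>

inductive nc_walk :: "('a \<times> 'a) set \<Rightarrow> ('a \<Rightarrow> 'w) \<Rightarrow> nat \<Rightarrow> 'a \<Rightarrow> 'a \<Rightarrow> bool" for E f where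
  nc_refl: "nc_walk E f 0 a a"
| nc_coll: "(a, b) \<in> E \<Longrightarrow> f a = f b \<Longrightarrow> nc_walk E f k b c \<Longrightarrow> nc_walk E f k a c"
| nc_step: "(a, b) \<in> E \<Longrightarrow> f a \<noteq> f b \<Longrightarrow> nc_walk E f k b c \<Longrightarrow> nc_walk E f (Suc k) a c"

lemma nc_trans: "nc_walk E f k a b \<Longrightarrow> nc_walk E f l b c \<Longrightarrow> nc_walk E f (k + l) a c"
  by (induction rule: nc_walk.induct) (auto intro: nc_walk.intros)

lemma nc_map:
  assumes "nc_walk E f k a b"
    and "\<And>a b. (a, b) \<in> E \<Longrightarrow> f a = f b \<Longrightarrow> nc_walk E' f' 0 (h a) (h b)"
    and "\<And>a b. (a, b) \<in> E \<Longrightarrow> f a \<noteq> f b \<Longrightarrow> nc_walk E' f' (Suc 0) (h a) (h b)"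
  shows "nc_walk E' f' k (h a) (h b)"
  using assms(1)
proof (induction rule: nc_walk.induct)
  case (nc_coll a b k c)
  then show ?case using nc_trans[OF assms(2)] by fastforce
next
  case (nc_step a b k c)
  then show ?case using nc_trans[OF assms(3)] by fastforce
qed (rule nc_refl)

lemma nc_edge:
  "(a, b) \<in> E \<Longrightarrow> f a = f b \<Longrightarrow> nc_walk E f 0 a b"
  "(a, b) \<in> E \<Longrightarrow> f a \<noteq> f b \<Longrightarrow> nc_walk E f (Suc 0) a b"
  by (auto intro: nc_walk.intros)

definition nc_edges :: "('a \<times> 'a) set \<Rightarrow> ('a \<Rightarrow> 'w) \<Rightarrow> ('a \<times> 'a) set" where
  "nc_edges E f = {(a, b) \<in> E. f a \<noteq> f b}"

definition pull_verts :: "'a set \<Rightarrow> ('a \<times> 'b) set \<Rightarrow> ('a + 'a \<times> 'b) set" where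
  "pull_verts V N = Inl ` V \<union> Inr ` N"

text \<open>
  The new starting point of the edge from \<open>a\<close> to \<open>b\<close>: the new vertex \<open>(a, f b)\<close> if there is
  one.
\<close>

definition pull_tail :: "('a \<times> 'b) set \<Rightarrow> ('a \<Rightarrow> 'b) \<Rightarrow> 'a \<Rightarrow> 'a \<Rightarrow> 'a + 'a \<times> 'b" where
  "pull_tail N f a b = (if (a, f b) \<in> N then Inr (a, f b) else Inl a)"

definition pull_lift :: "('a \<times> 'b) set \<Rightarrow> ('a \<Rightarrow> 'b) \<Rightarrow> 'a \<times> 'a \<Rightarrow> ('a + 'a \<times> 'b) \<times> ('a + 'a \<times> 'b)" where
  "pull_lift N f e = (pull_tail N f (fst e) (snd e), pull_tail N f (snd e) (fst e))"

definition pull_stem :: "'a \<times> 'b \<Rightarrow> ('a + 'a \<times> 'b) \<times> ('a + 'a \<times> 'b)" where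
  "pull_stem n = (Inl (fst n), Inr n)"

text \<open>
  The old edges with moved ends, and the stems that join each new vertex \<open>(a, y)\<close> to \<open>a\<close>.
\<close>

definition pull_edges :: "('a \<times> 'a) set \<Rightarrow> ('a \<times> 'b) set \<Rightarrow> ('a \<Rightarrow> 'b) \<Rightarrow> (('a + 'a \<times> 'b) \<times> ('a + 'a \<times> 'b)) set" where
  "pull_edges E N f = pull_lift N f ` E \<union> (pull_stem ` N \<union> (prod.swap \<circ> pull_stem) ` N)"

definition pull_act :: "('g \<Rightarrow> 'a \<Rightarrow> 'a) \<Rightarrow> ('g \<Rightarrow> 'b \<Rightarrow> 'b) \<Rightarrow> 'g \<Rightarrow> 'a + 'a \<times> 'b \<Rightarrow> 'a + 'a \<times> 'b" where
  "pull_act act bct g = map_sum (act g) (map_prod (act g) (bct g))"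

definition pull_map :: "('a \<Rightarrow> 'b) \<Rightarrow> 'a + 'a \<times> 'b \<Rightarrow> 'b" where
  "pull_map f = case_sum f snd"

definition pull_proj :: "'a + 'a \<times> 'b \<Rightarrow> 'a" where
  "pull_proj = case_sum id fst"

text \<open>
  The new vertices are the pairs in the orbit \<open>N\<close> of \<open>(x0, y0)\<close>; such a pair \<open>(a, y)\<close> is
  attached to \<open>a\<close> and mapped to \<open>y\<close>. If \<open>x0\<close> has no edge over the edge from \<open>f x0\<close> to \<open>y0\<close>,
  the pull only attaches new leaves. If it has several, the pull is the first half of a fold.
\<close>

locale pull = G_tree_map G V E act W D bct f
  for G :: "('g, 'm) monoid_scheme" (structure) and V :: "'a set" and E act
    and W :: "'b set" and D bct and f +
  fixes x0 y0
  assumes x0: "x0 \<in> V" and y0: "(f x0, y0) \<in> D"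
begin

definition "N = orbit G (\<lambda>g. map_prod (act g) (bct g)) (x0, y0)"

abbreviation "PV \<equiv> pull_verts V N"
abbreviation "PE \<equiv> pull_edges E N f"
abbreviation "pa \<equiv> pull_act act bct"
abbreviation "pf \<equiv> pull_map f"

lemma N_cases:
  assumes "n \<in> N" obtains g where "g \<in> carrier G" "n = (act g x0, bct g y0)"
  using assms by (auto simp: N_def orbit_def)

lemma N_mem: "(a, y) \<in> N \<Longrightarrow> a \<in> V \<and> (f a, y) \<in> D \<and> y \<in> W"
  using x0 y0 f_act X.act_closed Y.act_edge Y.edge_verts by (fastforce elim!: N_cases)

lemma base_N: "(x0, y0) \<in> N"
proof -
  have "(x0, y0) = (act \<one> x0, bct \<one> y0)" using X.act_one x0 Y.act_one Y.edge_verts[OF y0] by auto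
  then show ?thesis by (auto simp: N_def orbit_def intro!: exI[of _ \<one>])
qed

lemma N_act: "g \<in> carrier G \<Longrightarrow> (a, y) \<in> N \<Longrightarrow> (act g a, bct g y) \<in> N"
  using X.act_mult[symmetric, of g _ x0] Y.act_mult[symmetric, of g _ y0] x0 Y.edge_verts[OF y0]
  by (auto simp: N_def orbit_def)

lemma N_act_iff:
  assumes "g \<in> carrier G" "a \<in> V" "y \<in> W"
  shows "(act g a, bct g y) \<in> N \<longleftrightarrow> (a, y) \<in> N"
  using N_act[of g a y] N_act[of "inv g" "act g a" "bct g y"] assms by auto

text \<open>
  No edge is moved at both ends: the group element that relates the two pairs would invert the
  image of the edge in the target.
\<close>

lemma not_both:
  assumes "(a, b) \<in> E" "(a, f b) \<in> N" "(b, f a) \<in> N" shows False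
proof -
  obtain g where g: "g \<in> carrier G" "a = act g x0" "f b = bct g y0"
    using N_cases[OF assms(2)] by auto
  obtain h where h: "h \<in> carrier G" "b = act h x0" "f a = bct h y0"
    using N_cases[OF assms(3)] by auto
  let ?k = "h \<otimes> inv g"
  have W: "y0 \<in> W" "f x0 \<in> W" using Y.edge_verts[OF y0] by auto
  have k: "?k \<in> carrier G" using g h by auto
  have "bct ?k (f a) = f b"
  proof -
    have "f a = bct g (f x0)" "f b = bct h (f x0)" using f_act g h x0 by auto
    then show ?thesis using g(1) h(1) W by (simp add: Y.act_mult Y.act_closed)
  qed
  moreover have "bct ?k (f b) = f a"
    unfolding g(3) h(3) using g(1) h(1) W by (simp add: Y.act_mult Y.act_closed)
  ultimately show False using Y.no_inversion[OF k] N_mem assms(2) by blast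
qed

lemma proj_tail [simp]: "pull_proj (pull_tail N f a b) = a"
  by (auto simp: pull_proj_def pull_tail_def)

lemma proj_simps [simp]: "pull_proj (Inl a) = a" "pull_proj (Inr n) = fst n"
  by (auto simp: pull_proj_def)

lemma pf_simps [simp]: "pf (Inl a) = f a" "pf (Inr n) = snd n"
  by (auto simp: pull_map_def)

lemma pa_simps [simp]: "pa g (Inl a) = Inl (act g a)" "pa g (Inr (a, y)) = Inr (act g a, bct g y)"
  by (auto simp: pull_act_def)

lemma tail_act:
  assumes "g \<in> carrier G" "(a, b) \<in> E"
  shows "pull_tail N f (act g a) (act g b) = pa g (pull_tail N f a b)"
  using assms N_act_iff[of g a "f b"] X.edge_verts f_closed f_act by (auto simp: pull_tail_def)

lemma tail_closed: "(a, b) \<in> E \<Longrightarrow> pull_tail N f a b \<in> PV"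
  using X.edge_verts by (auto simp: pull_tail_def pull_verts_def)

lemma edge_cases:
  assumes "(u, u') \<in> PE"
  obtains (lift) a b where "(a, b) \<in> E" "u = pull_tail N f a b" "u' = pull_tail N f b a"
  | (stem) a y where "(a, y) \<in> N" "u = Inl a" "u' = Inr (a, y)"
  | (stem_rev) a y where "(a, y) \<in> N" "u = Inr (a, y)" "u' = Inl a"
  using assms by (auto simp: pull_edges_def pull_lift_def pull_stem_def)

lemma lift_edge: "(a, b) \<in> E \<Longrightarrow> (pull_tail N f a b, pull_tail N f b a) \<in> PE"
  by (force simp: pull_edges_def pull_lift_def)

lemma stem_edge: "(a, y) \<in> N \<Longrightarrow> (Inl a, Inr (a, y)) \<in> PE" "(a, y) \<in> N \<Longrightarrow> (Inr (a, y), Inl a) \<in> PE"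
  by (force simp: pull_edges_def pull_stem_def)+

lemma PE_sym: "(u, u') \<in> PE \<Longrightarrow> (u', u) \<in> PE"
  by (erule edge_cases) (auto intro: lift_edge stem_edge X.edge_sym)

lemma tail_conn: "(Inl a, pull_tail N f a b) \<in> PE\<^sup>*"
  using stem_edge by (auto simp: pull_tail_def)

lemma Inl_conn: "(a, b) \<in> E\<^sup>* \<Longrightarrow> (Inl a, Inl b) \<in> PE\<^sup>*"
proof (erule rtrancl_map)
  fix a b assume "(a, b) \<in> E"
  then have "(pull_tail N f a b, pull_tail N f b a) \<in> PE" by (rule lift_edge)
  moreover have "(pull_tail N f b a, Inl b) \<in> PE\<^sup>*"
    by (rule rtrancl_sym_set[OF _ tail_conn]) (rule PE_sym)
  ultimately show "(Inl a, Inl b) \<in> PE\<^sup>*"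
    using tail_conn[of a b] by (meson converse_rtrancl_into_rtrancl rtrancl_trans)
qed

text \<open>
  Collapsing the stems maps a walk that avoids the moved edge to a walk that avoids the
  original edge.
\<close>

lemma lift_bridge:
  assumes ab: "(a, b) \<in> E" and u: "u = pull_tail N f a b" "u' = pull_tail N f b a"
  shows "(u, u') \<notin> (PE - {(u, u'), (u', u)})\<^sup>*"
proof
  assume "(u, u') \<in> (PE - {(u, u'), (u', u)})\<^sup>*"
  then have "(pull_proj u, pull_proj u') \<in> (E - {(a, b), (b, a)})\<^sup>*"
  proof (rule rtrancl_map)
    fix x y assume xy: "(x, y) \<in> PE - {(u, u'), (u', u)}"
    then have "(x, y) \<in> PE" by auto
    then show "(pull_proj x, pull_proj y) \<in> (E - {(a, b), (b, a)})\<^sup>*"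
    proof (cases rule: edge_cases)
      case (lift c d)
      then have "(c, d) \<in> E - {(a, b), (b, a)}" using xy u by auto
      then show ?thesis using lift by auto
    qed auto
  qed
  then show False using X.bridge ab u by auto
qed

text \<open>
  On removal of the stem, the new vertex \<open>(a, y)\<close> stays connected only to the branches at \<open>a\<close>
  whose edges were moved to it, and no other edge leaves these branches.
\<close>

lemma stem_bridge:
  assumes n: "(a, y) \<in> N"
  shows "(Inr (a, y), Inl a) \<notin> (PE - {(Inl a, Inr (a, y)), (Inr (a, y), Inl a)})\<^sup>*"
proof
  \<comment> \<open>B is the union of the branches at a whose edges are moved to the new vertex.\<close>
  define B where "B = {x. \<exists>d. (a, d) \<in> E \<and> f d = y \<and> (d, x) \<in> (avoid E a)\<^sup>*}"
  define S where "S = {w. w = Inr (a, y) \<or> pull_proj w \<in> B}"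
  have aB: "a \<notin> B" using avoid_start X.edge_neq by (fastforce simp: B_def)
  have B_step: "x \<in> B \<longleftrightarrow> x' \<in> B" if "(x, x') \<in> E" "x \<noteq> a" "x' \<noteq> a" for x x'
  proof -
    have "(x, x') \<in> avoid E a" "(x', x) \<in> avoid E a" using that X.edge_sym by (auto simp: avoid_def)
    then show ?thesis unfolding B_def by (blast intro: rtrancl.rtrancl_into_rtrancl)
  qed
  have B_nbr: "x \<in> B \<longleftrightarrow> f x = y" if "(a, x) \<in> E" for x
    using that X.branch_unique unfolding B_def by blast
  assume "(Inr (a, y), Inl a) \<in> (PE - {(Inl a, Inr (a, y)), (Inr (a, y), Inl a)})\<^sup>*"
  then have "Inl a \<in> S"
  proof (rule rtrancl_closed)
    show "Inr (a, y) \<in> S" by (simp add: S_def)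
    fix u u' assume u: "u \<in> S" "(u, u') \<in> PE - {(Inl a, Inr (a, y)), (Inr (a, y), Inl a)}"
    then have "(u, u') \<in> PE" by auto
    then show "u' \<in> S"
    proof (cases rule: edge_cases)
      case (lift c d)
      consider "c = a" | "d = a" | "c \<noteq> a" "d \<noteq> a" by blast
      then show ?thesis
      proof cases
        case 1
        then have "u = Inr (a, y)" using u(1) lift aB by (auto simp: S_def)
        then have "f d = y" using lift 1 by (auto simp: pull_tail_def split: if_splits)
        then show ?thesis using B_nbr[of d] lift 1 by (auto simp: S_def)
      next
        case 2
        then have ca: "c \<noteq> a" "(a, c) \<in> E" using lift X.edge_neq X.edge_sym by auto
        then have "c \<in> B" using u(1) lift by (auto simp: S_def pull_tail_def split: if_splits)
        then have "f c = y" using B_nbr ca by auto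
        then show ?thesis using lift 2 n by (auto simp: S_def pull_tail_def)
      next
        case 3
        then have "c \<in> B" using u(1) lift by (auto simp: S_def pull_tail_def split: if_splits)
        then have "d \<in> B" using B_step lift 3 by auto
        then show ?thesis using lift by (auto simp: S_def)
      qed
    qed (use u aB in \<open>auto simp: S_def\<close>)
  qed
  then show False using aB by (auto simp: S_def)
qed

lemma pull_tree: "G_rel_tree G PV PE pa"
proof
  show "pa g u \<in> PV" if "g \<in> carrier G" "u \<in> PV" for g u
    using that X.act_closed N_act by (auto simp: pull_verts_def)
  show "pa \<one> u = u" if "u \<in> PV" for u
    using that X.act_one Y.act_one N_mem by (auto simp: pull_verts_def)
  show "pa (g \<otimes> h) u = pa g (pa h u)" if "g \<in> carrier G" "h \<in> carrier G" "u \<in> PV" for g h u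
    using that X.act_mult Y.act_mult N_mem by (fastforce simp: pull_verts_def)
  fix u u'
  show "u \<in> PV \<and> u' \<in> PV" if "(u, u') \<in> PE"
    using that
  proof (cases rule: edge_cases)
    case (lift a b)
    then show ?thesis using tail_closed X.edge_sym by simp
  qed (auto dest: N_mem simp: pull_verts_def)
  show "(u', u) \<in> PE" if "(u, u') \<in> PE"
    using that by (rule PE_sym)
  show "(u, u) \<notin> PE"
  proof
    assume "(u, u) \<in> PE"
    then show False
    proof (cases rule: edge_cases)
      case (lift a b)
      then have "a = b" by (metis proj_tail)
      then show ?thesis using lift X.edge_irrefl by auto
    qed auto
  qed
  show "PV \<noteq> {}" using X.nonempty by (auto simp: pull_verts_def)
  have toInl: "(Inl (pull_proj u), u) \<in> PE\<^sup>*" if "u \<in> PV" for u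
    using that stem_edge by (auto simp: pull_verts_def)
  have proj: "pull_proj u \<in> V" if "u \<in> PV" for u
    using that N_mem by (auto simp: pull_verts_def)
  show "(u, u') \<in> PE\<^sup>*" if "u \<in> PV" "u' \<in> PV"
    using toInl[OF that(2)] rtrancl_sym_set[OF PE_sym toInl[OF that(1)]]
      Inl_conn[OF X.connected[OF proj[OF that(1)] proj[OF that(2)]]]
    by (meson rtrancl_trans)
  show "(u, u') \<notin> (PE - {(u, u'), (u', u)})\<^sup>*" if "(u, u') \<in> PE"
    using that
  proof (cases rule: edge_cases)
    case (lift a b)
    then show ?thesis using lift_bridge by blast
  next
    case (stem a y)
    have "(u', u) \<notin> (PE - {(u, u'), (u', u)})\<^sup>*" using stem stem_bridge[OF stem(1)] by simp
    moreover have "(x', x) \<in> PE - {(u, u'), (u', u)}" if "(x, x') \<in> PE - {(u, u'), (u', u)}" for x x'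
      using that PE_sym by auto
    ultimately show ?thesis using rtrancl_sym_set[of "PE - {(u, u'), (u', u)}" u u'] by blast
  next
    case (stem_rev a y)
    then show ?thesis using stem_bridge[OF stem_rev(1)] by (simp add: insert_commute)
  qed
  show "(pa g u, pa g u') \<in> PE" if "g \<in> carrier G" "(u, u') \<in> PE" for g
    using that(2)
  proof (cases rule: edge_cases)
    case (lift a b)
    then show ?thesis using tail_act[OF that(1), symmetric] X.edge_sym lift_edge X.act_edge that by auto
  qed (use that N_act stem_edge in auto)
  show "pa g u' \<noteq> u" if g: "g \<in> carrier G" "(u, u') \<in> PE" "pa g u = u'" for g
    using g(2)
  proof (cases rule: edge_cases)
    case (lift a b)
    have "pull_proj (pa g u) = act g a" "pull_proj (pa g u') = act g b"
      using lift tail_act[OF g(1), symmetric] X.edge_sym by auto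
    then have "act g a = b" using g lift by auto
    then have "act g b \<noteq> a" using X.no_inversion g lift by blast
    then show ?thesis using lift \<open>pull_proj (pa g u') = act g b\<close> by auto
  qed (use g in auto)
qed

lemma pull_pairs:
  "collapsed_pairs G pa (Inr (x0, y0)) (Inl x0) = pull_stem ` N \<union> (prod.swap \<circ> pull_stem) ` N"
  by (force simp: collapsed_pairs_def orbit_def N_def pull_stem_def)

text \<open>
  The expansion is elementary because the orbit of the new vertex contains no old vertex, and
  its stabilizer fixes \<open>x0\<close> and hence the stem.
\<close>

lemma pull_collapse: "tree_collapse G PV PE pa V E act (Inr (x0, y0)) (Inl x0) pull_proj"
  unfolding tree_collapse_def
proof (intro conjI ballI)
  let ?F = "collapsed_pairs G pa (Inr (x0, y0)) (Inl x0)"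
  interpret P: G_rel_tree G PV PE pa by (rule pull_tree)
  show "(Inr (x0, y0), Inl x0) \<in> PE" using stem_edge base_N by auto
  show "orbit G pa (Inr (x0, y0)) \<noteq> orbit G pa (Inl x0)"
    using P.orbit_self[of "Inl x0"] x0 by (auto simp: orbit_def pull_verts_def)
  show "stabilizer G pa (Inr (x0, y0)) \<subseteq> stabilizer G pa (Inl x0)" by (auto simp: stabilizer_def)
  show "pull_proj ` PV = V"
  proof
    show "pull_proj ` PV \<subseteq> V" using N_mem by (auto simp: pull_verts_def)
    show "V \<subseteq> pull_proj ` PV" by (force simp: pull_verts_def image_image)
  qed
  show "pull_proj (pa g u) = act g (pull_proj u)" for g u
    by (cases u) auto
  show "pull_proj u = pull_proj u' \<longleftrightarrow> (u, u') \<in> ?F\<^sup>*" if "u \<in> PV" "u' \<in> PV" for u u'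
  proof
    have F: "(u, Inl (pull_proj u)) \<in> ?F\<^sup>* \<and> (Inl (pull_proj u), u) \<in> ?F\<^sup>*" if u: "u \<in> PV" for u
    proof (cases u)
      case (Inr n)
      then have "n \<in> N" using u by (auto simp: pull_verts_def)
      then have "(Inr n, Inl (fst n)) \<in> ?F" "(Inl (fst n), Inr n) \<in> ?F"
        unfolding pull_pairs by (force simp: pull_stem_def)+
      then show ?thesis using Inr by auto
    qed auto
    show "(u, u') \<in> ?F\<^sup>*" if "pull_proj u = pull_proj u'"
      using F[OF \<open>u \<in> PV\<close>] F[OF \<open>u' \<in> PV\<close>] that by (metis rtrancl_trans)
    show "pull_proj u = pull_proj u'" if "(u, u') \<in> ?F\<^sup>*"
      using that unfolding pull_pairs by (induction rule: rtrancl_induct) (auto simp: pull_stem_def)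
  qed
  have "pull_lift N f ` E \<inter> ?F = {}"
  proof -
    have "pull_proj (fst e) = pull_proj (snd e)" if "e \<in> ?F" for e
      using that unfolding pull_pairs by (auto simp: pull_stem_def)
    moreover have "pull_proj (fst (pull_lift N f e)) \<noteq> pull_proj (snd (pull_lift N f e))" if "e \<in> E" for e
      using that X.edge_neq by (cases e) (auto simp: pull_lift_def)
    ultimately show ?thesis by blast
  qed
  then have "PE - ?F = pull_lift N f ` E" unfolding pull_pairs pull_edges_def by auto
  moreover have "map_prod pull_proj pull_proj (pull_lift N f e) = e" for e
    by (cases e) (simp add: pull_lift_def)
  ultimately show "E = map_prod pull_proj pull_proj ` (PE - ?F)" by (simp add: image_image)
qed

lemma pull_G_tree_map: "G_tree_map G PV PE pa W D bct pf"
proof -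
  interpret P: G_rel_tree G PV PE pa by (rule pull_tree)
  show ?thesis
  proof
    show "pf u \<in> W" if "u \<in> PV" for u using that f_closed N_mem by (auto simp: pull_verts_def)
    show "pf (pa g u) = bct g (pf u)" if "g \<in> carrier G" "u \<in> PV" for g u
      using that f_act by (auto simp: pull_verts_def)
    show "pf u = pf u' \<or> (pf u, pf u') \<in> D" if "(u, u') \<in> PE" for u u'
      using that
    proof (cases rule: edge_cases)
      case (lift a b)
      then show ?thesis using f_edge not_both by (auto simp: pull_tail_def)
    qed (use N_mem Y.edge_sym in auto)
  qed
qed

lemma N_action: "set_action G N (\<lambda>g. map_prod (act g) (bct g))"
  using N_mem by unfold_locales (auto simp: N_act X.act_one Y.act_one X.act_mult Y.act_mult)

lemma pull_finite:
  assumes "finite (orbits G V act)" "finite (orbits G E (pact act))"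
  shows "finite (orbits G PV pa)" "finite (orbits G PE (pact pa))"
proof -
  let ?na = "\<lambda>g. map_prod (act g) (bct g)"
  interpret Nact: set_action G N ?na by (rule N_action)
  have N1: "finite (orbits G N ?na)" using Nact.orbits_orbit[OF base_N] by (simp flip: N_def)
  have "orbits G (Inl ` V) pa = (`) Inl ` orbits G V act"
    by (rule orbits_image) auto
  moreover have "orbits G (Inr ` N) pa = (`) Inr ` orbits G N ?na"
    by (rule orbits_image) auto
  ultimately show "finite (orbits G PV pa)" using assms N1 by (simp add: pull_verts_def orbits_Un)
  have "orbits G (pull_lift N f ` E) (pact pa) = (`) (pull_lift N f) ` orbits G E (pact act)"
    using tail_act X.edge_sym by (intro orbits_image) (auto simp: pull_lift_def)
  moreover have "orbits G (pull_stem ` N) (pact pa) = (`) pull_stem ` orbits G N ?na"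
    by (intro orbits_image) (auto simp: pull_stem_def)
  moreover have "orbits G ((prod.swap \<circ> pull_stem) ` N) (pact pa) = (`) (prod.swap \<circ> pull_stem) ` orbits G N ?na"
    by (intro orbits_image) (auto simp: pull_stem_def)
  ultimately show "finite (orbits G PE (pact pa))"
    using assms N1 by (simp add: pull_edges_def orbits_Un)
qed

text \<open>
  At most one end of an edge is moved. The one counted edge is then replaced by a stem, which
  is counted, and a moved edge, which is not.
\<close>

lemma pull_nc_walk:
  assumes "nc_walk E f k a b" shows "nc_walk PE pf k (Inl a) (Inl b)"
  using assms
proof (rule nc_map)
  fix a b assume ab: "(a, b) \<in> E"
  then have ba: "(b, a) \<in> E" by (rule X.edge_sym)
  note lift = lift_edge[OF ab]
  show "nc_walk PE pf 0 (Inl a) (Inl b)" if eq: "f a = f b"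
  proof -
    have "(a, f b) \<notin> N" "(b, f a) \<notin> N" using N_mem Y.edge_irrefl eq by metis+
    then show ?thesis using lift eq by (auto simp: pull_tail_def intro!: nc_edge)
  qed
  show "nc_walk PE pf (Suc 0) (Inl a) (Inl b)" if ne: "f a \<noteq> f b"
  proof -
    consider "(a, f b) \<in> N" "(b, f a) \<notin> N" | "(a, f b) \<notin> N" "(b, f a) \<in> N" | "(a, f b) \<notin> N" "(b, f a) \<notin> N"
      using not_both[OF ab] by blast
    then show ?thesis
    proof cases
      case 1
      have "(Inr (a, f b), Inl b) \<in> PE" using lift 1 by (simp add: pull_tail_def)
      then show ?thesis using ne
        by (intro nc_step[OF stem_edge(1)[OF 1(1)] _ nc_edge(1)]) auto
    next
      case 2
      have "(Inl a, Inr (b, f a)) \<in> PE" using lift 2 by (simp add: pull_tail_def)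
      then show ?thesis using ne stem_edge(2)[OF 2(2)]
        by (intro nc_coll[OF _ _ nc_edge(2)[of "Inr (b, f a)"]]) auto
    next
      case 3
      then show ?thesis using lift ne by (auto simp: pull_tail_def intro!: nc_edge)
    qed
  qed
qed

text \<open>
  Two edges at \<open>b\<close> with the same image meet at the new vertex, and neither is counted any
  more.
\<close>

lemma pull_fold:
  assumes "(b, a) \<in> E" "(b, c) \<in> E" "(b, f a) \<in> N" "f c = f a"
  shows "nc_walk PE pf 0 (Inl a) (Inl c)"
proof -
  have "(a, f b) \<notin> N" "(c, f b) \<notin> N" using not_both assms by metis+
  then have "(Inl a, Inr (b, f a)) \<in> PE" "(Inr (b, f a), Inl c) \<in> PE"
    using lift_edge[OF X.edge_sym[OF assms(1)]] lift_edge[OF assms(2)] assms by (auto simp: pull_tail_def)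
  then show ?thesis using assms by (intro nc_coll[OF _ _ nc_edge(1)[of "Inr (b, f a)"]]) auto
qed

text \<open>
  After the pull the orbits of the two edges from \<open>x0\<close> are no longer counted. The orbit of
  stems is, and it is made to correspond to the orbit of the first edge; so every counted
  orbit of the new tree comes from one of the old tree other than that of \<open>(x0, x')\<close>.
\<close>

lemma pull_nc_card:
  assumes x: "(x0, x) \<in> E" "f x = y0" and x': "(x0, x') \<in> E" "f x' = y0"
    and orb: "orbit G (pact act) (x0, x) \<noteq> orbit G (pact act) (x0, x')"
      "orbit G (pact act) (x, x0) \<noteq> orbit G (pact act) (x0, x')"
    and fin: "finite (orbits G E (pact act))"
  shows "card (orbits G (nc_edges PE pf) (pact pa)) < card (orbits G (nc_edges E f) (pact act))"
proof -
  interpret PA: set_action G E "pact act" by (rule X.pairs_action)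
  \<comment> \<open>One preimage for each counted edge of the new tree: a stem comes from an edge that was moved to its top, any other counted edge from itself.\<close>
  define lift where "lift e = (if (fst e, f (snd e)) \<in> N then (Inl (fst e), Inr (fst e, f (snd e)))
     else if (snd e, f (fst e)) \<in> N then (Inr (snd e, f (fst e)), Inl (snd e))
     else (Inl (fst e), Inl (snd e)))" for e
  let ?O = "orbits G (nc_edges E f) (pact act)"
  have finO: "finite ?O"
    by (rule finite_subset[OF _ fin]) (auto simp: orbits_def nc_edges_def)
  have lift_act: "lift (pact act g e) = pact pa g (lift e)" if "g \<in> carrier G" "e \<in> E" for g e
  proof -
    obtain a b where e: "e = (a, b)" by force
    then have "a \<in> V" "b \<in> V" using X.edge_verts that by auto
    then show ?thesis
      using N_act_iff[OF that(1), of a "f b"] N_act_iff[OF that(1), of b "f a"] f_closed f_act[OF that(1)]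
      by (auto simp: lift_def e)
  qed
  have orbit_lift: "orbit G (pact pa) (lift e) = lift ` orbit G (pact act) e" if "e \<in> E" for e
    using lift_act that by (intro orbit_image)
  have ne: "f x0 \<noteq> y0" using y0 Y.edge_irrefl by metis
  have xact: "pact act g (x0, x) \<in> nc_edges E f" "pact act g (x, x0) \<in> nc_edges E f" if "g \<in> carrier G" for g
  proof -
    have "f (act g x0) = bct g (f x0)" "f (act g x) = bct g y0" using f_act that x x0 X.edge_verts by auto
    moreover have "bct g (f x0) \<noteq> bct g y0" using Y.act_inj[OF that] ne Y.edge_verts[OF y0] by auto
    ultimately show "pact act g (x0, x) \<in> nc_edges E f" "pact act g (x, x0) \<in> nc_edges E f"
      using X.act_edge[OF that] x X.edge_sym by (auto simp: nc_edges_def)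
  qed
  have pre: "\<exists>e\<in>nc_edges E f. lift e = e' \<and> orbit G (pact act) e \<noteq> orbit G (pact act) (x0, x')"
    if e': "e' \<in> nc_edges PE pf" for e'
  proof -
    obtain u u' where u: "e' = (u, u')" "(u, u') \<in> PE" "pf u \<noteq> pf u'"
      using e' by (auto simp: nc_edges_def)
    from u(2) show ?thesis
    proof (cases rule: edge_cases)
      case (lift a b)
      have "(a, f b) \<notin> N" "(b, f a) \<notin> N"
        using u(3) lift not_both by (auto simp: pull_tail_def split: if_splits)
      then have "lift (a, b) = e'" "f a \<noteq> f b" using u lift by (auto simp: lift_def pull_tail_def)
      moreover have "orbit G (pact act) (a, b) \<noteq> orbit G (pact act) (x0, x')"
      proof
        assume "orbit G (pact act) (a, b) = orbit G (pact act) (x0, x')"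
        then have "(a, b) \<in> orbit G (pact act) (x0, x')" using PA.orbit_self lift by auto
        then obtain g where "g \<in> carrier G" "a = act g x0" "b = act g x'" by (auto simp: orbit_def)
        then have "(a, f b) \<in> N" using N_act[OF _ base_N] f_act x' X.edge_verts by auto
        then show False using \<open>(a, f b) \<notin> N\<close> by simp
      qed
      ultimately show ?thesis using lift by (intro bexI[of _ "(a, b)"]) (auto simp: nc_edges_def)
    next
      case (stem a y)
      obtain g where g: "g \<in> carrier G" "a = act g x0" "y = bct g y0"
        using N_cases[OF stem(1)] by (metis prod.inject)
      let ?e = "pact act g (x0, x)"
      have "f (act g x) = y" using f_act g x X.edge_verts by auto
      then have "lift ?e = (Inl a, Inr (a, y))" using stem(1) unfolding lift_def g(2)[symmetric] map_prod_simp by simp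
      then have "lift ?e = e'" using stem u(1) by simp
      moreover have "orbit G (pact act) ?e \<noteq> orbit G (pact act) (x0, x')"
        using PA.orbit_act[OF g(1) x(1)] orb by simp
      ultimately show ?thesis using xact(1)[OF g(1)] by blast
    next
      case (stem_rev a y)
      obtain g where g: "g \<in> carrier G" "a = act g x0" "y = bct g y0"
        using N_cases[OF stem_rev(1)] by (metis prod.inject)
      let ?e = "pact act g (x, x0)"
      have fx: "f (act g x) = y" using f_act g x X.edge_verts by auto
      have "(act g x0, act g x) \<in> E" using X.act_edge g x by auto
      then have "(act g x, f (act g x0)) \<notin> N" using not_both stem_rev g fx by metis
      then have "lift ?e = (Inr (a, y), Inl a)"
        using stem_rev(1) unfolding lift_def g(2)[symmetric] map_prod_simp fst_conv snd_conv fx by simp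
      then have "lift ?e = e'" using stem_rev u(1) by simp
      moreover have "orbit G (pact act) ?e \<noteq> orbit G (pact act) (x0, x')"
        using PA.orbit_act[OF g(1) X.edge_sym[OF x(1)]] orb by simp
      ultimately show ?thesis using xact(2)[OF g(1)] by blast
    qed
  qed
  have "orbits G (nc_edges PE pf) (pact pa) \<subseteq> (`) lift ` (?O - {orbit G (pact act) (x0, x')})"
  proof
    fix B assume "B \<in> orbits G (nc_edges PE pf) (pact pa)"
    then obtain e' where e': "e' \<in> nc_edges PE pf" "B = orbit G (pact pa) e'" unfolding orbits_def by blast
    obtain e where e: "e \<in> nc_edges E f" "lift e = e'" "orbit G (pact act) e \<noteq> orbit G (pact act) (x0, x')"
      using pre[OF e'(1)] by blast
    then have "B = lift ` orbit G (pact act) e" using orbit_lift e' by (auto simp: nc_edges_def)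
    moreover have "orbit G (pact act) e \<in> ?O" using e(1) unfolding orbits_def by blast
    ultimately show "B \<in> (`) lift ` (?O - {orbit G (pact act) (x0, x')})" using e by blast
  qed
  then have "card (orbits G (nc_edges PE pf) (pact pa)) \<le> card (?O - {orbit G (pact act) (x0, x')})"
    using finO by (meson card_image_le card_mono finite_Diff finite_imageI order_trans)
  also have "\<dots> < card ?O"
  proof (rule card_Diff1_less[OF finO])
    have "(x0, x') \<in> nc_edges E f" using x' ne by (auto simp: nc_edges_def)
    then show "orbit G (pact act) (x0, x') \<in> ?O" unfolding orbits_def by blast
  qed
  finally show ?thesis .
qed

end

section \<open>Transport of trees and termination of folding\<close>

definition tree_iso where
  "tree_iso G V E act V' E' act' j \<longleftrightarrow> bij_betw j V V' \<and> E' = map_prod j j ` E \<and>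
     (\<forall>g\<in>carrier G. \<forall>v\<in>V. j (act g v) = act' g (j v))"

lemma rtrancl_image_iff:
  assumes "inj_on j V" "F \<subseteq> V \<times> V" "a \<in> V" "b \<in> V"
  shows "(j a, j b) \<in> (map_prod j j ` F)\<^sup>* \<longleftrightarrow> (a, b) \<in> F\<^sup>*"
proof
  assume "(a, b) \<in> F\<^sup>*"
  then show "(j a, j b) \<in> (map_prod j j ` F)\<^sup>*"
    by (rule rtrancl_map) (force intro: r_into_rtrancl)
next
  assume "(j a, j b) \<in> (map_prod j j ` F)\<^sup>*"
  then have "(inv_into V j (j a), inv_into V j (j b)) \<in> F\<^sup>*"
  proof (rule rtrancl_map)
    fix x y assume "(x, y) \<in> map_prod j j ` F"
    then obtain c d where cd: "(c, d) \<in> F" "x = j c" "y = j d" by auto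
    then have "c \<in> V" "d \<in> V" using assms by auto
    then show "(inv_into V j x, inv_into V j y) \<in> F\<^sup>*" using cd assms by auto
  qed
  then show "(a, b) \<in> F\<^sup>*" using assms by simp
qed

context G_rel_tree
begin

lemma tree_iso_tree:
  assumes "tree_iso G V E act V' E' act' j"
  shows "G_rel_tree G V' E' act'"
proof -
  interpret tree_quotient G V E act "{}" j V' E' act'
    by unfold_locales (use assms in \<open>auto simp: tree_iso_def bij_betw_def inj_on_eq_iff\<close>)
  show ?thesis by (rule quotient_tree)
qed

lemma tree_iso_inv:
  assumes "tree_iso G V E act V' E' act' j"
  shows "tree_iso G V' E' act' V E act (inv_into V j)"
proof -
  have bij: "bij_betw j V V'" and inj: "inj_on j V" and im: "j ` V = V'"
    and E': "E' = map_prod j j ` E" and eq: "\<And>g v. g \<in> carrier G \<Longrightarrow> v \<in> V \<Longrightarrow> act' g (j v) = j (act g v)"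
    using assms by (auto simp: tree_iso_def bij_betw_def)
  have "map_prod (inv_into V j) (inv_into V j) ` E' = E"
  proof -
    have "map_prod (inv_into V j) (inv_into V j) (map_prod j j e) = e" if "e \<in> E" for e
      using that edge_verts inj by (cases e) auto
    then show ?thesis unfolding E' by (simp add: image_image)
  qed
  then show ?thesis unfolding tree_iso_def
    using bij_betw_inv_into[OF bij] im eq inj act_closed by auto
qed

lemma tree_iso_trans:
  assumes "tree_iso G V E act V' E' act' j" "tree_iso G V' E' act' V'' E'' act'' k"
  shows "tree_iso G V E act V'' E'' act'' (k \<circ> j)"
proof -
  have "j v \<in> V'" if "v \<in> V" for v using assms(1) that by (auto simp: tree_iso_def bij_betw_def)
  then show ?thesis using assms unfolding tree_iso_def
    by (auto simp: image_image map_prod_compose intro: bij_betw_trans)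
qed

lemma iso_orbit:
  assumes "tree_iso G V E act V' E' act' j" "v \<in> V"
  shows "orbit G act' (j v) = j ` orbit G act v"
  using assms by (intro orbit_image) (auto simp: tree_iso_def)

lemma iso_pairs:
  assumes "tree_iso G V E act V' E' act' j" "v \<in> V" "w \<in> V"
  shows "collapsed_pairs G act' (j v) (j w) = map_prod j j ` collapsed_pairs G act v w"
proof -
  have "orbit G (pact act') (j a, j b) = map_prod j j ` orbit G (pact act) (a, b)"
    if "a \<in> V" "b \<in> V" for a b
    using orbit_image[of G "map_prod j j" "pact act" "(a, b)" "pact act'"] assms that
    by (auto simp: tree_iso_def)
  then show ?thesis using assms by (simp add: collapsed_pairs_def image_Un)
qed

lemma iso_orbits:
  assumes "tree_iso G V E act V' E' act' j"
  shows "orbits G V' act' = (`) j ` orbits G V act"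
    and "orbits G E' (pact act') = (`) (map_prod j j) ` orbits G E (pact act)"
proof -
  have "orbits G (j ` V) act' = (`) j ` orbits G V act"
    using assms by (intro orbits_image) (auto simp: tree_iso_def)
  then show "orbits G V' act' = (`) j ` orbits G V act"
    using assms by (simp add: tree_iso_def bij_betw_def)
  have "orbits G (map_prod j j ` E) (pact act') = (`) (map_prod j j) ` orbits G E (pact act)"
    using assms edge_verts by (intro orbits_image) (fastforce simp: tree_iso_def)
  then show "orbits G E' (pact act') = (`) (map_prod j j) ` orbits G E (pact act)"
    using assms by (simp add: tree_iso_def)
qed

lemma tree_collapse_iso:
  assumes c: "tree_collapse G V E act V' E' act' v w q"
    and i: "tree_iso G V E act V1 E1 act1 i" and j: "tree_iso G V' E' act' V1' E1' act1' j"
  shows "tree_collapse G V1 E1 act1 V1' E1' act1' (i v) (i w) (j \<circ> q \<circ> inv_into V i)"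
proof -
  let ?F = "collapsed_pairs G act v w" and ?i = "inv_into V i"
  have vw: "(v, w) \<in> E" and orb: "orbit G act v \<noteq> orbit G act w"
    and st: "stabilizer G act v \<subseteq> stabilizer G act w" and qV: "q ` V = V'"
    and qa: "\<And>g a. g \<in> carrier G \<Longrightarrow> a \<in> V \<Longrightarrow> q (act g a) = act' g (q a)"
    and qe: "\<And>a b. a \<in> V \<Longrightarrow> b \<in> V \<Longrightarrow> q a = q b \<longleftrightarrow> (a, b) \<in> ?F\<^sup>*"
    and E': "E' = map_prod q q ` (E - ?F)"
    using c unfolding tree_collapse_def by blast+
  have V: "v \<in> V" "w \<in> V" using vw edge_verts by auto
  have inj: "inj_on i V" and V1: "i ` V = V1" and E1: "E1 = map_prod i i ` E"
    and ia: "\<And>g a. g \<in> carrier G \<Longrightarrow> a \<in> V \<Longrightarrow> act1 g (i a) = i (act g a)"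
    using i by (auto simp: tree_iso_def bij_betw_def)
  have injj: "inj_on j V'" and V1': "j ` V' = V1'" and E1': "E1' = map_prod j j ` E'"
    and ja: "\<And>g a. g \<in> carrier G \<Longrightarrow> a \<in> V' \<Longrightarrow> act1' g (j a) = j (act' g a)"
    using j by (auto simp: tree_iso_def bij_betw_def)
  have EV: "E \<subseteq> V \<times> V" using edge_verts by auto
  have FE: "?F \<subseteq> E" by (rule pairs_sub[OF vw])
  have F1: "collapsed_pairs G act1 (i v) (i w) = map_prod i i ` ?F" by (rule iso_pairs[OF i V])
  have injE: "inj_on (map_prod i i) E"
    using map_prod_inj_on[OF inj inj] EV by (rule inj_on_subset)
  show ?thesis
    unfolding tree_collapse_def F1
  proof (intro conjI ballI)
    show "(i v, i w) \<in> E1" using vw E1 by force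
    show "orbit G act1 (i v) \<noteq> orbit G act1 (i w)"
      using orb inj_on_image_eq_iff[OF inj orbit_sub[OF V(1)] orbit_sub[OF V(2)]]
      by (simp add: iso_orbit[OF i] V)
    show "stabilizer G act1 (i v) \<subseteq> stabilizer G act1 (i w)"
      using st V ia act_closed inj_onD[OF inj] by (fastforce simp: stabilizer_def)
    show "(j \<circ> q \<circ> ?i) ` V1 = V1'"
    proof -
      have "?i ` V1 = V" using inj V1 by (metis inv_into_image_cancel subset_refl)
      then show ?thesis using qV V1' by (simp only: image_comp[symmetric])
    qed
    show "(j \<circ> q \<circ> ?i) (act1 g x) = act1' g ((j \<circ> q \<circ> ?i) x)" if gx: "g \<in> carrier G" "x \<in> V1" for g x
    proof -
      obtain a where "x = i a" "a \<in> V" using gx V1 by auto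
      then show ?thesis using gx ia ja qa qV inj act_closed by auto
    qed
    show "(j \<circ> q \<circ> ?i) x = (j \<circ> q \<circ> ?i) y \<longleftrightarrow> (x, y) \<in> (map_prod i i ` ?F)\<^sup>*" if xy: "x \<in> V1" "y \<in> V1" for x y
    proof -
      obtain a b where ab: "x = i a" "a \<in> V" "y = i b" "b \<in> V" using xy V1 by auto
      have "(j \<circ> q \<circ> ?i) x = (j \<circ> q \<circ> ?i) y \<longleftrightarrow> q a = q b"
        using ab inj qV injj by (auto dest: inj_onD)
      also have "\<dots> \<longleftrightarrow> (a, b) \<in> ?F\<^sup>*" using qe ab by auto
      also have "\<dots> \<longleftrightarrow> (x, y) \<in> (map_prod i i ` ?F)\<^sup>*"
        using rtrancl_image_iff[OF inj, of ?F] FE EV ab by blast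
      finally show ?thesis .
    qed
    have "E1 - map_prod i i ` ?F = map_prod i i ` (E - ?F)"
      unfolding E1 using inj_on_image_set_diff[OF injE, of E ?F] FE by auto
    moreover have "map_prod (j \<circ> q \<circ> ?i) (j \<circ> q \<circ> ?i) (map_prod i i e) = map_prod j j (map_prod q q e)"
      if "e \<in> E" for e
      using that edge_verts inj by (cases e) auto
    ultimately show "E1' = map_prod (j \<circ> q \<circ> ?i) (j \<circ> q \<circ> ?i) ` (E1 - map_prod i i ` ?F)"
      unfolding E1' E' by (simp add: image_image)
  qed
qed

lemma iso_exists:
  assumes "inj_on \<iota> V"
  shows "\<exists>act'. tree_iso G V E act (\<iota> ` V) (map_prod \<iota> \<iota> ` E) act' \<iota>"
  using assms
  by (intro exI[of _ "\<lambda>g x. \<iota> (act g (inv_into V \<iota> x))"]) (auto simp: tree_iso_def bij_betw_def)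

end

text \<open>
  Sequences of collapses and expansions that end at the tree \<open>(W, D, bct)\<close>. All intermediate
  trees have the same type, and finitely many orbits, so that they can be realized by graphs
  later.
\<close>

inductive deforms_to for G :: "('g, 'm) monoid_scheme" and W :: "'b set" and D bct where
  deform_iso: "tree_iso G V E act W D bct j \<Longrightarrow> deforms_to G W D bct V E act"
| deform_collapse: "tree_collapse G V E act V' E' act' v w q \<Longrightarrow> G_rel_tree G V' E' act' \<Longrightarrow>
     finite (orbits G V' act') \<Longrightarrow> finite (orbits G E' (pact act')) \<Longrightarrow>
     deforms_to G W D bct V' E' act' \<Longrightarrow> deforms_to G W D bct V E act"
| deform_expand: "tree_collapse G V' E' act' V E act v w q \<Longrightarrow> G_rel_tree G V' E' act' \<Longrightarrow>
     finite (orbits G V' act') \<Longrightarrow> finite (orbits G E' (pact act')) \<Longrightarrow>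
     deforms_to G W D bct V' E' act' \<Longrightarrow> deforms_to G W D bct V E act"

context G_tree_map_and_back
begin

lemma transport:
  assumes iso: "tree_iso G V E act V' E' act' j"
  shows "G_tree_map_and_back G V' E' act' W D bct (f \<circ> inv_into V j) (j \<circ> s)"
proof -
  interpret V': G_rel_tree G V' E' act' by (rule X.tree_iso_tree[OF iso])
  have j: "inj_on j V" "V' = j ` V" "E' = map_prod j j ` E"
    and act': "\<And>g v. g \<in> carrier G \<Longrightarrow> v \<in> V \<Longrightarrow> act' g (j v) = j (act g v)"
    using iso by (auto simp: tree_iso_def bij_betw_def)
  show ?thesis
  proof
    show "(f \<circ> inv_into V j) x \<in> W" if "x \<in> V'" for x using that j f_closed by auto
    show "(f \<circ> inv_into V j) (act' g x) = bct g ((f \<circ> inv_into V j) x)" if "g \<in> carrier G" "x \<in> V'" for g x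
      using that j act' X.act_closed f_act by auto
    show "(f \<circ> inv_into V j) x = (f \<circ> inv_into V j) y \<or> ((f \<circ> inv_into V j) x, (f \<circ> inv_into V j) y) \<in> D"
      if xy: "(x, y) \<in> E'" for x y
    proof -
      from xy obtain a b where ab: "(a, b) \<in> E" "x = j a" "y = j b" unfolding j(3) by auto
      then show ?thesis using j(1) f_edge[OF ab(1)] X.edge_verts[OF ab(1)] by auto
    qed
    show "(j \<circ> s) y \<in> V'" if "y \<in> W" for y using that s_closed j by auto
    show "(j \<circ> s) (bct g y) = act' g ((j \<circ> s) y)" if "g \<in> carrier G" "y \<in> W" for g y
      using that s_act s_closed act' by auto
    show "finite (orbits G V' act')" using X.iso_orbits(1)[OF iso] fin_V by simp
    show "finite (orbits G E' (pact act'))" using X.iso_orbits(2)[OF iso] fin_E by simp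
  qed
qed

text \<open>
  The new tree is transported to the vertex type shared by all trees of the sequence. The
  vertices \<open>s' y\<close> may be chosen among old and new vertices.
\<close>

lemma pull_exists:
  assumes x0: "x0 \<in> V" "(f x0, y0) \<in> D"
    and M: "M = pull.N G act bct x0 y0"
    and s': "\<And>y. y \<in> W \<Longrightarrow> s' y \<in> pull_verts V M"
    "\<And>g y. g \<in> carrier G \<Longrightarrow> y \<in> W \<Longrightarrow> s' (bct g y) = pull_act act bct g (s' y)"
  obtains V' :: "('g \<times> nat) set" and E' act' f' j v w q
  where "tree_iso G (pull_verts V M) (pull_edges E M f) (pull_act act bct) V' E' act' j"
    "\<forall>u\<in>pull_verts V M. f' (j u) = pull_map f u"
    "G_tree_map_and_back G V' E' act' W D bct f' (j \<circ> s')"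
    "tree_collapse G V' E' act' V E act v w q"
proof -
  interpret P: pull G V E act W D bct f x0 y0 using x0 by unfold_locales
  have M': "M = P.N" using M by simp
  interpret T: G_rel_tree G P.PV P.PE P.pa by (rule P.pull_tree)
  interpret TM: G_tree_map G P.PV P.PE P.pa W D bct P.pf by (rule P.pull_G_tree_map)
  note fin = P.pull_finite[OF fin_V fin_E]
  obtain j :: "_ \<Rightarrow> 'g \<times> nat" where j: "inj_on j P.PV"
    using T.embedding_exists[OF fin(1)] by blast
  obtain act' where iso: "tree_iso G P.PV P.PE P.pa (j ` P.PV) (map_prod j j ` P.PE) act' j"
    using T.iso_exists[OF j] by blast
  interpret S: G_tree_map_and_back G P.PV P.PE P.pa W D bct P.pf s'
    by unfold_locales (use s' M' fin in auto)
  have "tree_iso G V E act V E act id"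
    by (auto simp: tree_iso_def map_prod.id bij_betw_def)
  then have "tree_collapse G (j ` P.PV) (map_prod j j ` P.PE) act' V E act
      (j (Inr (x0, y0))) (j (Inl x0)) (id \<circ> pull_proj \<circ> inv_into P.PV j)"
    by (rule T.tree_collapse_iso[OF P.pull_collapse iso])
  moreover have "\<forall>u\<in>P.PV. (P.pf \<circ> inv_into P.PV j) (j u) = P.pf u" using j by simp
  ultimately show thesis using that iso S.transport[OF iso] M' by blast
qed

lemma nc_walk_exists:
  assumes "a \<in> V" "b \<in> V" shows "\<exists>k. nc_walk E f k a b"
  using X.connected[OF assms]
proof (induction rule: converse_rtrancl_induct)
  case base
  then show ?case by (blast intro: nc_refl)
next
  case (step x y)
  then show ?case by (cases "f x = f y") (blast intro: nc_coll nc_step)+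
qed

end

definition nc_dist :: "('a \<times> 'a) set \<Rightarrow> ('a \<Rightarrow> 'w) \<Rightarrow> 'a \<Rightarrow> 'a \<Rightarrow> nat" where
  "nc_dist E f a b = (LEAST k. nc_walk E f k a b)"

lemma nc_dist_le: "nc_walk E f k a b \<Longrightarrow> nc_dist E f a b \<le> k"
  unfolding nc_dist_def by (rule Least_le)

lemma nc_dist_walk: "nc_walk E f k a b \<Longrightarrow> nc_walk E f (nc_dist E f a b) a b"
  unfolding nc_dist_def by (rule LeastI)

lemma nc_walk_relpow:
  "nc_walk E f k a b \<Longrightarrow> (\<And>a b. (a, b) \<in> E \<Longrightarrow> f a \<noteq> f b) \<Longrightarrow> (a, b) \<in> E ^^ k"
proof (induction rule: nc_walk.induct)
  case (nc_step a b k c)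
  then show ?case by (meson relpow_Suc_I2)
qed auto

lemma relpow_nc_walk:
  "(a, b) \<in> E ^^ k \<Longrightarrow> (\<And>a b. (a, b) \<in> E \<Longrightarrow> f a \<noteq> f b) \<Longrightarrow> nc_walk E f k a b"
proof (induction k arbitrary: a)
  case (Suc k)
  then obtain c where "(a, c) \<in> E" "(c, b) \<in> E ^^ k" by (meson relpow_Suc_D2)
  then show ?case using Suc by (meson nc_step)
qed (auto intro: nc_refl)

lemma orbits_image_card:
  assumes "\<And>g a. g \<in> carrier G \<Longrightarrow> a \<in> A \<Longrightarrow> h (act g a) = act' g (h a)" "finite (orbits G A act)"
  shows "card (orbits G (h ` A) act') \<le> card (orbits G A act)"
  using orbits_image[of G A h act act'] assms card_image_le by metis

text \<open>
  The first component measures how far \<open>s\<close> is from mapping edges to edges, on orbit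
  representatives \<open>R\<close> of the edges of the target. The pulls used below reduce the first
  component, or the second without increasing the first. A collapse reduces the third without
  increasing the others.
\<close>

definition fold_complexity where
  "fold_complexity G E act f s R = (\<Sum>r\<in>R. nc_dist E f (s (fst r)) (s (snd r)),
     card (orbits G (nc_edges E f) (pact act)), card (orbits G E (pact act)))"

abbreviation simpler :: "((nat \<times> nat \<times> nat) \<times> (nat \<times> nat \<times> nat)) set" where
  "simpler \<equiv> less_than <*lex*> less_than <*lex*> less_than"

context G_tree_map_and_back
begin

lemma collapse_simplifies:
  assumes "(a, b) \<in> E" "f a = f b" and R: "R \<subseteq> D"
  obtains v w q V' E' act' where "tree_collapse G V E act V' E' act' v w q"
    "G_tree_map_and_back G V' E' act' W D bct f (q \<circ> s)" "\<forall>x\<in>V. f (q x) = f x"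
    "(fold_complexity G E' act' f (q \<circ> s) R, fold_complexity G E act f s R) \<in> simpler"
proof -
  have RW: "fst r \<in> W" "snd r \<in> W" if "r \<in> R" for r
    using that R Y.edge_verts by (cases r; auto)+
  from collapse_exists[OF assms(1,2)] obtain v w q V' E' act' where
    c: "tree_collapse G V E act V' E' act' v w q" and
    S': "G_tree_map_and_back G V' E' act' W D bct f (q \<circ> s)" and fq: "\<forall>x\<in>V. f (q x) = f x"
    by blast
  interpret S': G_tree_map_and_back G V' E' act' W D bct f "q \<circ> s" by (rule S')
  let ?F = "collapsed_pairs G act v w"
  have vw: "(v, w) \<in> E" and E': "E' = map_prod q q ` (E - ?F)"
    and qa: "\<And>g a. g \<in> carrier G \<Longrightarrow> a \<in> V \<Longrightarrow> q (act g a) = act' g (q a)"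
    and qe: "\<And>a b. a \<in> V \<Longrightarrow> b \<in> V \<Longrightarrow> q a = q b \<longleftrightarrow> (a, b) \<in> ?F\<^sup>*"
    using c unfolding tree_collapse_def by blast+
  have qF: "q a = q b" if "(a, b) \<in> ?F" for a b
    using that qe X.pairs_sub[OF vw] X.edge_verts by blast
  have fF: "f a = f b" if "(a, b) \<in> ?F" for a b
    using qF[OF that] fq that X.pairs_sub[OF vw] X.edge_verts by (metis subsetD)
  have nc: "nc_walk E' f k (q a) (q b)" if "nc_walk E f k a b" for k a b
    using that
  proof (rule nc_map)
    fix a b assume ab: "(a, b) \<in> E"
    have fab: "f (q a) = f a" "f (q b) = f b" using fq X.edge_verts[OF ab] by auto
    have e: "(q a, q b) \<in> E'" if "(a, b) \<notin> ?F" using ab that unfolding E' by force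
    show "nc_walk E' f 0 (q a) (q b)" if "f a = f b"
      using e that fab qF by (cases "(a, b) \<in> ?F") (auto intro: nc_refl nc_edge)
    show "nc_walk E' f (Suc 0) (q a) (q b)" if "f a \<noteq> f b"
      using e that fab fF by (cases "(a, b) \<in> ?F") (auto intro: nc_edge)
  qed
  have m1: "(\<Sum>r\<in>R. nc_dist E' f ((q \<circ> s) (fst r)) ((q \<circ> s) (snd r))) \<le> (\<Sum>r\<in>R. nc_dist E f (s (fst r)) (s (snd r)))"
  proof (rule sum_mono)
    fix r assume "r \<in> R"
    then obtain k where "nc_walk E f k (s (fst r)) (s (snd r))"
      using nc_walk_exists s_closed RW by blast
    then show "nc_dist E' f ((q \<circ> s) (fst r)) ((q \<circ> s) (snd r)) \<le> nc_dist E f (s (fst r)) (s (snd r))"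
      using nc[OF nc_dist_walk] nc_dist_le by fastforce
  qed
  have ncE': "nc_edges E' f = map_prod q q ` nc_edges E f"
  proof -
    have "nc_edges E f \<inter> ?F = {}" using fF by (auto simp: nc_edges_def)
    moreover have "f (q a) = f a \<and> f (q b) = f b" if "(a, b) \<in> E" for a b
      using that fq X.edge_verts by auto
    ultimately show ?thesis unfolding E' by (fastforce simp: nc_edges_def)
  qed
  have qact: "map_prod q q (pact act g e) = pact act' g (map_prod q q e)" if "g \<in> carrier G" "e \<in> E" for g e
    using that qa X.edge_verts by (cases e) auto
  have ncsub: "nc_edges E f \<subseteq> E" by (auto simp: nc_edges_def)
  have sub: "finite (orbits G B (pact act))" if "B \<subseteq> E" for B
    using that unfolding orbits_def by (intro finite_subset[OF _ fin_E[unfolded orbits_def]]) blast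
  have m2: "card (orbits G (nc_edges E' f) (pact act')) \<le> card (orbits G (nc_edges E f) (pact act))"
    unfolding ncE' using qact ncsub sub[OF ncsub] by (intro orbits_image_card) auto
  have "card (orbits G E' (pact act')) \<le> card (orbits G (E - ?F) (pact act))"
    unfolding E' using qact sub[of "E - ?F"] by (intro orbits_image_card) auto
  also have "\<dots> < card (orbits G E (pact act))"
  proof (rule psubset_card_mono[OF fin_E])
    interpret PA: set_action G E "pact act" by (rule X.pairs_action)
    have "orbit G (pact act) (v, w) \<notin> orbits G (E - ?F) (pact act)"
    proof
      assume "orbit G (pact act) (v, w) \<in> orbits G (E - ?F) (pact act)"
      then obtain e where e: "e \<in> E - ?F" "orbit G (pact act) (v, w) = orbit G (pact act) e"
        unfolding orbits_def by blast
      then have "e \<in> orbit G (pact act) (v, w)" using PA.orbit_self by blast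
      then show False using e by (auto simp: collapsed_pairs_def)
    qed
    moreover have "orbit G (pact act) (v, w) \<in> orbits G E (pact act)" using vw unfolding orbits_def by blast
    moreover have "orbits G (E - ?F) (pact act) \<subseteq> orbits G E (pact act)" unfolding orbits_def by blast
    ultimately show "orbits G (E - ?F) (pact act) \<subset> orbits G E (pact act)" by blast
  qed
  finally have m3: "card (orbits G E' (pact act')) < card (orbits G E (pact act))" .
  have "(fold_complexity G E' act' f (q \<circ> s) R, fold_complexity G E act f s R) \<in> simpler"
    unfolding fold_complexity_def using m1 m2 m3 by auto
  then show thesis using that[OF c S' fq] by blast
qed

text \<open>
  A pull that makes the map simpler: it shortens one of the paths counted in the first
  component, or reduces the number of orbits of edges that \<open>f\<close> does not collapse.
\<close>

definition good_pull where
  "good_pull R x0 y0 \<longleftrightarrow> x0 \<in> V \<and> (f x0, y0) \<in> D \<and>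
     (let E' = pull_edges E (pull.N G act bct x0 y0) f in
       (\<exists>r\<in>R. nc_dist E' (pull_map f) (Inl (s (fst r))) (Inl (s (snd r))) < nc_dist E f (s (fst r)) (s (snd r))) \<or>
       card (orbits G (nc_edges E' (pull_map f)) (pact (pull_act act bct))) < card (orbits G (nc_edges E f) (pact act)))"

text \<open>
  The transport to the common vertex type preserves the counts, and the third component may
  grow, as it comes last in the lexicographic order.
\<close>

lemma pull_simplifies:
  assumes good: "good_pull R x0 y0" and R: "finite R" "R \<subseteq> D"
  obtains V' :: "('g \<times> nat) set" and E' act' f' s' v w q
  where "tree_collapse G V' E' act' V E act v w q"
    "G_tree_map_and_back G V' E' act' W D bct f' s'" "\<forall>y\<in>W. f' (s' y) = f (s y)"
    "(fold_complexity G E' act' f' s' R, fold_complexity G E act f s R) \<in> simpler"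
proof -
  have RW: "fst r \<in> W" "snd r \<in> W" if "r \<in> R" for r
    using that R Y.edge_verts by (cases r; auto)+
  have x0: "x0 \<in> V" "(f x0, y0) \<in> D" using good by (auto simp: good_pull_def)
  interpret P: pull G V E act W D bct f x0 y0 using x0 by unfold_locales
  have dec: "(\<exists>r\<in>R. nc_dist P.PE P.pf (Inl (s (fst r))) (Inl (s (snd r))) < nc_dist E f (s (fst r)) (s (snd r))) \<or>
      card (orbits G (nc_edges P.PE P.pf) (pact P.pa)) < card (orbits G (nc_edges E f) (pact act))"
    using good unfolding good_pull_def Let_def by blast
  interpret T: G_rel_tree G P.PV P.PE P.pa by (rule P.pull_tree)
  obtain V' :: "('g \<times> nat) set" and E' act' f' j v w q
    where iso: "tree_iso G P.PV P.PE P.pa V' E' act' j"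
      and f': "\<forall>u\<in>P.PV. f' (j u) = P.pf u"
      and S': "G_tree_map_and_back G V' E' act' W D bct f' (j \<circ> (Inl \<circ> s))"
      and c: "tree_collapse G V' E' act' V E act v w q"
  proof (rule pull_exists[OF x0 refl, of "Inl \<circ> s"])
    show "(Inl \<circ> s) y \<in> P.PV" if "y \<in> W" for y
      using that s_closed by (auto simp: pull_verts_def)
    show "(Inl \<circ> s) (bct g y) = P.pa g ((Inl \<circ> s) y)" if "g \<in> carrier G" "y \<in> W" for g y
      using that s_act by auto
  qed blast
  interpret S': G_tree_map_and_back G V' E' act' W D bct f' "j \<circ> (Inl \<circ> s)" by (rule S')
  have E': "E' = map_prod j j ` P.PE" using iso by (auto simp: tree_iso_def)
  have nc: "nc_walk E' f' k (j a) (j b)" if "nc_walk P.PE P.pf k a b" for k a b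
    using that
  proof (rule nc_map)
    fix a b assume ab: "(a, b) \<in> P.PE"
    have fab: "f' (j a) = P.pf a" "f' (j b) = P.pf b" using f' T.edge_verts[OF ab] by auto
    have e: "(j a, j b) \<in> E'" using ab unfolding E' by force
    show "nc_walk E' f' 0 (j a) (j b)" if "P.pf a = P.pf b" using e that fab by (auto intro: nc_edge)
    show "nc_walk E' f' (Suc 0) (j a) (j b)" if "P.pf a \<noteq> P.pf b" using e that fab by (auto intro: nc_edge)
  qed
  have ncd: "nc_dist E' f' ((j \<circ> (Inl \<circ> s)) (fst r)) ((j \<circ> (Inl \<circ> s)) (snd r))
        \<le> nc_dist P.PE P.pf (Inl (s (fst r))) (Inl (s (snd r)))"
      "nc_dist P.PE P.pf (Inl (s (fst r))) (Inl (s (snd r))) \<le> nc_dist E f (s (fst r)) (s (snd r))"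
    if "r \<in> R" for r
  proof -
    obtain k where "nc_walk E f k (s (fst r)) (s (snd r))"
      using nc_walk_exists s_closed RW \<open>r \<in> R\<close> by blast
    from P.pull_nc_walk[OF nc_dist_walk[OF this]]
    have w: "nc_walk P.PE P.pf (nc_dist E f (s (fst r)) (s (snd r))) (Inl (s (fst r))) (Inl (s (snd r)))" .
    show "nc_dist P.PE P.pf (Inl (s (fst r))) (Inl (s (snd r))) \<le> nc_dist E f (s (fst r)) (s (snd r))"
      using nc_dist_le[OF w] .
    show "nc_dist E' f' ((j \<circ> (Inl \<circ> s)) (fst r)) ((j \<circ> (Inl \<circ> s)) (snd r))
        \<le> nc_dist P.PE P.pf (Inl (s (fst r))) (Inl (s (snd r)))"
      using nc_dist_le[OF nc[OF nc_dist_walk[OF w]]] by simp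
  qed
  let ?n' = "\<lambda>r. nc_dist E' f' ((j \<circ> (Inl \<circ> s)) (fst r)) ((j \<circ> (Inl \<circ> s)) (snd r))"
  let ?n = "\<lambda>r. nc_dist E f (s (fst r)) (s (snd r))"
  have le: "?n' r \<le> ?n r" if "r \<in> R" for r using ncd[OF that] by linarith
  have "(\<Sum>r\<in>R. ?n' r) < (\<Sum>r\<in>R. ?n r) \<or> (\<Sum>r\<in>R. ?n' r) \<le> (\<Sum>r\<in>R. ?n r) \<and>
      card (orbits G (nc_edges E' f') (pact act')) < card (orbits G (nc_edges E f) (pact act))"
    using dec
  proof
    assume "\<exists>r\<in>R. nc_dist P.PE P.pf (Inl (s (fst r))) (Inl (s (snd r))) < ?n r"
    then obtain r where "r \<in> R" "?n' r < ?n r" using ncd(1) by (meson le_less_trans)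
    then have "(\<Sum>r\<in>R. ?n' r) < (\<Sum>r\<in>R. ?n r)"
      using R(1) le by (intro sum_strict_mono_ex1) auto
    then show ?thesis ..
  next
    assume lc: "card (orbits G (nc_edges P.PE P.pf) (pact P.pa)) < card (orbits G (nc_edges E f) (pact act))"
    have "nc_edges E' f' = map_prod j j ` nc_edges P.PE P.pf"
    proof -
      have "f' (j a) = P.pf a \<and> f' (j b) = P.pf b" if "(a, b) \<in> P.PE" for a b
        using that f' T.edge_verts by auto
      then show ?thesis unfolding E' by (fastforce simp: nc_edges_def)
    qed
    moreover have "finite (orbits G (nc_edges P.PE P.pf) (pact P.pa))"
      by (intro finite_subset[OF _ P.pull_finite(2)[OF fin_V fin_E]]) (auto simp: orbits_def nc_edges_def)
    moreover have "map_prod j j (pact P.pa g e) = pact act' g (map_prod j j e)"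
      if "g \<in> carrier G" "e \<in> nc_edges P.PE P.pf" for g e
      using that iso T.edge_verts by (cases e) (auto simp: tree_iso_def nc_edges_def)
    ultimately have c1: "card (orbits G (nc_edges E' f') (pact act')) \<le> card (orbits G (nc_edges P.PE P.pf) (pact P.pa))"
      using orbits_image_card[of G "nc_edges P.PE P.pf" "map_prod j j" "pact P.pa" "pact act'"] by auto
    have "(\<Sum>r\<in>R. ?n' r) \<le> (\<Sum>r\<in>R. ?n r)" using le by (rule sum_mono)
    then show ?thesis by (rule disjI2[OF conjI[OF _ le_less_trans[OF c1 lc]]])
  qed
  then have "(fold_complexity G E' act' f' (j \<circ> (Inl \<circ> s)) R, fold_complexity G E act f s R) \<in> simpler"
    unfolding fold_complexity_def by auto
  moreover have "\<forall>y\<in>W. f' ((j \<circ> (Inl \<circ> s)) y) = f (s y)"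
    using f' s_closed by (auto simp: pull_verts_def)
  ultimately show thesis using that[OF c S'] by blast
qed

text \<open>
  A shortest walk from \<open>s y\<close> to \<open>s z\<close> is mapped to a walk between adjacent vertices. If it has
  more than one edge, its image turns back somewhere, as otherwise it would be a geodesic.
  Pulling at the turning point removes two edges from the count.
\<close>

lemma backtracking_pull:
  assumes fs: "\<And>y. y \<in> W \<Longrightarrow> f (s y) = y" and nocoll: "\<And>a b. (a, b) \<in> E \<Longrightarrow> f a \<noteq> f b"
    and R: "R \<subseteq> D" "\<And>d. d \<in> D \<Longrightarrow> \<exists>r\<in>R. d \<in> orbit G (pact bct) r"
    and d: "d \<in> D" "(s (fst d), s (snd d)) \<notin> E"
  shows "\<exists>x0 y0. good_pull R x0 y0"
proof -
  have RW: "fst r \<in> W" "snd r \<in> W" if "r \<in> R" for r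
    using that R(1) Y.edge_verts by (cases r; auto)+
  obtain r where r: "r \<in> R" "d \<in> orbit G (pact bct) r" using R(2) d by blast
  then obtain g where g: "g \<in> carrier G" "d = pact bct g r" by (auto simp: orbit_def)
  have nE: "(s (fst r), s (snd r)) \<notin> E"
  proof
    assume "(s (fst r), s (snd r)) \<in> E"
    then have "(act g (s (fst r)), act g (s (snd r))) \<in> E" by (rule X.act_edge[OF g(1)])
    moreover have "fst d = bct g (fst r)" "snd d = bct g (snd r)" using g(2) by (cases r; auto)+
    ultimately show False using d(2) s_act[OF g(1)] RW[OF r(1)] by simp
  qed
  define k where "k = nc_dist E f (s (fst r)) (s (snd r))"
  obtain k0 where "nc_walk E f k0 (s (fst r)) (s (snd r))"
    using nc_walk_exists s_closed RW[OF r(1)] by blast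
  then have "(s (fst r), s (snd r)) \<in> E ^^ k"
    unfolding k_def by (rule nc_walk_relpow[OF nc_dist_walk nocoll])
  then obtain p where p: "p 0 = s (fst r)" "p k = s (snd r)" "\<And>i. i < k \<Longrightarrow> (p i, p (Suc i)) \<in> E"
    unfolding relpow_fun_conv by blast
  have fp: "f (p 0) = fst r" "f (p k) = snd r" using p fs RW[OF r(1)] by auto
  have rD: "(fst r, snd r) \<in> D" using r R(1) by auto
  have "\<exists>i. Suc i < k \<and> f (p i) = f (p (Suc (Suc i)))"
  proof (rule ccontr)
    assume no: "\<not> ?thesis"
    have "tdist D ((f \<circ> p) k) ((f \<circ> p) 0) = k"
    proof (rule Y.nonbacktracking_dist)
      show "((f \<circ> p) i, (f \<circ> p) (Suc i)) \<in> D" if "i < k" for i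
        using p(3)[OF that] f_edge nocoll by fastforce
      show "(f \<circ> p) i \<noteq> (f \<circ> p) (Suc (Suc i))" if "Suc i < k" for i using no that by auto
      show "(f \<circ> p) 0 \<in> W" using fp RW[OF r(1)] by auto
    qed
    then have "k = 1" using Y.tdist_edge[OF Y.edge_sym[OF rD]] fp by auto
    then show False using p(1,2) p(3)[of 0] nE by auto
  qed
  then obtain i where i: "Suc i < k" "f (p i) = f (p (Suc (Suc i)))" by blast
  let ?x = "p (Suc i)" and ?y = "f (p i)"
  have e1: "(?x, p i) \<in> E" using p(3)[of i] i X.edge_sym by auto
  have e2: "(?x, p (Suc (Suc i))) \<in> E" using p(3)[of "Suc i"] i by auto
  have x: "?x \<in> V" "(f ?x, ?y) \<in> D"
    using X.edge_verts[OF e1] f_edge[OF e1] nocoll[OF e1] by auto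
  interpret P: pull G V E act W D bct f ?x ?y using x by unfold_locales
  have seg: "(p a, p (a + l)) \<in> E ^^ l" if "a + l \<le> k" for a l
    using that
  proof (induction l)
    case (Suc l)
    then have "(p a, p (a + l)) \<in> E ^^ l" "(p (a + l), p (Suc (a + l))) \<in> E" using p(3) by auto
    then show ?case by auto
  qed simp
  have w1: "nc_walk P.PE P.pf i (Inl (p 0)) (Inl (p i))"
    using P.pull_nc_walk[OF relpow_nc_walk[OF seg nocoll, of 0 i]] i by simp
  have w2: "nc_walk P.PE P.pf 0 (Inl (p i)) (Inl (p (Suc (Suc i))))"
    using P.pull_fold[OF e1 e2 P.base_N] i by simp
  have w3: "nc_walk P.PE P.pf (k - Suc (Suc i)) (Inl (p (Suc (Suc i)))) (Inl (p k))"
  proof -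
    have "Suc (Suc i) + (k - Suc (Suc i)) = k" using i by simp
    then have "(p (Suc (Suc i)), p k) \<in> E ^^ (k - Suc (Suc i))"
      using seg[of "Suc (Suc i)" "k - Suc (Suc i)"] by (metis order_refl)
    from P.pull_nc_walk[OF relpow_nc_walk[OF this nocoll]] show ?thesis .
  qed
  have "nc_walk P.PE P.pf (i + (0 + (k - Suc (Suc i)))) (Inl (p 0)) (Inl (p k))"
    by (rule nc_trans[OF w1 nc_trans[OF w2 w3]])
  then have "nc_dist P.PE P.pf (Inl (p 0)) (Inl (p k)) \<le> i + (0 + (k - Suc (Suc i)))" by (rule nc_dist_le)
  then have "nc_dist P.PE P.pf (Inl (s (fst r))) (Inl (s (snd r))) < k" using i p by simp
  then show ?thesis using x r(1) unfolding k_def good_pull_def Let_def by blast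
qed

text \<open>
  By connectedness some edge leads from a vertex \<open>s z\<close> to a vertex \<open>x\<close> outside the image of
  \<open>s\<close>. It has the same image in the target as the edge from \<open>s z\<close> to \<open>s (f x)\<close>, so the two can
  be folded. They lie in different orbits since the image of \<open>s\<close> is invariant.
\<close>

lemma outside_pull:
  assumes fs: "\<And>y. y \<in> W \<Longrightarrow> f (s y) = y" and nocoll: "\<And>a b. (a, b) \<in> E \<Longrightarrow> f a \<noteq> f b"
    and sE: "\<And>y z. (y, z) \<in> D \<Longrightarrow> (s y, s z) \<in> E" and outside: "\<not> V \<subseteq> s ` W"
  shows "\<exists>x0 y0. good_pull R x0 y0"
proof -
  obtain v where v: "v \<in> V" "v \<notin> s ` W" using outside by blast
  obtain y where y: "y \<in> W" using Y.nonempty by auto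
  have "\<exists>z x. (z, x) \<in> E \<and> z \<in> s ` W \<and> x \<notin> s ` W"
  proof (rule ccontr)
    assume "\<not> ?thesis"
    then have "v \<in> s ` W"
      using rtrancl_closed[OF X.connected[OF s_closed[OF y] v(1)], of "s ` W"] y by blast
    then show False using v by auto
  qed
  then obtain z x where zx: "(s z, x) \<in> E" "z \<in> W" "x \<notin> s ` W" by blast
  have xV: "x \<in> V" "s z \<in> V" using zx X.edge_verts by auto
  have fz: "f (s z) = z" using fs zx by auto
  have D: "(z, f x) \<in> D" using f_edge[OF zx(1)] nocoll[OF zx(1)] fz by auto
  then have D': "(f (s z), f x) \<in> D" using fz by simp
  interpret P: pull G V E act W D bct f "s z" "f x" using D' xV by unfold_locales
  have fx: "f x \<in> W" using xV f_closed by auto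
  interpret PA: set_action G E "pact act" by (rule X.pairs_action)
  have nos: "act g x \<noteq> s u" if "g \<in> carrier G" "u \<in> W" for g u
  proof
    assume "act g x = s u"
    then have "x = act (inv\<^bsub>G\<^esub> g) (s u)" using X.act_inv[OF that(1) xV(1)] by simp
    then have "x = s (bct (inv\<^bsub>G\<^esub> g) u)" using s_act that by simp
    moreover have "bct (inv\<^bsub>G\<^esub> g) u \<in> W" using Y.act_closed that by simp
    ultimately show False using zx(3) by blast
  qed
  have sx: "(s z, s (f x)) \<in> E" using sE[OF D] .
  have "card (orbits G (nc_edges P.PE P.pf) (pact P.pa)) < card (orbits G (nc_edges E f) (pact act))"
  proof (rule P.pull_nc_card[OF zx(1) refl sx _ _ _ fin_E])
    show "f (s (f x)) = f x" using fs fx by auto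
    show "orbit G (pact act) (s z, x) \<noteq> orbit G (pact act) (s z, s (f x))"
    proof
      assume "orbit G (pact act) (s z, x) = orbit G (pact act) (s z, s (f x))"
      then have "(s z, s (f x)) \<in> orbit G (pact act) (s z, x)" using PA.orbit_self[OF sx] by simp
      then obtain g where "g \<in> carrier G" "act g x = s (f x)" by (auto simp: orbit_def)
      then show False using nos[OF _ fx] by blast
    qed
    show "orbit G (pact act) (x, s z) \<noteq> orbit G (pact act) (s z, s (f x))"
    proof
      assume "orbit G (pact act) (x, s z) = orbit G (pact act) (s z, s (f x))"
      then have "(s z, s (f x)) \<in> orbit G (pact act) (x, s z)" using PA.orbit_self[OF sx] by simp
      then obtain g where "g \<in> carrier G" "act g x = s z" by (auto simp: orbit_def)
      then show False using nos[OF _ zx(2)] by blast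
    qed
  qed
  then show ?thesis using xV(2) D' unfolding good_pull_def Let_def by blast
qed

text \<open>
  Edges of the target lift along \<open>s\<close>, and \<open>f\<close> sends edges to edges, so the vertex bijection
  matches the two edge relations.
\<close>

lemma bijective_iso:
  assumes fs': "\<And>y. y \<in> W \<Longrightarrow> f (s y) = y" and nocoll: "\<And>a b. (a, b) \<in> E \<Longrightarrow> f a \<noteq> f b"
    and sE: "\<And>y z. (y, z) \<in> D \<Longrightarrow> (s y, s z) \<in> E" and onto: "V \<subseteq> s ` W"
  shows "tree_iso G V E act W D bct f"
proof -
  have fs: "s (f v) = v" if "v \<in> V" for v
    using that onto fs' by auto
  have "bij_betw f V W"
    by (rule bij_betw_byWitness[where f' = s]) (use fs fs' f_closed s_closed in auto)
  moreover have "D = map_prod f f ` E"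
  proof
    show "D \<subseteq> map_prod f f ` E"
    proof clarify
      fix y z assume yz: "(y, z) \<in> D"
      then have "map_prod f f (s y, s z) = (y, z)" using fs' Y.edge_verts by auto
      then show "(y, z) \<in> map_prod f f ` E" using sE[OF yz] by (metis imageI)
    qed
    show "map_prod f f ` E \<subseteq> D" using f_edge nocoll by fastforce
  qed
  ultimately show ?thesis using f_act by (auto simp: tree_iso_def)
qed

end

text \<open>
  Edges collapsed by \<open>f\<close> are removed first; then all edges are counted, and the remaining
  cases are those of the three preceding lemmas.
\<close>

lemma deforms_to_if_section:
  fixes G :: "('g, 'm) monoid_scheme" and V :: "('g \<times> nat) set"
  assumes "G_tree_map_and_back G V E act W D bct f s" "\<And>y. y \<in> W \<Longrightarrow> f (s y) = y"
    and R: "finite R" "R \<subseteq> D" "\<And>d. d \<in> D \<Longrightarrow> \<exists>r\<in>R. d \<in> orbit G (pact bct) r"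
  shows "deforms_to G W D bct V E act"
proof -
  have wf: "wf simpler" by (intro wf_lex_prod wf_less_than)
  have "t = fold_complexity G E act f s R \<Longrightarrow> ?thesis" for t
    using assms(1,2)
  proof (induction t arbitrary: V E act f s rule: wf_induct_rule[OF wf, case_names less])
    case (less t)
    interpret G_tree_map_and_back G V E act W D bct f s by (rule less)
    note IH = less(1)[unfolded less(2), OF _ refl]
    show ?case
    proof (cases "\<exists>a b. (a, b) \<in> E \<and> f a = f b")
      case True
      then obtain a b where ab: "(a, b) \<in> E" "f a = f b" by blast
      obtain v w q V' E' act' where c: "tree_collapse G V E act V' E' act' v w q"
        and S': "G_tree_map_and_back G V' E' act' W D bct f (q \<circ> s)" and fq: "\<forall>x\<in>V. f (q x) = f x"
        and m: "(fold_complexity G E' act' f (q \<circ> s) R, fold_complexity G E act f s R) \<in> simpler"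
        by (rule collapse_simplifies[OF ab R(2)])
      interpret S': G_tree_map_and_back G V' E' act' W D bct f "q \<circ> s" by (rule S')
      have "deforms_to G W D bct V' E' act'"
      proof (rule IH[OF m S'])
        show "f ((q \<circ> s) y) = y" if "y \<in> W" for y using that fq s_closed less(4) by auto
      qed
      then show ?thesis
        using deform_collapse[OF c S'.X.G_rel_tree_axioms S'.fin_V S'.fin_E] by blast
    next
      case False
      then have nocoll: "f a \<noteq> f b" if "(a, b) \<in> E" for a b using that by blast
      have step: ?thesis if good: "good_pull R x0 y0" for x0 y0
      proof -
        obtain V' :: "('g \<times> nat) set" and E' act' f' s' v w q
          where c: "tree_collapse G V' E' act' V E act v w q"
            and S': "G_tree_map_and_back G V' E' act' W D bct f' s'" and fs: "\<forall>y\<in>W. f' (s' y) = f (s y)"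
            and m: "(fold_complexity G E' act' f' s' R, fold_complexity G E act f s R) \<in> simpler"
          by (rule pull_simplifies[OF good R(1,2)])
        interpret S': G_tree_map_and_back G V' E' act' W D bct f' s' by (rule S')
        have "deforms_to G W D bct V' E' act'"
        proof (rule IH[OF m S'])
          show "f' (s' y) = y" if "y \<in> W" for y using that fs less(4) by auto
        qed
        then show ?thesis
          using deform_expand[OF c S'.X.G_rel_tree_axioms S'.fin_V S'.fin_E] by blast
      qed
      show ?thesis
      proof (cases "\<forall>d\<in>D. (s (fst d), s (snd d)) \<in> E")
        case False
        then obtain d where d: "d \<in> D" "(s (fst d), s (snd d)) \<notin> E" by blast
        then show ?thesis using backtracking_pull[OF less(4) nocoll R(2,3) d] step by blast
      next
        case True
        then have sE: "(s y, s z) \<in> E" if "(y, z) \<in> D" for y z using that by fastforce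
        show ?thesis
        proof (cases "V \<subseteq> s ` W")
          case False
          then show ?thesis using outside_pull[OF less(4) nocoll sE] step by blast
        next
          case True
          show ?thesis by (rule deform_iso[OF bijective_iso[OF less(4) nocoll sE True]])
        qed
      qed
    qed
  qed
  then show ?thesis by blast
qed

text \<open>
  A pull at \<open>s y0\<close> in the direction of \<open>y0\<close> creates a vertex that is fixed by the stabilizer
  of \<open>y0\<close> and maps one step closer to \<open>y0\<close>; redefining \<open>s\<close> on the orbit of \<open>y0\<close> reduces the
  total distance from \<open>f (s y)\<close> to \<open>y\<close> over orbit representatives \<open>Q\<close>. Once it is zero, \<open>s\<close> is
  a section.
\<close>

lemma deforms_to_target:
  fixes G :: "('g, 'm) monoid_scheme" and V :: "('g \<times> nat) set"
  assumes "G_tree_map_and_back G V E act W D bct f s"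
    and R: "finite R" "R \<subseteq> D" "\<And>d. d \<in> D \<Longrightarrow> \<exists>r\<in>R. d \<in> orbit G (pact bct) r"
    and Q: "finite Q" "Q \<subseteq> W" "\<And>y. y \<in> W \<Longrightarrow> \<exists>r\<in>Q. y \<in> orbit G bct r"
  shows "deforms_to G W D bct V E act"
proof -
  have "t = (\<Sum>y\<in>Q. tdist D (f (s y)) y) \<Longrightarrow> ?thesis" for t
    using assms(1)
  proof (induction t arbitrary: V E act f s rule: less_induct)
    case (less t)
    interpret G_tree_map_and_back G V E act W D bct f s by (rule less)
    show ?case
    proof (cases "\<forall>y\<in>Q. f (s y) = y")
      case True
      have "f (s y) = y" if y: "y \<in> W" for y
      proof -
        obtain r where r: "r \<in> Q" "y \<in> orbit G bct r" using Q(3)[OF y] by blast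
        then obtain g where g: "g \<in> carrier G" "y = bct g r" by (auto simp: orbit_def)
        have "r \<in> W" using r Q by auto
        then show ?thesis using f_act[OF g(1) s_closed] s_act[OF g(1)] True r g by auto
      qed
      then show ?thesis using deforms_to_if_section[OF less(3) _ R] by blast
    next
      case False
      then obtain y0 where y0: "y0 \<in> Q" "f (s y0) \<noteq> y0" by blast
      then have y0W: "y0 \<in> W" using Q by auto
      let ?n = "\<lambda>y. Y.toward (f (s y)) y"
      have fsW: "f (s y) \<in> W" if "y \<in> W" for y using that s_closed f_closed by auto
      have x0: "s y0 \<in> V" "(f (s y0), ?n y0) \<in> D"
        using s_closed[OF y0W] Y.toward_edge[OF fsW[OF y0W] y0W y0(2)] by auto
      interpret P: pull G V E act W D bct f "s y0" "?n y0" using x0 by unfold_locales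
      interpret T: G_rel_tree G P.PV P.PE P.pa by (rule P.pull_tree)
      define O0 where "O0 = orbit G bct y0"
      have O0: "f (s y) \<noteq> y \<and> (s y, ?n y) \<in> P.N \<and> y \<in> W" if "y \<in> O0" for y
      proof -
        from that obtain g where g: "g \<in> carrier G" "y = bct g y0" by (auto simp: O0_def orbit_def)
        have sy: "s y = act g (s y0)" "f (s y) = bct g (f (s y0))"
          using g y0W s_act s_closed f_act by auto
        have "?n y = bct g (?n y0)"
          using Y.toward_act[OF g(1) fsW[OF y0W] y0W y0(2)] sy g by simp
        then show ?thesis using P.N_act[OF g(1) P.base_N] sy g y0 Y.act_inj[OF g(1) fsW[OF y0W] y0W] Y.act_closed[OF g(1) y0W]
          by auto
      qed
      have O0_act: "bct g y \<in> O0 \<longleftrightarrow> y \<in> O0" if "g \<in> carrier G" "y \<in> W" for g y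
        unfolding O0_def using Y.orbit_eq_iff[OF y0W] Y.orbit_act[OF that] Y.act_closed[OF that] that by blast
      define s' where "s' y = (if y \<in> O0 then Inr (s y, ?n y) else Inl (s y))" for y
      have s'V: "s' y \<in> P.PV" if "y \<in> W" for y
        using that O0 s_closed by (auto simp: s'_def pull_verts_def)
      have s'act: "s' (bct g y) = P.pa g (s' y)" if g: "g \<in> carrier G" and y: "y \<in> W" for g y
      proof (cases "y \<in> O0")
        case True
        have "?n (bct g y) = bct g (?n y)"
          using Y.toward_act[OF g fsW[OF y] y] O0[OF True] s_act[OF g y] f_act[OF g s_closed[OF y]] by simp
        then show ?thesis using True O0_act[OF g y] s_act[OF g y] by (simp add: s'_def)
      next
        case False
        then show ?thesis using O0_act[OF g y] s_act[OF g y] by (simp add: s'_def)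
      qed
      obtain V' :: "('g \<times> nat) set" and E' act' f' j v w q
        where iso: "tree_iso G P.PV P.PE P.pa V' E' act' j"
          and f': "\<forall>u\<in>P.PV. f' (j u) = P.pf u"
          and S': "G_tree_map_and_back G V' E' act' W D bct f' (j \<circ> s')"
          and c: "tree_collapse G V' E' act' V E act v w q"
        by (rule pull_exists[OF x0 refl s'V s'act]) blast
      interpret S': G_tree_map_and_back G V' E' act' W D bct f' "j \<circ> s'" by (rule S')
      have d: "tdist D (f' ((j \<circ> s') y)) y \<le> tdist D (f (s y)) y \<and>
          (y \<in> O0 \<longrightarrow> tdist D (f' ((j \<circ> s') y)) y < tdist D (f (s y)) y)" if y: "y \<in> W" for y
      proof (cases "y \<in> O0")
        case True
        then have "f' ((j \<circ> s') y) = ?n y" using bspec[OF f' s'V[OF y]] by (simp add: s'_def)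
        then show ?thesis using Y.toward_dist[OF fsW[OF y] y] O0[OF True] by simp
      next
        case False
        then show ?thesis using bspec[OF f' s'V[OF y]] by (simp add: s'_def)
      qed
      have "y0 \<in> O0" using Y.orbit_self[OF y0W] by (simp add: O0_def)
      then have "(\<Sum>y\<in>Q. tdist D (f' ((j \<circ> s') y)) y) < (\<Sum>y\<in>Q. tdist D (f (s y)) y)"
        using d Q y0 by (intro sum_strict_mono_ex1) auto
      then have "deforms_to G W D bct V' E' act'" using less(1)[OF _ refl S'] less(2) by blast
      then show ?thesis
        using deform_expand[OF c S'.X.G_rel_tree_axioms S'.fin_V S'.fin_E] by blast
    qed
  qed
  then show ?thesis by blast
qed

section \<open>Trees in the sense of Serre and as relations\<close>

abbreviation ends :: "('g, 'v, 'e) G_graph \<Rightarrow> 'e \<Rightarrow> 'v \<times> 'v" where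
  "ends Z e \<equiv> (bd0 Z e, bd1 Z e)"

abbreviation end_pairs :: "('g, 'v, 'e) G_graph \<Rightarrow> ('v \<times> 'v) set" where
  "end_pairs Z \<equiv> ends Z ` gedges Z"

lemma end_pairsI: "e \<in> gedges Z \<Longrightarrow> ends Z e = x \<Longrightarrow> x \<in> end_pairs Z"
  by auto

lemma (in wf_digraph) rtrancl_arcs_awalk:
  assumes "(x, y) \<in> ((\<lambda>a. (tail G a, head G a)) ` A)\<^sup>*" "A \<subseteq> arcs G" "y \<in> verts G"
  shows "\<exists>p. awalk x p y \<and> set p \<subseteq> A"
  using assms(1)
proof (induction rule: converse_rtrancl_induct)
  case base
  then show ?case using assms by (intro exI[of _ "[]"]) (auto simp: awalk_Nil_iff)
next
  case (step x z)
  then obtain p a where "awalk z p y" "set p \<subseteq> A" "a \<in> A" "x = tail G a" "z = head G a" by auto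
  then show ?case using assms(2) by (intro exI[of _ "a # p"]) (auto simp: awalk_Cons_iff)
qed

lemma (in wf_digraph) awalk_rtrancl_arcs:
  "awalk x p y \<Longrightarrow> set p \<subseteq> A \<Longrightarrow> (x, y) \<in> ((\<lambda>a. (tail G a, head G a)) ` A)\<^sup>*"
proof (induction p arbitrary: x)
  case (Cons e p)
  then have "(head G e, y) \<in> ((\<lambda>a. (tail G a, head G a)) ` A)\<^sup>*" "x = tail G e"
    by (auto simp: awalk_Cons_iff)
  moreover have "(tail G e, head G e) \<in> (\<lambda>a. (tail G a, head G a)) ` A" using Cons by auto
  ultimately show ?case by (metis converse_rtrancl_into_rtrancl)
qed (auto simp: awalk_Nil_iff)

text \<open>
  A path without repeated vertices does not traverse an edge in both directions. This is what
  separates circuits from cycles in the sense of directed graphs.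
\<close>

lemma (in wf_digraph) apath_no_reversal:
  "awalk x p y \<Longrightarrow> distinct (awalk_verts x p) \<Longrightarrow> a \<in> set p \<Longrightarrow> b \<in> set p \<Longrightarrow>
     tail G b = head G a \<Longrightarrow> head G b \<noteq> tail G a"
proof (induction p arbitrary: x)
  case (Cons e p)
  have w: "awalk (head G e) p y" using Cons.prems(1) by (simp add: awalk_Cons_iff)
  have d: "distinct (awalk_verts (head G e) p)" "tail G e \<notin> set (awalk_verts (head G e) p)"
    using Cons.prems(2) by auto
  have hd: "head G e \<in> set (awalk_verts (head G e) p)" by (cases p) (use w in \<open>auto simp: awalk_Cons_iff\<close>)
  have h: "head G c \<in> set (awalk_verts (head G e) p)" if "c \<in> set p" for c
    using awalk_verts_arc2[OF w that] .
  have t: "tail G c \<in> set (awalk_verts (head G e) p)" if "c \<in> set p" for c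
    using awalk_verts_arc1[OF that] .
  consider "a = e" "b = e" | "a = e" "b \<in> set p" | "b = e" "a \<in> set p" | "a \<in> set p" "b \<in> set p"
    using Cons.prems by auto
  then show ?case
  proof cases
    case 1
    then show ?thesis using Cons.prems d hd by auto
  next
    case 2
    then show ?thesis using h d by metis
  next
    case 3
    then show ?thesis using h d Cons.prems by metis
  next
    case 4
    then show ?thesis using Cons.IH[OF w d(1)] Cons.prems by auto
  qed
qed auto

locale G_tree_graph = group G for G :: "('g, 'm) monoid_scheme" (structure) +
  fixes Z :: "('g, 'v, 'e) G_graph"
  assumes G_tree: "G_tree G Z"
begin

sublocale B: bidirected_digraph "gr Z" "erev Z"
  using G_tree by (simp add: G_tree_def simplicial_tree_def)

sublocale VA: group_action G "gverts Z" "vact Z"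
  using G_tree by (simp add: G_tree_def)

sublocale EA: group_action G "gedges Z" "eact Z"
  using G_tree by (simp add: G_tree_def)

lemma no_circuit: "\<not> circuit (gr Z) (erev Z) p"
  using G_tree by (auto simp: G_tree_def simplicial_tree_def)

lemma bd_act: "g \<in> carrier G \<Longrightarrow> e \<in> gedges Z \<Longrightarrow> ends Z (eact Z g e) = pact (vact Z) g (ends Z e)"
  using G_tree by (auto simp: G_tree_def)

lemma eact_not_rev: "g \<in> carrier G \<Longrightarrow> e \<in> gedges Z \<Longrightarrow> eact Z g e \<noteq> erev Z e"
  using G_tree by (auto simp: G_tree_def)

lemma eact_closed: "g \<in> carrier G \<Longrightarrow> e \<in> gedges Z \<Longrightarrow> eact Z g e \<in> gedges Z"
  using EA.element_image by blast

lemma no_loop: "e \<in> gedges Z \<Longrightarrow> bd0 Z e \<noteq> bd1 Z e"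
proof
  assume e: "e \<in> gedges Z" "bd0 Z e = bd1 Z e"
  have "circuit (gr Z) (erev Z) [e]"
    unfolding circuit_def B.cycle_def using e B.arev_neq[OF e(1)]
    by (auto intro!: exI[of _ "bd0 Z e"] simp: B.awalk_Cons_iff B.awalk_Nil_iff)
  then show False using no_circuit by blast
qed

text \<open>
  Two parallel edges would form a circuit.
\<close>

lemma ends_inj: "inj_on (ends Z) (gedges Z)"
proof (rule inj_onI, rule ccontr)
  fix e e' assume e: "e \<in> gedges Z" "e' \<in> gedges Z" "ends Z e = ends Z e'" "e \<noteq> e'"
  let ?p = "[e, erev Z e']"
  have rev: "erev Z e \<noteq> erev Z e'" using e B.arev_eq_iff by auto
  have "e \<noteq> erev Z e'" using e no_loop[OF e(1)] B.tail_arev[OF e(2)] by auto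
  then have "\<forall>a\<in>set ?p. erev Z a \<notin> set ?p"
    using e rev B.arev_neq B.arev_arev by auto metis+
  moreover have "B.cycle ?p"
    unfolding B.cycle_def using e no_loop[OF e(2)]
    by (intro exI[of _ "bd0 Z e"]) (auto simp: B.awalk_Cons_iff B.awalk_Nil_iff)
  ultimately show False using no_circuit[of ?p] by (simp add: circuit_def)
qed

text \<open>
  A walk around an edge can be shortened to a path without repeated vertices, which the edge
  closes up to a circuit.
\<close>

lemma ends_bridge:
  assumes uv: "(u, v) \<in> end_pairs Z"
  shows "(u, v) \<notin> (end_pairs Z - {(u, v), (v, u)})\<^sup>*"
proof
  assume walk: "(u, v) \<in> (end_pairs Z - {(u, v), (v, u)})\<^sup>*"
  obtain e where e: "e \<in> gedges Z" "bd0 Z e = v" "bd1 Z e = u"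
  proof -
    from uv obtain a where "a \<in> gedges Z" "bd0 Z a = u" "bd1 Z a = v" by auto
    then show thesis using that[of "erev Z a"] by auto
  qed
  let ?A = "{a \<in> gedges Z. ends Z a \<notin> {(u, v), (v, u)}}"
  have "end_pairs Z - {(u, v), (v, u)} = ends Z ` ?A" by auto
  then obtain p where p: "B.awalk u p v" "set p \<subseteq> ?A"
    using B.rtrancl_arcs_awalk[of u v ?A] walk e by auto
  define q where "q = B.awalk_to_apath p"
  have q: "B.awalk u q v" "distinct (B.awalk_verts u q)" "set q \<subseteq> ?A"
    using B.apath_awalk_to_apath[OF p(1)] B.awalk_to_apath_subset[OF p(1)] p(2)
    by (auto simp: q_def B.apath_def)
  have "B.cycle (e # q)"
    unfolding B.cycle_def using q e by (intro exI[of _ v]) (auto simp: B.awalk_Cons_iff)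
  moreover have "erev Z a \<notin> set (e # q)" if a: "a \<in> set (e # q)" for a
  proof
    assume r: "erev Z a \<in> set (e # q)"
    have ae: "a \<in> gedges Z" using a q e by auto
    consider "a = e" "erev Z a = e" | "a = e" "erev Z a \<in> set q" | "a \<in> set q" "erev Z a = e"
      | "a \<in> set q" "erev Z a \<in> set q" using a r by auto
    then show False
    proof cases
      case 1
      then show ?thesis using B.arev_neq ae by metis
    next
      case 2
      then have "ends Z (erev Z e) \<notin> {(u, v), (v, u)}" using q by auto
      then show ?thesis using e by simp
    next
      case 3
      then have "ends Z a = (u, v)" using e ae B.tail_arev[OF ae] B.head_arev[OF ae] by simp
      then show ?thesis using 3 q by auto
    next
      case 4
      then show ?thesis using B.apath_no_reversal[OF q(1,2) 4] B.tail_arev[OF ae] B.head_arev[OF ae] by simp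
    qed
  qed
  ultimately show False using no_circuit[of "e # q"] by (simp add: circuit_def)
qed

lemma internal_tree: "G_rel_tree G (gverts Z) (end_pairs Z) (vact Z)"
proof
  show "vact Z g x \<in> gverts Z" if "g \<in> carrier G" "x \<in> gverts Z" for g x
    using VA.element_image that by blast
  show "vact Z \<one> x = x" if "x \<in> gverts Z" for x
    using VA.id_eq_one that by (metis restrict_apply')
  show "vact Z (g \<otimes> h) x = vact Z g (vact Z h x)" if "g \<in> carrier G" "h \<in> carrier G" "x \<in> gverts Z" for g h x
    using VA.composition_rule that by blast
  have con: "Digraph_Component.connected (gr Z)" using G_tree by (auto simp: G_tree_def simplicial_tree_def)
  then show "gverts Z \<noteq> {}" by (auto simp: connected_conv)
  have arcs: "arcs_ends (gr Z) = end_pairs Z" by (auto simp: arcs_ends_def arc_to_ends_def)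
  fix x y
  show "x \<in> gverts Z \<and> y \<in> gverts Z" if "(x, y) \<in> end_pairs Z"
    using that by auto
  show symm: "(y, x) \<in> end_pairs Z" if "(x, y) \<in> end_pairs Z" for x y
  proof -
    from that obtain e where "e \<in> gedges Z" "x = bd0 Z e" "y = bd1 Z e" by auto
    then have "ends Z (erev Z e) = (y, x)" "erev Z e \<in> gedges Z" by auto
    then show ?thesis using end_pairsI by metis
  qed
  show "(x, x) \<notin> end_pairs Z" using no_loop by auto
  show "(x, y) \<in> (end_pairs Z)\<^sup>*" if "x \<in> gverts Z" "y \<in> gverts Z"
  proof -
    have "(x, y) \<in> rtrancl_on (gverts Z) (symcl (end_pairs Z))"
      using con that by (simp add: connected_conv arcs)
    then have "(x, y) \<in> (symcl (end_pairs Z))\<^sup>*" by (rule rtrancl_on_rtranclI)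
    moreover have "symcl (end_pairs Z) = end_pairs Z" unfolding symcl_def using symm by auto
    ultimately show ?thesis by simp
  qed
  show "(x, y) \<notin> (end_pairs Z - {(x, y), (y, x)})\<^sup>*" if "(x, y) \<in> end_pairs Z"
    using ends_bridge[OF that] .
  show "(vact Z g x, vact Z g y) \<in> end_pairs Z" if g: "g \<in> carrier G" and xy: "(x, y) \<in> end_pairs Z" for g
  proof -
    from xy obtain e where e: "e \<in> gedges Z" "x = bd0 Z e" "y = bd1 Z e" by auto
    then have "ends Z (eact Z g e) = (vact Z g x, vact Z g y)" using bd_act[OF g] by simp
    then show ?thesis by (rule end_pairsI[OF eact_closed[OF g e(1)]])
  qed
  show "vact Z g y \<noteq> x" if g: "g \<in> carrier G" and xy: "(x, y) \<in> end_pairs Z" "vact Z g x = y" for g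
  proof
    assume "vact Z g y = x"
    from xy obtain e where e: "e \<in> gedges Z" "x = bd0 Z e" "y = bd1 Z e" by auto
    then have "ends Z (eact Z g e) = ends Z (erev Z e)"
      using bd_act[OF g e(1)] xy \<open>vact Z g y = x\<close> by simp
    then have "eact Z g e = erev Z e"
      by (rule inj_onD[OF ends_inj _ eact_closed[OF g e(1)] B.arev_in_arcs[OF e(1)]])
    then show False using eact_not_rev[OF g e(1)] by simp
  qed
qed

sublocale T: G_rel_tree G "gverts Z" "end_pairs Z" "vact Z"
  by (rule internal_tree)

lemma ends_orbit: "e \<in> gedges Z \<Longrightarrow> orbit G (pact (vact Z)) (ends Z e) = ends Z ` orbit G (eact Z) e"
  by (rule orbit_image) (simp only: bd_act)

lemma ends_orbits: "orbits G (end_pairs Z) (pact (vact Z)) = (`) (ends Z) ` orbits G (gedges Z) (eact Z)"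
  by (rule orbits_image) (simp only: bd_act)

end

text \<open>
  Edges of a tree are determined by their ends, so a map of vertices that matches the pairs of
  ends lifts to edges, and its compatibility with reversal and with the action follows from
  uniqueness.
\<close>

lemma edge_map_exists:
  assumes "G_tree_graph G Z" "G_tree_graph G Z'" and A: "A \<subseteq> gedges Z"
    and rev: "\<And>e. e \<in> A \<Longrightarrow> erev Z e \<in> A" and act: "\<And>g e. g \<in> carrier G \<Longrightarrow> e \<in> A \<Longrightarrow> eact Z g e \<in> A"
    and h: "\<And>g v. g \<in> carrier G \<Longrightarrow> v \<in> gverts Z \<Longrightarrow> h (vact Z g v) = vact Z' g (h v)"
    and bij: "bij_betw (map_prod h h) (ends Z ` A) (end_pairs Z')"
  shows "\<exists>fe. bij_betw fe A (gedges Z') \<and>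
    (\<forall>e\<in>A. h (bd0 Z e) = bd0 Z' (fe e) \<and> h (bd1 Z e) = bd1 Z' (fe e) \<and> fe (erev Z e) = erev Z' (fe e)) \<and>
    (\<forall>g\<in>carrier G. \<forall>e\<in>A. fe (eact Z g e) = eact Z' g (fe e))"
proof -
  interpret Z: G_tree_graph G Z by (rule assms)
  interpret Z': G_tree_graph G Z' by (rule assms)
  define fe where "fe = inv_into (gedges Z') (ends Z') \<circ> (map_prod h h \<circ> ends Z)"
  have fe: "fe e \<in> gedges Z'" "ends Z' (fe e) = (h (bd0 Z e), h (bd1 Z e))" if "e \<in> A" for e
  proof -
    have "map_prod h h (ends Z e) \<in> end_pairs Z'" using bij that by (auto simp: bij_betw_def)
    then show "fe e \<in> gedges Z'" "ends Z' (fe e) = (h (bd0 Z e), h (bd1 Z e))"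
      using inv_into_into[of "map_prod h h (ends Z e)" "ends Z'" "gedges Z'"]
        f_inv_into_f[of "map_prod h h (ends Z e)" "ends Z'" "gedges Z'"] by (auto simp: fe_def)
  qed
  have eq: "fe e = e'" if "e \<in> A" "e' \<in> gedges Z'" "ends Z' e' = (h (bd0 Z e), h (bd1 Z e))" for e e'
    using inj_onD[OF Z'.ends_inj] fe[OF that(1)] that by simp
  have "bij_betw fe A (gedges Z')"
    unfolding fe_def
  proof (rule bij_betw_trans[OF bij_betw_trans[OF _ bij]])
    show "bij_betw (ends Z) A (ends Z ` A)"
      using inj_on_subset[OF Z.ends_inj A] by (rule inj_on_imp_bij_betw)
    show "bij_betw (inv_into (gedges Z') (ends Z')) (end_pairs Z') (gedges Z')"
      by (rule bij_betw_inv_into[OF inj_on_imp_bij_betw[OF Z'.ends_inj]])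
  qed
  moreover have "fe (erev Z e) = erev Z' (fe e)" if e: "e \<in> A" for e
    using fe[OF e] e A by (intro eq rev) auto
  moreover have "fe (eact Z g e) = eact Z' g (fe e)" if g: "g \<in> carrier G" and e: "e \<in> A" for g e
  proof (rule eq[OF act[OF g e]])
    have eZ: "e \<in> gedges Z" using e A by auto
    show "eact Z' g (fe e) \<in> gedges Z'" using Z'.eact_closed g fe(1)[OF e] by auto
    show "ends Z' (eact Z' g (fe e)) = (h (bd0 Z (eact Z g e)), h (bd1 Z (eact Z g e)))"
      using Z'.bd_act[OF g fe(1)[OF e]] Z.bd_act[OF g eZ] fe[OF e] h[OF g] eZ by simp
  qed
  ultimately show ?thesis using fe by (intro exI[of _ fe]) auto
qed

lemma tree_iso_isomorphic:
  assumes "group G" "G_tree G Z" "G_tree G Z'"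
    and iso: "tree_iso G (gverts Z) (end_pairs Z) (vact Z) (gverts Z') (end_pairs Z') (vact Z') j"
  shows "isomorphic_G_graphs G Z Z'"
proof -
  interpret Z: G_tree_graph G Z using assms by (simp add: G_tree_graph_def G_tree_graph_axioms_def)
  interpret Z': G_tree_graph G Z' using assms by (simp add: G_tree_graph_def G_tree_graph_axioms_def)
  have j: "bij_betw j (gverts Z) (gverts Z')" "end_pairs Z' = map_prod j j ` end_pairs Z"
    "\<And>g v. g \<in> carrier G \<Longrightarrow> v \<in> gverts Z \<Longrightarrow> j (vact Z g v) = vact Z' g (j v)"
    using iso by (auto simp: tree_iso_def)
  have "inj_on (map_prod j j) (gverts Z \<times> gverts Z)"
    using j(1) by (intro map_prod_inj_on) (auto simp: bij_betw_def)
  then have "inj_on (map_prod j j) (end_pairs Z)" by (rule inj_on_subset) auto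
  then have "bij_betw (map_prod j j) (end_pairs Z) (end_pairs Z')" using j(2) by (simp add: bij_betw_def)
  from edge_map_exists[OF Z.G_tree_graph_axioms Z'.G_tree_graph_axioms subset_refl Z.B.arev_in_arcs Z.eact_closed j(3) this]
  show ?thesis unfolding isomorphic_G_graphs_def using j by blast
qed

text \<open>
  The classes of vertices in the definition of the collapse are the fibres of \<open>q\<close>, and an edge
  of the collapse corresponds to the edge of \<open>Z'\<close> between the images of its ends.
\<close>

lemma tree_collapse_elementary:
  assumes "group G" "G_tree G Z" "G_tree G Z'"
    and c: "tree_collapse G (gverts Z) (end_pairs Z) (vact Z) (gverts Z') (end_pairs Z') (vact Z') v w q"
  shows "elementary_collapse G Z Z'"
proof -
  interpret Z: G_tree_graph G Z using assms by (simp add: G_tree_graph_def G_tree_graph_axioms_def)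
  interpret Z': G_tree_graph G Z' using assms by (simp add: G_tree_graph_def G_tree_graph_axioms_def)
  let ?F = "collapsed_pairs G (vact Z) v w"
  have vw: "(v, w) \<in> end_pairs Z" and orb: "orbit G (vact Z) v \<noteq> orbit G (vact Z) w"
    and st: "stabilizer G (vact Z) v \<subseteq> stabilizer G (vact Z) w" and qV: "q ` gverts Z = gverts Z'"
    and qa: "\<And>g a. g \<in> carrier G \<Longrightarrow> a \<in> gverts Z \<Longrightarrow> q (vact Z g a) = vact Z' g (q a)"
    and qe: "\<And>a b. a \<in> gverts Z \<Longrightarrow> b \<in> gverts Z \<Longrightarrow> q a = q b \<longleftrightarrow> (a, b) \<in> ?F\<^sup>*"
    and E': "end_pairs Z' = map_prod q q ` (end_pairs Z - ?F)"
    using tree_collapseD[OF c] by simp_all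
  interpret Q: tree_quotient G "gverts Z" "end_pairs Z" "vact Z" ?F q "gverts Z'" "end_pairs Z'" "vact Z'"
    by unfold_locales (use Z.T.pairs_sub[OF vw] Z.T.pairs_sym[OF vw] Z.T.pairs_act[OF vw] qV qa qe E' in auto)
  obtain e where e: "e \<in> gedges Z" "bd0 Z e = v" "bd1 Z e = w" using vw by auto
  have wV: "v \<in> gverts Z" "w \<in> gverts Z" using e by auto
  let ?CE = "collapsed_edges G Z e" and ?cc = "collapse_class G Z e"
  have CE: "ends Z ` ?CE = ?F"
    unfolding collapsed_edges_def collapsed_pairs_def image_Un
    using Z.ends_orbit[OF e(1)] Z.ends_orbit[of "erev Z e"] e by simp
  have CEsub: "?CE \<subseteq> gedges Z"
    using e Z.eact_closed by (auto simp: collapsed_edges_def orbit_def)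
  have in_CE: "a \<in> ?CE \<longleftrightarrow> ends Z a \<in> ?F" if "a \<in> gedges Z" for a
    unfolding CE[symmetric] using inj_on_image_mem_iff[OF Z.ends_inj that CEsub] by simp
  have cc: "?cc a = {b. (a, b) \<in> ?F\<^sup>*}" for a
    unfolding collapse_class_def CE by simp
  have Fsym: "(b, a) \<in> ?F\<^sup>*" if "(a, b) \<in> ?F\<^sup>*" for a b
    using Z.T.pairs_sym[OF vw] that by (rule rtrancl_sym_set)
  have cc_eq: "?cc a = ?cc b \<longleftrightarrow> (a, b) \<in> ?F\<^sup>*" for a b
  proof
    show "(a, b) \<in> ?F\<^sup>*" if "?cc a = ?cc b" using that unfolding cc by blast
    show "?cc a = ?cc b" if "(a, b) \<in> ?F\<^sup>*" unfolding cc using that Fsym by (auto intro: rtrancl_trans)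
  qed
  have FV: "b \<in> gverts Z" if "(a, b) \<in> ?F\<^sup>*" "a \<in> gverts Z" for a b
    using that(1) that(2) by (rule rtrancl_closed) (use Z.T.pairs_sub[OF vw] in auto)
  have Fact: "(vact Z g a, vact Z g b) \<in> ?F\<^sup>*" if "g \<in> carrier G" "(a, b) \<in> ?F\<^sup>*" for g a b
    using that(2) by (rule rtrancl_map) (use Z.T.pairs_act[OF vw that(1)] in blast)
  have cc_act: "vact Z g ` ?cc a = ?cc (vact Z g a)" if g: "g \<in> carrier G" and a: "a \<in> gverts Z" for g a
  proof
    show "vact Z g ` ?cc a \<subseteq> ?cc (vact Z g a)" unfolding cc using Fact[OF g] by auto
    show "?cc (vact Z g a) \<subseteq> vact Z g ` ?cc a"
    proof
      fix b assume "b \<in> ?cc (vact Z g a)"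
      then have b: "(vact Z g a, b) \<in> ?F\<^sup>*" by (simp add: cc)
      then have "b \<in> gverts Z" using FV Z.T.act_closed g a by blast
      then have "b = vact Z g (vact Z (inv\<^bsub>G\<^esub> g) b)" using g by simp
      moreover have "(a, vact Z (inv\<^bsub>G\<^esub> g) b) \<in> ?F\<^sup>*"
        using Fact[OF Z.inv_closed[OF g] b] g a by simp
      ultimately show "b \<in> vact Z g ` ?cc a" unfolding cc by blast
    qed
  qed
  define fv where "fv S = q (SOME a. a \<in> gverts Z \<and> ?cc a = S)" for S
  have fv: "fv (?cc a) = q a" if a: "a \<in> gverts Z" for a
  proof -
    have "(SOME b. b \<in> gverts Z \<and> ?cc b = ?cc a) \<in> gverts Z \<and> ?cc (SOME b. b \<in> gverts Z \<and> ?cc b = ?cc a) = ?cc a"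
      by (rule someI[of "\<lambda>b. b \<in> gverts Z \<and> ?cc b = ?cc a" a]) (simp add: a)
    then show ?thesis unfolding fv_def using qe a cc_eq by blast
  qed
  have rev_CE: "erev Z a \<in> gedges Z - ?CE" if "a \<in> gedges Z - ?CE" for a
    using that in_CE[of a] in_CE[of "erev Z a"] Z.T.pairs_sym[OF vw] by auto
  have act_CE: "eact Z g a \<in> gedges Z - ?CE" if g: "g \<in> carrier G" and a: "a \<in> gedges Z - ?CE" for g a
  proof -
    have "ends Z a \<notin> ?F" using a in_CE by auto
    then have "ends Z (eact Z g a) \<notin> ?F"
      using Z.bd_act[OF g, of a] Q.F_act_iff[OF g] a by auto
    then show ?thesis using in_CE Z.eact_closed[OF g] a by auto
  qed
  have "bij_betw (map_prod q q) (ends Z ` (gedges Z - ?CE)) (end_pairs Z')"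
  proof -
    have "ends Z ` (gedges Z - ?CE) = end_pairs Z - ?F" using in_CE by auto
    moreover have "inj_on (map_prod q q) (end_pairs Z - ?F)"
    proof (rule inj_onI)
      fix x y assume xy: "x \<in> end_pairs Z - ?F" "y \<in> end_pairs Z - ?F" "map_prod q q x = map_prod q q y"
      obtain a b c d where "x = (a, b)" "y = (c, d)" by (metis surj_pair)
      then show "x = y" using Q.q_edge_inj[of a b c d] xy by simp
    qed
    ultimately show ?thesis using E' by (simp add: bij_betw_def)
  qed
  from edge_map_exists[OF Z.G_tree_graph_axioms Z'.G_tree_graph_axioms Diff_subset rev_CE act_CE qa this]
  obtain fe where fe: "bij_betw fe (gedges Z - ?CE) (gedges Z')"
    "\<forall>a\<in>gedges Z - ?CE. q (bd0 Z a) = bd0 Z' (fe a) \<and> q (bd1 Z a) = bd1 Z' (fe a) \<and> fe (erev Z a) = erev Z' (fe a)"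
    "\<forall>g\<in>carrier G. \<forall>a\<in>gedges Z - ?CE. fe (eact Z g a) = eact Z' g (fe a)"
    by blast
  have bij_fv: "bij_betw fv (?cc ` gverts Z) (gverts Z')"
  proof (rule bij_betw_imageI)
    show "inj_on fv (?cc ` gverts Z)"
    proof (rule inj_onI)
      fix S S' assume "S \<in> ?cc ` gverts Z" "S' \<in> ?cc ` gverts Z" "fv S = fv S'"
      then obtain a b where ab: "S = ?cc a" "S' = ?cc b" "a \<in> gverts Z" "b \<in> gverts Z" "q a = q b"
        using fv by auto
      then have "(a, b) \<in> ?F\<^sup>*" using qe by blast
      then show "S = S'" unfolding ab(1,2) using cc_eq by blast
    qed
    show "fv ` ?cc ` gverts Z = gverts Z'" using fv qV by (simp add: image_image)
  qed
  let ?C = "collapse G Z e"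
  have C: "gverts ?C = ?cc ` gverts Z" "gedges ?C = gedges Z - ?CE"
    "\<And>a. bd0 ?C a = ?cc (bd0 Z a)" "\<And>a. bd1 ?C a = ?cc (bd1 Z a)"
    "\<And>a. a \<in> gedges Z - ?CE \<Longrightarrow> erev ?C a = erev Z a"
    "\<And>g S. S \<in> ?cc ` gverts Z \<Longrightarrow> vact ?C g S = vact Z g ` S"
    "\<And>g a. a \<in> gedges Z - ?CE \<Longrightarrow> eact ?C g a = eact Z g a"
    by (simp_all add: collapse_def Let_def)
  have "isomorphic_G_graphs G ?C Z'"
    unfolding isomorphic_G_graphs_def C(1-4)
  proof (intro exI conjI ballI)
    show "bij_betw fv (?cc ` gverts Z) (gverts Z')" by (rule bij_fv)
    show "bij_betw fe (gedges Z - ?CE) (gedges Z')" by (rule fe)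
    fix a assume a: "a \<in> gedges Z - ?CE"
    show "fv (?cc (bd0 Z a)) = bd0 Z' (fe a)" "fv (?cc (bd1 Z a)) = bd1 Z' (fe a)"
      using fv fe(2) a by auto
    show "fe (erev ?C a) = erev Z' (fe a)"
      unfolding C(5)[OF a] using fe(2) a by blast
  next
    fix g S assume g: "g \<in> carrier G" and "S \<in> ?cc ` gverts Z"
    then obtain a where a: "S = ?cc a" "a \<in> gverts Z" by auto
    then show "fv (vact ?C g S) = vact Z' g (fv S)"
      using C(6)[of S g] cc_act[OF g a(2)] fv qa[OF g] Z.T.act_closed[OF g] by simp
  next
    fix g a assume g: "g \<in> carrier G" and a: "a \<in> gedges Z - ?CE"
    show "fe (eact ?C g a) = eact Z' g (fe a)"
      unfolding C(7)[OF a] using fe(3) g a by blast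
  qed
  moreover have "stabilizer G (vact Z) (bd0 Z e) = stabilizer G (eact Z) e"
  proof
    show "stabilizer G (vact Z) (bd0 Z e) \<subseteq> stabilizer G (eact Z) e"
    proof
      fix g assume "g \<in> stabilizer G (vact Z) (bd0 Z e)"
      then have g: "g \<in> carrier G" "vact Z g v = v" "vact Z g w = w"
        using e st by (auto simp: stabilizer_def)
      then have "ends Z (eact Z g e) = ends Z e" using Z.bd_act[OF g(1) e(1)] e by simp
      then show "g \<in> stabilizer G (eact Z) e"
        using g e Z.ends_inj Z.eact_closed by (auto simp: stabilizer_def dest: inj_onD)
    qed
    show "stabilizer G (eact Z) e \<subseteq> stabilizer G (vact Z) (bd0 Z e)"
    proof
      fix g assume "g \<in> stabilizer G (eact Z) e"
      then have g: "g \<in> carrier G" "eact Z g e = e" by (auto simp: stabilizer_def)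
      then show "g \<in> stabilizer G (vact Z) (bd0 Z e)"
        using Z.bd_act[OF g(1) e(1)] by (simp add: stabilizer_def)
    qed
  qed
  ultimately show ?thesis
    unfolding elementary_collapse_def using assms e orb by auto
qed

text \<open>
  Actions on a set are required to be extensional, hence the restriction.
\<close>

lemma (in set_action) restricted_action:
  assumes "\<And>g x. g \<in> carrier G \<Longrightarrow> x \<in> V \<Longrightarrow> act' g x = act g x"
  shows "group_action G V (\<lambda>g. restrict (act' g) V)"
proof (unfold group_action_def group_hom_def group_hom_axioms_def, intro conjI)
  have eq: "restrict (act' g) V = restrict (act g) V" if "g \<in> carrier G" for g
    using assms that by (intro restrict_ext) auto
  have bij: "restrict (act g) V \<in> Bij V" if g: "g \<in> carrier G" for g
  proof -
    have "bij_betw (act g) V V"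
      by (rule bij_betw_byWitness[where f' = "act (inv g)"]) (use g act_closed in auto)
    then show ?thesis by (simp add: Bij_def bij_betw_restrict_eq)
  qed
  show "group G" by (rule group_axioms)
  show "group (BijGroup V)" by (rule group_BijGroup)
  show "(\<lambda>g. restrict (act' g) V) \<in> hom G (BijGroup V)"
  proof (rule homI)
    show "restrict (act' g) V \<in> carrier (BijGroup V)" if "g \<in> carrier G" for g
      using bij eq that by (simp add: BijGroup_def)
    fix g h assume gh: "g \<in> carrier G" "h \<in> carrier G"
    have "restrict (act (g \<otimes> h)) V = compose V (restrict (act g) V) (restrict (act h) V)"
      using gh act_mult act_closed by (auto simp: compose_def fun_eq_iff restrict_def)
    then show "restrict (act' (g \<otimes> h)) V = restrict (act' g) V \<otimes>\<^bsub>BijGroup V\<^esub> restrict (act' h) V"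
      using gh bij eq by (simp add: BijGroup_def)
  qed
qed

section \<open>Realizing sequences of moves\<close>

text \<open>
  A relational tree can be realized by graphs of various types; any two are isomorphic, by
  \<open>models_isomorphic\<close>.
\<close>

definition models where
  "models G Z V E act \<longleftrightarrow> G_tree G Z \<and>
     (\<exists>j. tree_iso G V E act (gverts Z) (end_pairs Z) (vact Z) j)"

text \<open>
  The oriented edges are the elements of \<open>E\<close>, renamed by \<open>\<kappa>\<close> so as to have the required
  type. In a circuit, all edges except the first connect the ends of the first edge without
  using it in either direction, so it would not be a bridge.
\<close>

lemma pair_graph_G_tree:
  fixes V :: "'a set" and \<kappa> :: "'a \<times> 'a \<Rightarrow> 'e" and G :: "('g, 'm) monoid_scheme"
  assumes tree: "G_rel_tree G V E act" and inj: "inj_on \<kappa> E"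
  shows "\<exists>Z :: ('g, 'a, 'e) G_graph. G_tree G Z \<and> end_pairs Z = E \<and> gverts Z = V \<and>
    (\<forall>g. \<forall>v\<in>V. vact Z g v = act g v)"
proof -
  define arc where "arc = inv_into E \<kappa>"
  define Z :: "('g, 'a, 'e) G_graph" where
    "Z = \<lparr>gr = \<lparr>verts = V, arcs = \<kappa> ` E, tail = fst \<circ> arc, head = snd \<circ> arc\<rparr>,
     erev = (\<lambda>e. if e \<in> \<kappa> ` E then \<kappa> (prod.swap (arc e)) else e),
     vact = (\<lambda>g. restrict (act g) V),
     eact = (\<lambda>g. restrict (\<lambda>e. \<kappa> (pact act g (arc e))) (\<kappa> ` E))\<rparr>"
  interpret X: G_rel_tree G V E act by (rule tree)
  have arc: "arc (\<kappa> x) = x" if "x \<in> E" for x using inj that by (simp add: arc_def)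
  have swap: "prod.swap x \<in> E" if "x \<in> E" for x using X.edge_sym that by (cases x) auto
  have pactE: "pact act g x \<in> E" if "g \<in> carrier G" "x \<in> E" for g x
    using X.act_edge that by (cases x) auto
  have inj2: "\<kappa> x = \<kappa> y \<longleftrightarrow> x = y" if "x \<in> E" "y \<in> E" for x y using inj that by (auto dest: inj_onD)
  have neq: "fst x \<noteq> snd x" if "x \<in> E" for x using X.edge_neq that by (cases x) auto
  have EV: "fst x \<in> V" "snd x \<in> V" if "x \<in> E" for x using X.edge_verts that by (cases x; auto)+
  interpret W: wf_digraph "gr Z"
    by unfold_locales (auto simp: Z_def arc dest: X.edge_verts)
  have ep: "end_pairs Z = E" using arc by (force simp: Z_def image_image)
  have bidir: "bidirected_digraph (gr Z) (erev Z)"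
  proof (rule W.bidirected_digraphI)
    show "erev Z a = a" if "a \<notin> gedges Z" for a using that by (simp add: Z_def)
    fix a assume "a \<in> gedges Z"
    then obtain x where x: "a = \<kappa> x" "x \<in> E" by (auto simp: Z_def)
    then have r: "erev Z a = \<kappa> (prod.swap x)" by (simp add: Z_def arc)
    show "erev Z a \<noteq> a" unfolding r using x inj2[OF swap] neq[OF x(2)] by (cases x) auto
    show "erev Z (erev Z a) = a" unfolding r using x swap by (simp add: Z_def arc)
    show "bd0 Z (erev Z a) = bd1 Z a" unfolding r using x swap by (simp add: Z_def arc)
  qed
  then interpret B: bidirected_digraph "gr Z" "erev Z" .
  have arcs: "arcs_ends (gr Z) = E" unfolding ep[symmetric] by (auto simp: arcs_ends_def arc_to_ends_def)
  have con: "Digraph_Component.connected (gr Z)"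
    unfolding connected_conv arcs
  proof (intro conjI ballI)
    show "gverts Z \<noteq> {}" using X.nonempty by (simp add: Z_def)
    fix u v assume "u \<in> gverts Z" "v \<in> gverts Z"
    then have uv: "u \<in> V" "v \<in> V" by (simp_all add: Z_def)
    show "(u, v) \<in> rtrancl_on (gverts Z) (symcl E)"
      using X.connected[OF uv]
    proof (induction rule: rtrancl_induct)
      case base
      then show ?case using uv by (auto simp: Z_def)
    next
      case (step y z)
      have "z \<in> gverts Z" using X.edge_verts[OF step(2)] by (simp add: Z_def)
      then show ?case using step by (auto simp: symcl_def intro: rtrancl_on_into_rtrancl_on)
    qed
  qed
  have nocirc: "\<not> circuit (gr Z) (erev Z) p" for p
  proof
    assume c: "circuit (gr Z) (erev Z) p"
    then obtain u where u: "W.awalk u p u" "distinct (tl (W.awalk_verts u p))" "p \<noteq> []"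
      by (auto simp: circuit_def W.cycle_def)
    obtain e q where p: "p = e # q" using u by (cases p) auto
    have e: "e \<in> gedges Z" "bd0 Z e = u" "W.awalk (bd1 Z e) q u" using u p by (auto simp: W.awalk_Cons_iff)
    have dq: "distinct (W.awalk_verts (bd1 Z e) q)" using u p by auto
    have "ends Z e \<in> end_pairs Z" using e by blast
    then have ue: "(u, bd1 Z e) \<in> E" using ep e by auto
    have ends_eq: "a = b" if "a \<in> gedges Z" "b \<in> gedges Z" "ends Z a = ends Z b" for a b
    proof -
      obtain x y where xy: "a = \<kappa> x" "x \<in> E" "b = \<kappa> y" "y \<in> E"
        using \<open>a \<in> gedges Z\<close> \<open>b \<in> gedges Z\<close> unfolding Z_def by auto
      have "x = y" using that(3) arc[OF xy(2)] arc[OF xy(4)] xy by (simp add: Z_def prod_eq_iff)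
      then show ?thesis using xy by simp
    qed
    have qE: "set q \<subseteq> gedges Z" using e(3) by (auto simp: W.awalk_def)
    have "ends Z a \<notin> {(u, bd1 Z e), (bd1 Z e, u)}" if a: "a \<in> set q" for a
    proof
      have aE: "a \<in> gedges Z" using a qE by auto
      assume "ends Z a \<in> {(u, bd1 Z e), (bd1 Z e, u)}"
      then consider "ends Z a = ends Z e" | "ends Z a = ends Z (erev Z e)" using e by auto
      then show False
      proof cases
        case 1
        then have "a = e" using ends_eq aE e by blast
        obtain b r where q: "q = b # r" using a by (cases q) auto
        have w: "W.awalk (bd1 Z b) r u" "bd0 Z b = bd1 Z e" using e(3) q by (auto simp: W.awalk_Cons_iff)
        have "b \<noteq> e"
        proof
          assume "b = e"
          then have "bd0 Z e = bd1 Z e" using w by simp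
          then show False using ue e X.edge_irrefl by auto
        qed
        then have "e \<in> set r" using \<open>a = e\<close> a q by auto
        then have "bd1 Z e \<in> set (W.awalk_verts (bd1 Z b) r)" using W.awalk_verts_arc2[OF w(1)] by auto
        then show False using dq q w by auto
      next
        case 2
        then have "a = erev Z e" using ends_eq aE B.arev_in_arcs e by blast
        then show False using c p a by (auto simp: circuit_def)
      qed
    qed
    then have "set q \<subseteq> {a \<in> gedges Z. ends Z a \<notin> {(u, bd1 Z e), (bd1 Z e, u)}}" using qE by auto
    then have "(bd1 Z e, u) \<in> (ends Z ` {a \<in> gedges Z. ends Z a \<notin> {(u, bd1 Z e), (bd1 Z e, u)}})\<^sup>*"
      by (rule W.awalk_rtrancl_arcs[OF e(3)])
    then have "(bd1 Z e, u) \<in> (E - {(bd1 Z e, u), (u, bd1 Z e)})\<^sup>*"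
      by (rule rtrancl_mono[THEN subsetD, rotated]) (use ep in auto)
    then show False using X.bridge[OF X.edge_sym[OF ue]] by blast
  qed
  have va: "group_action G (gverts Z) (vact Z)"
    unfolding Z_def by (simp add: X.restricted_action)
  have ea: "group_action G (gedges Z) (eact Z)"
  proof -
    let ?ea = "\<lambda>g e. \<kappa> (pact act g (arc e))"
    interpret EA: set_action G "\<kappa> ` E" ?ea
    proof
      show "?ea g e \<in> \<kappa> ` E" if "g \<in> carrier G" "e \<in> \<kappa> ` E" for g e
        using that pactE arc by auto
      show "?ea \<one>\<^bsub>G\<^esub> e = e" if "e \<in> \<kappa> ` E" for e
        using that arc X.act_one X.edge_verts by auto
      show "?ea (g \<otimes>\<^bsub>G\<^esub> h) e = ?ea g (?ea h e)" if "g \<in> carrier G" "h \<in> carrier G" "e \<in> \<kappa> ` E" for g h e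
      proof -
        obtain x where x: "e = \<kappa> x" "x \<in> E" using \<open>e \<in> \<kappa> ` E\<close> by auto
        then show ?thesis using arc[OF x(2)] arc[OF pactE[OF that(2) x(2)]] X.act_mult[OF that(1,2)] EV[OF x(2)]
          by (cases x) auto
      qed
    qed
    show ?thesis unfolding Z_def by (simp add: EA.restricted_action)
  qed
  have eq: "bd0 Z (eact Z g e) = vact Z g (bd0 Z e) \<and> bd1 Z (eact Z g e) = vact Z g (bd1 Z e) \<and>
      eact Z g (erev Z e) = erev Z (eact Z g e) \<and> eact Z g e \<noteq> erev Z e"
    if g: "g \<in> carrier G" and e: "e \<in> gedges Z" for g e
  proof -
    obtain a b where x: "e = \<kappa> (a, b)" "(a, b) \<in> E" using e by (auto simp: Z_def)
    have V: "a \<in> V" "b \<in> V" using x X.edge_verts by auto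
    have s: "(b, a) \<in> E" using x X.edge_sym by auto
    have m: "(act g a, act g b) \<in> E" "(act g b, act g a) \<in> E" using X.act_edge[OF g] x s by auto
    have ee: "eact Z g e = \<kappa> (act g a, act g b)" "erev Z e = \<kappa> (b, a)"
      using x arc[OF x(2)] by (simp_all add: Z_def)
    have "eact Z g (erev Z e) = \<kappa> (act g b, act g a)" "erev Z (eact Z g e) = \<kappa> (act g b, act g a)"
      unfolding ee using arc[OF s] arc[OF m(1)] s m by (simp_all add: Z_def)
    moreover have "eact Z g e \<noteq> erev Z e"
      unfolding ee using inj2[OF m(1) s] X.no_inversion[OF g x(2)] by auto
    moreover have "bd0 Z (eact Z g e) = vact Z g (bd0 Z e)" "bd1 Z (eact Z g e) = vact Z g (bd1 Z e)"
      unfolding ee using arc[OF m(1)] arc[OF x(2)] x V by (simp_all add: Z_def)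
    ultimately show ?thesis by simp
  qed
  have "G_tree G Z" using bidir con nocirc va ea eq by (simp add: G_tree_def simplicial_tree_def)
  then show ?thesis using ep by (intro exI[of _ Z]) (simp add: Z_def)
qed

text \<open>
  Both vertices and edges fall into finitely many orbits, so they embed into pairs of a group
  element and a number, and from there into the given types.
\<close>

lemma model_exists:
  fixes V :: "'a set" and \<iota> :: "'g \<times> nat \<Rightarrow> 'v" and \<kappa> :: "'g \<times> nat \<Rightarrow> 'e"
    and G :: "('g, 'm) monoid_scheme"
  assumes tree: "G_rel_tree G V E act"
    and fin: "finite (orbits G V act)" "finite (orbits G E (pact act))"
    and inj: "inj \<iota>" "inj \<kappa>"
  shows "\<exists>Z :: ('g, 'v, 'e) G_graph. models G Z V E act"
proof -
  interpret X: G_rel_tree G V E act by (rule tree)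
  obtain i :: "'a \<Rightarrow> 'g \<times> nat" where i: "inj_on i V" using X.embedding_exists[OF fin(1)] by blast
  have "inj_on (\<iota> \<circ> i) V" using i inj(1) by (simp add: comp_inj_on inj_on_subset)
  then obtain act' where iso: "tree_iso G V E act ((\<iota> \<circ> i) ` V) (map_prod (\<iota> \<circ> i) (\<iota> \<circ> i) ` E) act' (\<iota> \<circ> i)"
    using X.iso_exists by blast
  let ?V = "(\<iota> \<circ> i) ` V" and ?E = "map_prod (\<iota> \<circ> i) (\<iota> \<circ> i) ` E"
  interpret X': G_rel_tree G ?V ?E act' by (rule X.tree_iso_tree[OF iso])
  interpret PA: set_action G ?E "pact act'" by (rule X'.pairs_action)
  have "finite (orbits G ?E (pact act'))" using X.iso_orbits(2)[OF iso] fin by simp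
  then obtain k :: "'v \<times> 'v \<Rightarrow> 'g \<times> nat" where k: "inj_on k ?E" using PA.embedding_exists by blast
  have "inj_on (\<kappa> \<circ> k) ?E" using k inj(2) by (simp add: comp_inj_on inj_on_subset)
  from pair_graph_G_tree[OF X'.G_rel_tree_axioms this]
  obtain Z :: "('g, 'v, 'e) G_graph" where Z: "G_tree G Z \<and> end_pairs Z = ?E \<and> gverts Z = ?V \<and>
    (\<forall>g. \<forall>v\<in>?V. vact Z g v = act' g v)" by (rule exE)
  note iso' = iso[unfolded tree_iso_def]
  have "(\<iota> \<circ> i) (act g v) = vact Z g ((\<iota> \<circ> i) v)" if "g \<in> carrier G" "v \<in> V" for g v
  proof -
    have "vact Z g ((\<iota> \<circ> i) v) = act' g ((\<iota> \<circ> i) v)" using Z that(2) by blast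
    then show ?thesis using iso' that by metis
  qed
  then have "tree_iso G V E act (gverts Z) (end_pairs Z) (vact Z) (\<iota> \<circ> i)"
    unfolding tree_iso_def using iso' Z by metis
  then show ?thesis using Z unfolding models_def by metis
qed

lemma models_isomorphic:
  assumes "G_rel_tree G V E act" "models G Z V E act" "models G Z' V E act"
  shows "isomorphic_G_graphs G Z Z'"
proof -
  interpret X: G_rel_tree G V E act by (rule assms)
  obtain i j where i: "tree_iso G V E act (gverts Z) (end_pairs Z) (vact Z) i"
    and j: "tree_iso G V E act (gverts Z') (end_pairs Z') (vact Z') j" and "G_tree G Z" "G_tree G Z'"
    using assms unfolding models_def by blast
  moreover interpret Z: G_rel_tree G "gverts Z" "end_pairs Z" "vact Z" by (rule X.tree_iso_tree[OF i])
  have "tree_iso G (gverts Z) (end_pairs Z) (vact Z) (gverts Z') (end_pairs Z') (vact Z') (j \<circ> inv_into V i)"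
    by (rule Z.tree_iso_trans[OF X.tree_iso_inv[OF i] j])
  ultimately show ?thesis using tree_iso_isomorphic X.is_group by blast
qed

lemma models_collapse:
  assumes "G_rel_tree G V E act" "models G Z V E act" "models G Z' V' E' act'"
    and c: "tree_collapse G V E act V' E' act' v w q"
  shows "elementary_collapse G Z Z'"
proof -
  interpret X: G_rel_tree G V E act by (rule assms)
  obtain i j where i: "tree_iso G V E act (gverts Z) (end_pairs Z) (vact Z) i"
    and j: "tree_iso G V' E' act' (gverts Z') (end_pairs Z') (vact Z') j" and Z: "G_tree G Z" "G_tree G Z'"
    using assms unfolding models_def by blast
  show ?thesis
    using tree_collapse_elementary[OF X.is_group Z X.tree_collapse_iso[OF c i j]] .
qed

lemma deforms_to_moves:
  fixes G :: "('g, 'm) monoid_scheme" and Z :: "('g, 'v + 'g \<times> nat, 'e + 'g \<times> nat) G_graph"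
  assumes "deforms_to G W D bct V E act" "G_rel_tree G V E act" "models G Z V E act"
  shows "\<exists>Z' :: ('g, 'v + 'g \<times> nat, 'e + 'g \<times> nat) G_graph.
    (elementary_move G)\<^sup>*\<^sup>* Z Z' \<and> models G Z' W D bct"
  using assms
proof (induction arbitrary: Z rule: deforms_to.induct)
  case (deform_iso V E act j)
  interpret X: G_rel_tree G V E act by (rule deform_iso)
  interpret Y: G_rel_tree G W D bct by (rule X.tree_iso_tree[OF deform_iso(1)])
  obtain i where "tree_iso G V E act (gverts Z) (end_pairs Z) (vact Z) i" "G_tree G Z"
    using deform_iso(3) unfolding models_def by blast
  then have "models G Z W D bct"
    using Y.tree_iso_trans[OF X.tree_iso_inv[OF deform_iso(1)]] unfolding models_def by blast
  then show ?case by blast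
next
  case (deform_collapse V E act V' E' act' v w q)
  obtain Z1 :: "('g, 'v + 'g \<times> nat, 'e + 'g \<times> nat) G_graph" where Z1: "models G Z1 V' E' act'"
    using model_exists[OF deform_collapse(2-4), of Inr Inr] by auto
  have "elementary_move G Z Z1"
    using models_collapse[OF deform_collapse(7,8) Z1 deform_collapse(1)] by (simp add: elementary_move_def)
  then show ?case using deform_collapse.IH[OF deform_collapse(2) Z1] by (meson converse_rtranclp_into_rtranclp)
next
  case (deform_expand V' E' act' V E act v w q)
  obtain Z1 :: "('g, 'v + 'g \<times> nat, 'e + 'g \<times> nat) G_graph" where Z1: "models G Z1 V' E' act'"
    using model_exists[OF deform_expand(2-4), of Inr Inr] by auto
  have "elementary_move G Z Z1"
    using models_collapse[OF deform_expand(2) Z1 deform_expand(8) deform_expand(1)] by (simp add: elementary_move_def)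
  then show ?case using deform_expand.IH[OF deform_expand(2) Z1] by (meson converse_rtranclp_into_rtranclp)
qed

lemma orbits_mono: "A \<subseteq> B \<Longrightarrow> orbits G A act \<subseteq> orbits G B act"
  unfolding orbits_def by blast

text \<open>
  Choose a fixed vertex for one representative of each orbit and translate it. This does not
  depend on the translating element, as the stabilizer of the representative fixes the chosen
  vertex.
\<close>

lemma equivariant_choice:
  fixes G :: "('g, 'm) monoid_scheme" and V :: "'b set" and W :: "'c set"
  assumes "set_action G V act" "set_action G W bct"
    and elliptic: "\<And>y. y \<in> W \<Longrightarrow> \<exists>x\<in>V. \<forall>g\<in>carrier G. bct g y = y \<longrightarrow> act g x = x"
  shows "\<exists>s. (\<forall>y\<in>W. s y \<in> V) \<and> (\<forall>g\<in>carrier G. \<forall>y\<in>W. s (bct g y) = act g (s y))"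
proof -
  interpret V: set_action G V act by (rule assms)
  interpret W: set_action G W bct by (rule assms)
  have "\<forall>y\<in>W. \<exists>x. x \<in> V \<and> (\<forall>g\<in>carrier G. bct g y = y \<longrightarrow> act g x = x)" using elliptic by blast
  then obtain x where x: "\<forall>y\<in>W. x y \<in> V \<and> (\<forall>g\<in>carrier G. bct g y = y \<longrightarrow> act g (x y) = x y)"
    by (rule bchoice[THEN exE])
  obtain rep elt where "\<forall>y\<in>W. rep (orbit G bct y) \<in> W \<and> elt y \<in> carrier G \<and> bct (elt y) (rep (orbit G bct y)) = y"
    using W.orbit_representatives by (elim exE)
  note r = bspec[OF this]
  define s where "s y = act (elt y) (x (rep (orbit G bct y)))" for y
  have "s y \<in> V" if "y \<in> W" for y
    unfolding s_def using V.act_closed r[OF that] x by blast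
  moreover have "s (bct g y) = act g (s y)" if g: "g \<in> carrier G" and y: "y \<in> W" for g y
  proof -
    let ?r = "rep (orbit G bct y)" and ?h = "elt y" and ?k = "elt (bct g y)"
    have O: "orbit G bct (bct g y) = orbit G bct y" by (rule W.orbit_act[OF g y])
    have h: "?h \<in> carrier G" "bct ?h ?r = y" using r[OF y] by auto
    have k: "?k \<in> carrier G" "bct ?k ?r = bct g y" using r[OF W.act_closed[OF g y]] O by auto
    have rW: "?r \<in> W" using r[OF y] by blast
    have xr: "x ?r \<in> V" using x rW by blast
    let ?m = "inv\<^bsub>G\<^esub> (g \<otimes>\<^bsub>G\<^esub> ?h) \<otimes>\<^bsub>G\<^esub> ?k"
    have gh: "g \<otimes>\<^bsub>G\<^esub> ?h \<in> carrier G" using g h by auto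
    have "bct (g \<otimes>\<^bsub>G\<^esub> ?h) ?r = bct g y" using W.act_mult[OF g h(1) rW] h by simp
    then have "bct ?m ?r = ?r"
      using W.act_mult[OF _ k(1) rW, of "inv\<^bsub>G\<^esub> (g \<otimes>\<^bsub>G\<^esub> ?h)"] gh k(2) W.act_inv[OF gh rW] by simp
    moreover have "?m \<in> carrier G" using gh k by auto
    ultimately have "act ?m (x ?r) = x ?r" using x rW by blast
    then have "act (inv\<^bsub>G\<^esub> (g \<otimes>\<^bsub>G\<^esub> ?h)) (act ?k (x ?r)) = x ?r"
      using V.act_mult[OF _ k(1) xr] gh by simp
    then have "act ?k (x ?r) = act (g \<otimes>\<^bsub>G\<^esub> ?h) (x ?r)"
      using V.act_inv2[OF gh V.act_closed[OF k(1) xr]] by simp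
    then show ?thesis unfolding s_def O using V.act_mult[OF g h(1) xr] by simp
  qed
  ultimately show ?thesis by blast
qed

theorem theorem1p3:
  fixes G :: "('g, 'm) monoid_scheme"
    and X :: "('g, 'v, 'e) G_graph"
    and Y :: "('g, 'w, 'f) G_graph"
    and fv :: "'v \<Rightarrow> 'w"
    and fe :: "'e \<Rightarrow> 'w + 'f"
  assumes "group G"
    and "G_tree G Y"
    and "\<not> trivial_G_tree G Y"
    and "locally_finite Y"
    and "fg_stabilizers G Y"
    and "G_tree G X"
    and "cocompact G X"
    and "simplicial_map X Y fv fe"
    and "equivariant_map G X Y fv fe"
    and "surjective_map X Y fv fe"
  shows "same_deformation_space G X Y"
proof -
  interpret X: G_tree_graph G X using assms by (simp add: G_tree_graph_def G_tree_graph_axioms_def)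
  interpret Y: G_tree_graph G Y using assms by (simp add: G_tree_graph_def G_tree_graph_axioms_def)
  let ?E = "end_pairs X" and ?D = "end_pairs Y"
  have fv: "fv v \<in> gverts Y" if "v \<in> gverts X" for v
    using assms(8) that by (auto simp: simplicial_map_def)
  have fe: "case fe e of Inl w \<Rightarrow> fv (bd0 X e) = w \<and> fv (bd1 X e) = w
      | Inr e' \<Rightarrow> e' \<in> gedges Y \<and> fv (bd0 X e) = bd0 Y e' \<and> fv (bd1 X e) = bd1 Y e'" if "e \<in> gedges X" for e
    using assms(8) that by (auto simp: simplicial_map_def split: sum.splits)
  have fact: "fv (vact X g v) = vact Y g (fv v)" if "g \<in> carrier G" "v \<in> gverts X" for g v
    using assms(9) that by (auto simp: equivariant_map_def)
  interpret F: G_tree_map G "gverts X" ?E "vact X" "gverts Y" ?D "vact Y" fv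
  proof
    show "fv a = fv b \<or> (fv a, fv b) \<in> ?D" if ab: "(a, b) \<in> ?E" for a b
    proof -
      from ab obtain e where e: "e \<in> gedges X" "a = bd0 X e" "b = bd1 X e" by auto
      show ?thesis
      proof (cases "fe e")
        case (Inl w)
        then show ?thesis using fe[OF e(1)] e by simp
      next
        case (Inr e')
        then have "e' \<in> gedges Y" "ends Y e' = (fv a, fv b)" using fe[OF e(1)] e by simp_all
        then show ?thesis by (intro disjI2 end_pairsI)
      qed
    qed
  qed (use fv fact in auto)
  have elliptic: "\<exists>x\<in>gverts X. \<forall>g\<in>carrier G. vact Y g y = y \<longrightarrow> vact X g x = x" if y: "y \<in> gverts Y" for y
  proof -
    obtain S where S: "finite S" "S \<subseteq> carrier G" "stabilizer G (vact Y) y = generate G S"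
      using assms(5) y unfolding fg_stabilizers_def finitely_generated_def by blast
    show ?thesis
    proof (rule F.elliptic[OF _ _ y S(1,2)])
      show "finite (?D `` {z})" if "z \<in> gverts Y" for z
      proof (rule finite_subset)
        show "?D `` {z} \<subseteq> bd1 Y ` out_arcs (gr Y) z" by (auto simp: out_arcs_def)
        show "finite (bd1 Y ` out_arcs (gr Y) z)" using assms(4) that by (auto simp: locally_finite_def)
      qed
      show "\<not> (\<exists>y\<in>gverts Y. \<forall>g\<in>carrier G. vact Y g y = y)"
        using assms(3) by (simp add: trivial_G_tree_def)
      show "{g \<in> carrier G. vact Y g y = y} = generate G S" using S(3) by (simp add: stabilizer_def)
    qed
  qed
  obtain s where s: "\<forall>y\<in>gverts Y. s y \<in> gverts X"
    "\<forall>g\<in>carrier G. \<forall>y\<in>gverts Y. s (vact Y g y) = vact X g (s y)"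
    using equivariant_choice[OF X.T.set_action_axioms Y.T.set_action_axioms elliptic] by blast
  have finV: "finite (orbits G (gverts X) (vact X))" and finE: "finite (orbits G ?E (pact (vact X)))"
    using assms(7) X.ends_orbits by (auto simp: cocompact_def)
  interpret S: G_tree_map_and_back G "gverts X" ?E "vact X" "gverts Y" ?D "vact Y" fv s
    by unfold_locales (use s finV finE in auto)
  have DE: "?D \<subseteq> map_prod fv fv ` ?E"
  proof
    fix d assume "d \<in> ?D"
    then obtain e' where e': "e' \<in> gedges Y" "d = ends Y e'" by auto
    then have "Inr e' \<in> fe ` gedges X" using assms(10) by (auto simp: surjective_map_def)
    then obtain e where e: "e \<in> gedges X" "fe e = Inr e'" by auto
    then have "d = map_prod fv fv (ends X e)" using fe[OF e(1)] e' by simp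
    then show "d \<in> map_prod fv fv ` ?E" using e by blast
  qed
  have WV: "gverts Y = fv ` gverts X" using assms(10) fv by (auto simp: surjective_map_def)
  have finW: "finite (orbits G (gverts Y) (vact Y))"
  proof -
    have "orbits G (fv ` gverts X) (vact Y) = (`) fv ` orbits G (gverts X) (vact X)"
      by (rule orbits_image) (rule fact)
    then show ?thesis using finV by (simp add: WV)
  qed
  have finD: "finite (orbits G ?D (pact (vact Y)))"
  proof (rule finite_subset)
    show "orbits G ?D (pact (vact Y)) \<subseteq> orbits G (map_prod fv fv ` ?E) (pact (vact Y))"
      by (rule orbits_mono[OF DE])
    have "orbits G (map_prod fv fv ` ?E) (pact (vact Y)) = (`) (map_prod fv fv) ` orbits G ?E (pact (vact X))"
    proof (rule orbits_image)
      fix g e assume g: "g \<in> carrier G" and "e \<in> ?E"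
      then obtain a b where "e = (a, b)" "a \<in> gverts X" "b \<in> gverts X" by auto
      then show "map_prod fv fv (pact (vact X) g e) = pact (vact Y) g (map_prod fv fv e)"
        using fact[OF g] by simp
    qed
    then show "finite (orbits G (map_prod fv fv ` ?E) (pact (vact Y)))" using finE by simp
  qed
  interpret YP: set_action G ?D "pact (vact Y)" by (rule Y.T.pairs_action)
  obtain R where R: "finite R" "R \<subseteq> ?D" "\<And>d. d \<in> ?D \<Longrightarrow> \<exists>r\<in>R. d \<in> orbit G (pact (vact Y)) r"
    using YP.finite_orbit_representatives[OF finD] by blast
  obtain Q where Q: "finite Q" "Q \<subseteq> gverts Y" "\<And>y. y \<in> gverts Y \<Longrightarrow> \<exists>r\<in>Q. y \<in> orbit G (vact Y) r"
    using Y.T.finite_orbit_representatives[OF finW] by blast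
  obtain j :: "'v \<Rightarrow> 'g \<times> nat" where j: "inj_on j (gverts X)" using X.T.embedding_exists[OF finV] by blast
  obtain act' where iso: "tree_iso G (gverts X) ?E (vact X) (j ` gverts X) (map_prod j j ` ?E) act' j"
    using X.T.iso_exists[OF j] by blast
  let ?V' = "j ` gverts X" and ?E' = "map_prod j j ` ?E"
  note S' = S.transport[OF iso]
  interpret S': G_tree_map_and_back G ?V' ?E' act' "gverts Y" ?D "vact Y" "fv \<circ> inv_into (gverts X) j" "j \<circ> s"
    by (rule S')
  have dt: "deforms_to G (gverts Y) ?D (vact Y) ?V' ?E' act'"
    by (rule deforms_to_target[OF S' R Q])
  obtain Z :: "('g, 'v + 'g \<times> nat, 'e + 'g \<times> nat) G_graph" where Z: "models G Z ?V' ?E' act'"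
    using model_exists[OF S'.X.G_rel_tree_axioms S'.fin_V S'.fin_E, of Inr Inr] by auto
  obtain Z' :: "('g, 'v + 'g \<times> nat, 'e + 'g \<times> nat) G_graph"
    where Z': "(elementary_move G)\<^sup>*\<^sup>* Z Z'" "models G Z' (gverts Y) ?D (vact Y)"
    using deforms_to_moves[OF dt S'.X.G_rel_tree_axioms Z] by blast
  have "models G X ?V' ?E' act'"
    using X.T.tree_iso_inv[OF iso] assms(6) unfolding models_def by blast
  then have "isomorphic_G_graphs G X Z" using models_isomorphic[OF S'.X.G_rel_tree_axioms _ Z] by blast
  moreover have "models G Y (gverts Y) ?D (vact Y)"
    unfolding models_def using assms(2) by (intro conjI exI[of _ id]) (auto simp: tree_iso_def map_prod.id bij_betw_def)
  then have "isomorphic_G_graphs G Z' Y" using models_isomorphic[OF Y.internal_tree Z'(2)] by blast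
  moreover have "G_tree G Z" "G_tree G Z'" using Z Z' by (auto simp: models_def)
  ultimately show ?thesis unfolding same_deformation_space_def using assms Z'(1) by blast
qed

end
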